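(* Let $R$ be a commutative ring, let $G$, $H$ and $K$ be finite groups, let $X$ be a subgroup of $H\times G$ and let $Y$ be a subgroup of $K\times H$. Let $M$ be an $RX$-module and let $N$ be an $RY$-module. Then there is an isomorphism of $(RK,RG)$-bimodules $$\big(\mathrm{Ind}_{Y}^{K\times H}N\big)\otimes_{RH}\big(\mathrm{Ind}_{X}^{H\times G}M\big)\;\cong\bigoplus_{t\in [p_2(Y)\backslash H/p_1(X)]}\mathrm{Ind}_{Y*{}^{(t,1)}X}^{K\times G}\Big(N\otimes_{k_2(Y)\cap{}^{t}k_1(X)}{}^{(t,1)}M\Big),$$ where $[p_2(Y)\backslash H/p_1(X)]$ is a set of representatives of the double cosets, where $$p_1(X)=\{h\in H\mid \exists g\in G,\ (h,g)\in X\},\qquad k_1(X)=\{h\in H\mid (h,1)\in X\},$$ $$p_2(Y)=\{h\in H\mid \exists k\in K,\ (k,h)\in Y\},\qquad k_2(Y)=\{h\in H\mid (1,h)\in Y\},$$ $$Y*{}^{(t,1)}X=\{(k,g)\in K\times G\mid \exists h\in H,\ (k,h)\in Y,\ (h^t,g)\in X\},$$ and where the action of $(k,g)\in Y*{}^{(t,1)}X$ on $N\otimes_{k_2(Y)\cap{}^{t}k_1(X)}{}^{(t,1)}M$ is given by $$(k,g)\cdot(n\otimes m)=k\cdot(n\otimes m)\cdot g^{-1}=(k\cdot n\cdot h^{-1})\otimes(h^t\cdot m\cdot g^{-1}),$$ if $h\in H$ is chosen such that $(k,h)\in Y$ and $(h^t,g)\in X$.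
   Context: Modules are left modules unless stated otherwise. For groups $A,B$, a left $R(A\times B)$-module $W$ is identified with an $(RA,RB)$-bimodule via $a\cdot w\cdot b^{-1}=(a,b)\cdot w$. This notation is extended to subgroups: if $X\le A\times B$ and $M$ is an $RX$-module, then for $m\in M$ and $(a,b)\in X$ one writes $a\cdot m\cdot b^{-1}=(a,b)\cdot m$. For a subgroup $X$ of a finite group $\Gamma$ and an $RX$-module $M$, $\mathrm{Ind}_X^{\Gamma}M=R\Gamma\otimes_{RX}M$. Induced modules from subgroups of $K\times H$, $H\times G$, $K\times G$ are regarded as bimodules via the identification above. Conjugation: $h^t=t^{-1}ht$, ${}^{t}k_1(X)=t\,k_1(X)\,t^{-1}$, ${}^{(t,1)}X=(t,1)X(t,1)^{-1}$. The module ${}^{(t,1)}M$ is the conjugate $R\,{}^{(t,1)}X$-module: it is $M$ as an $R$-module, and $(h,g)\in{}^{(t,1)}X$ acts on it as $(h^t,g)\in X$ acts on $M$. The tensor product $N\otimes_{k_2(Y)\cap{}^{t}k_1(X)}{}^{(t,1)}M$ is taken over the group algebra $R\big(k_2(Y)\cap{}^{t}k_1(X)\big)$, where $h\in k_2(Y)\cap{}^{t}k_1(X)$ acts on the right on $N$ by $n\cdot h=(1,h^{-1})\cdot n$ and on the left on ${}^{(t,1)}M$ by $m\mapsto (h^t,1)\cdot m$. *)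

theory Defs
  imports "HOL-Algebra.Module" "HOL-Algebra.Free_Abelian_Groups"
begin

section \<open>Modules and bimodules over not necessarily commutative rings\<close>

text \<open>The locale \<^locale>\<open>module\<close> of the library assumes a commutative ring of scalars. As there, the
  ring multiplication and unit that a module record inherits from \<^type>\<open>ring\<close> are irrelevant.\<close>

locale left_module = A?: ring A + M?: abelian_group M
    for A :: "('a, 'x) ring_scheme" (structure) and M :: "('a, 'm, 'z) module_scheme" (structure) +
  assumes smult_closed:
      "\<lbrakk>a \<in> carrier A; x \<in> carrier M\<rbrakk> \<Longrightarrow> a \<odot>\<^bsub>M\<^esub> x \<in> carrier M"
    and smult_l_distr:
      "\<lbrakk>a \<in> carrier A; b \<in> carrier A; x \<in> carrier M\<rbrakk> \<Longrightarrow>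
        (a \<oplus>\<^bsub>A\<^esub> b) \<odot>\<^bsub>M\<^esub> x = a \<odot>\<^bsub>M\<^esub> x \<oplus>\<^bsub>M\<^esub> b \<odot>\<^bsub>M\<^esub> x"
    and smult_r_distr:
      "\<lbrakk>a \<in> carrier A; x \<in> carrier M; y \<in> carrier M\<rbrakk> \<Longrightarrow>
        a \<odot>\<^bsub>M\<^esub> (x \<oplus>\<^bsub>M\<^esub> y) = a \<odot>\<^bsub>M\<^esub> x \<oplus>\<^bsub>M\<^esub> a \<odot>\<^bsub>M\<^esub> y"
    and smult_assoc:
      "\<lbrakk>a \<in> carrier A; b \<in> carrier A; x \<in> carrier M\<rbrakk> \<Longrightarrow>
        (a \<otimes>\<^bsub>A\<^esub> b) \<odot>\<^bsub>M\<^esub> x = a \<odot>\<^bsub>M\<^esub> (b \<odot>\<^bsub>M\<^esub> x)"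
    and smult_one:
      "x \<in> carrier M \<Longrightarrow> \<one>\<^bsub>A\<^esub> \<odot>\<^bsub>M\<^esub> x = x"

record ('a, 'b, 'm) bimodule = "('a, 'm) module" +
  rsmult :: "['m, 'b] \<Rightarrow> 'm"  (infixl \<open>\<odot>r\<index>\<close> 70)

locale right_module = B?: ring B + M?: abelian_group M
    for B :: "('b, 'y) ring_scheme" (structure)
    and M :: "('a, 'b, 'm, 'z) bimodule_scheme" (structure) +
  assumes rsmult_closed:
      "\<lbrakk>x \<in> carrier M; b \<in> carrier B\<rbrakk> \<Longrightarrow> x \<odot>r\<^bsub>M\<^esub> b \<in> carrier M"
    and rsmult_r_distr:
      "\<lbrakk>x \<in> carrier M; a \<in> carrier B; b \<in> carrier B\<rbrakk> \<Longrightarrow>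
        x \<odot>r\<^bsub>M\<^esub> (a \<oplus>\<^bsub>B\<^esub> b) = x \<odot>r\<^bsub>M\<^esub> a \<oplus>\<^bsub>M\<^esub> x \<odot>r\<^bsub>M\<^esub> b"
    and rsmult_l_distr:
      "\<lbrakk>x \<in> carrier M; y \<in> carrier M; b \<in> carrier B\<rbrakk> \<Longrightarrow>
        (x \<oplus>\<^bsub>M\<^esub> y) \<odot>r\<^bsub>M\<^esub> b = x \<odot>r\<^bsub>M\<^esub> b \<oplus>\<^bsub>M\<^esub> y \<odot>r\<^bsub>M\<^esub> b"
    and rsmult_assoc:
      "\<lbrakk>x \<in> carrier M; a \<in> carrier B; b \<in> carrier B\<rbrakk> \<Longrightarrow>
        x \<odot>r\<^bsub>M\<^esub> (a \<otimes>\<^bsub>B\<^esub> b) = (x \<odot>r\<^bsub>M\<^esub> a) \<odot>r\<^bsub>M\<^esub> b"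
    and rsmult_one:
      "x \<in> carrier M \<Longrightarrow> x \<odot>r\<^bsub>M\<^esub> \<one>\<^bsub>B\<^esub> = x"

locale bimodule = left_module A M + right_module B M
    for A :: "('a, 'x) ring_scheme" (structure) and B :: "('b, 'y) ring_scheme" (structure)
    and M :: "('a, 'b, 'm, 'z) bimodule_scheme" (structure) +
  assumes smult_rsmult:
      "\<lbrakk>a \<in> carrier A; x \<in> carrier M; b \<in> carrier B\<rbrakk> \<Longrightarrow>
        (a \<odot>\<^bsub>M\<^esub> x) \<odot>r\<^bsub>M\<^esub> b = a \<odot>\<^bsub>M\<^esub> (x \<odot>r\<^bsub>M\<^esub> b)"

definition bimodule_isos ::
    "('a, 'x) ring_scheme \<Rightarrow> ('b, 'y) ring_scheme \<Rightarrow> ('a, 'b, 'm, 'z) bimodule_scheme \<Rightarrow>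
     ('a, 'b, 'n, 'w) bimodule_scheme \<Rightarrow> ('m \<Rightarrow> 'n) set" where
  "bimodule_isos A B P Q = {\<phi>. bij_betw \<phi> (carrier P) (carrier Q) \<and>
     (\<forall>x\<in>carrier P. \<forall>y\<in>carrier P. \<phi> (x \<oplus>\<^bsub>P\<^esub> y) = \<phi> x \<oplus>\<^bsub>Q\<^esub> \<phi> y) \<and>
     (\<forall>a\<in>carrier A. \<forall>x\<in>carrier P. \<phi> (a \<odot>\<^bsub>P\<^esub> x) = a \<odot>\<^bsub>Q\<^esub> \<phi> x) \<and>
     (\<forall>x\<in>carrier P. \<forall>b\<in>carrier B. \<phi> (x \<odot>r\<^bsub>P\<^esub> b) = \<phi> x \<odot>r\<^bsub>Q\<^esub> b)}"

definition bimodule_isomorphic ::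
    "('a, 'x) ring_scheme \<Rightarrow> ('b, 'y) ring_scheme \<Rightarrow> ('a, 'b, 'm, 'z) bimodule_scheme \<Rightarrow>
     ('a, 'b, 'n, 'w) bimodule_scheme \<Rightarrow> bool" where
  "bimodule_isomorphic A B P Q \<longleftrightarrow>
     bimodule A B P \<and> bimodule A B Q \<and> bimodule_isos A B P Q \<noteq> {}"

definition bimodule_direct_sum ::
    "'i set \<Rightarrow> ('i \<Rightarrow> ('a, 'b, 'm, 'z) bimodule_scheme) \<Rightarrow> ('a, 'b, 'i \<Rightarrow> 'm) bimodule" where
  "bimodule_direct_sum I M = \<lparr>
     carrier = {f \<in> (\<Pi>\<^sub>E i\<in>I. carrier (M i)). finite {i\<in>I. f i \<noteq> \<zero>\<^bsub>M i\<^esub>}},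
     monoid.mult = undefined, one = undefined,
     ring.zero = (\<lambda>i\<in>I. \<zero>\<^bsub>M i\<^esub>),
     add = (\<lambda>f g. \<lambda>i\<in>I. f i \<oplus>\<^bsub>M i\<^esub> g i),
     smult = (\<lambda>a f. \<lambda>i\<in>I. a \<odot>\<^bsub>M i\<^esub> f i),
     rsmult = (\<lambda>f b. \<lambda>i\<in>I. f i \<odot>r\<^bsub>M i\<^esub> b)\<rparr>"


section \<open>Tensor products\<close>

text \<open>The tensor product of a right \<open>A\<close>-module \<open>P\<close> and a left \<open>A\<close>-module \<open>Q\<close> is the free abelian
  group on the set of pairs modulo the biadditivity and balancing relations; its elements are
  cosets of formal sums of pairs.\<close>

definition tensor_relators ::
    "('a, 'x) ring_scheme \<Rightarrow> ('c, 'a, 'm, 'z) bimodule_scheme \<Rightarrow> ('a, 'n, 'w) module_scheme \<Rightarrow>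
     ('m \<times> 'n \<Rightarrow>\<^sub>0 int) set" where
  "tensor_relators A P Q =
     {frag_of (p \<oplus>\<^bsub>P\<^esub> p', q) - (frag_of (p, q) + frag_of (p', q)) | p p' q.
        p \<in> carrier P \<and> p' \<in> carrier P \<and> q \<in> carrier Q} \<union>
     {frag_of (p, q \<oplus>\<^bsub>Q\<^esub> q') - (frag_of (p, q) + frag_of (p, q')) | p q q'.
        p \<in> carrier P \<and> q \<in> carrier Q \<and> q' \<in> carrier Q} \<union>
     {frag_of (p \<odot>r\<^bsub>P\<^esub> a, q) - frag_of (p, a \<odot>\<^bsub>Q\<^esub> q) | p a q.
        p \<in> carrier P \<and> a \<in> carrier A \<and> q \<in> carrier Q}"

definition tensor_free ::
    "('c, 'a, 'm, 'z) bimodule_scheme \<Rightarrow> ('a, 'n, 'w) module_scheme \<Rightarrow> ('m \<times> 'n \<Rightarrow>\<^sub>0 int) monoid" where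
  "tensor_free P Q = free_Abelian_group (carrier P \<times> carrier Q)"

definition tensor_kernel ::
    "('a, 'x) ring_scheme \<Rightarrow> ('c, 'a, 'm, 'z) bimodule_scheme \<Rightarrow> ('a, 'n, 'w) module_scheme \<Rightarrow>
     ('m \<times> 'n \<Rightarrow>\<^sub>0 int) set" where
  "tensor_kernel A P Q = generate (tensor_free P Q) (tensor_relators A P Q)"

definition tensor_class ::
    "('a, 'x) ring_scheme \<Rightarrow> ('c, 'a, 'm, 'z) bimodule_scheme \<Rightarrow> ('a, 'n, 'w) module_scheme \<Rightarrow>
     ('m \<times> 'n \<Rightarrow>\<^sub>0 int) \<Rightarrow> ('m \<times> 'n \<Rightarrow>\<^sub>0 int) set" where
  "tensor_class A P Q x = tensor_kernel A P Q #>\<^bsub>tensor_free P Q\<^esub> x"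

definition pure_tensor ::
    "('a, 'x) ring_scheme \<Rightarrow> ('c, 'a, 'm, 'z) bimodule_scheme \<Rightarrow> ('a, 'n, 'w) module_scheme \<Rightarrow>
     'm \<Rightarrow> 'n \<Rightarrow> ('m \<times> 'n \<Rightarrow>\<^sub>0 int) set" where
  "pure_tensor A P Q p q = tensor_class A P Q (frag_of (p, q))"

text \<open>\<open>tensor_map A P Q \<phi> \<psi>\<close> is the additive endomorphism of the tensor product with
  \<open>p \<otimes> q \<mapsto> \<phi> p \<otimes> \<psi> q\<close>, provided that this is well defined.\<close>

definition tensor_map ::
    "('a, 'x) ring_scheme \<Rightarrow> ('c, 'a, 'm, 'z) bimodule_scheme \<Rightarrow> ('a, 'n, 'w) module_scheme \<Rightarrow>
     ('m \<Rightarrow> 'm) \<Rightarrow> ('n \<Rightarrow> 'n) \<Rightarrow> ('m \<times> 'n \<Rightarrow>\<^sub>0 int) set \<Rightarrow> ('m \<times> 'n \<Rightarrow>\<^sub>0 int) set" where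
  "tensor_map A P Q \<phi> \<psi> w = the_elem
     ((\<lambda>x. tensor_class A P Q (frag_extend (\<lambda>(p, q). frag_of (\<phi> p, \<psi> q)) x)) ` w)"

text \<open>For a \<open>(C, A)\<close>-bimodule \<open>P\<close> and a left \<open>A\<close>-module \<open>Q\<close>, the tensor product is a left
  \<open>C\<close>-module; if \<open>Q\<close> is an \<open>(A, D)\<close>-bimodule, it is a \<open>(C, D)\<close>-bimodule.\<close>

definition tensor_module ::
    "('a, 'x) ring_scheme \<Rightarrow> ('c, 'a, 'm, 'z) bimodule_scheme \<Rightarrow> ('a, 'n, 'w) module_scheme \<Rightarrow>
     ('c, ('m \<times> 'n \<Rightarrow>\<^sub>0 int) set) module" where
  "tensor_module A P Q = (let T = tensor_free P Q Mod tensor_kernel A P Q in \<lparr>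
     carrier = carrier T,
     monoid.mult = undefined, one = undefined,
     ring.zero = \<one>\<^bsub>T\<^esub>,
     add = (\<otimes>\<^bsub>T\<^esub>),
     smult = (\<lambda>c. tensor_map A P Q (\<lambda>p. c \<odot>\<^bsub>P\<^esub> p) (\<lambda>q. q))\<rparr>)"

definition tensor_bimodule ::
    "('a, 'x) ring_scheme \<Rightarrow> ('c, 'a, 'm, 'z) bimodule_scheme \<Rightarrow> ('a, 'd, 'n, 'w) bimodule_scheme \<Rightarrow>
     ('c, 'd, ('m \<times> 'n \<Rightarrow>\<^sub>0 int) set) bimodule" where
  "tensor_bimodule A P Q = (let W = tensor_module A P Q in \<lparr>
     carrier = carrier W, monoid.mult = undefined, one = undefined, ring.zero = \<zero>\<^bsub>W\<^esub>, add = (\<oplus>\<^bsub>W\<^esub>),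
     smult = (\<odot>\<^bsub>W\<^esub>),
     rsmult = (\<lambda>w d. tensor_map A P Q (\<lambda>p. p) (\<lambda>q. q \<odot>r\<^bsub>Q\<^esub> d) w)\<rparr>)"


section \<open>Group algebras and induction\<close>

text \<open>The group algebra of a finite group \<open>G\<close>. Its elements are functions that vanish outside
  \<open>carrier G\<close>, so that the group algebra of a subgroup is literally a subring.\<close>

definition group_algebra ::
    "('r, 'x) ring_scheme \<Rightarrow> ('g, 'y) monoid_scheme \<Rightarrow> ('g \<Rightarrow> 'r) ring" where
  "group_algebra R G = \<lparr>
     carrier = {f. (\<forall>x\<in>carrier G. f x \<in> carrier R) \<and> (\<forall>x. x \<notin> carrier G \<longrightarrow> f x = \<zero>\<^bsub>R\<^esub>)},
     monoid.mult = (\<lambda>f g x. if x \<in> carrier G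
       then \<Oplus>\<^bsub>R\<^esub>y\<in>carrier G. f y \<otimes>\<^bsub>R\<^esub> g (inv\<^bsub>G\<^esub> y \<otimes>\<^bsub>G\<^esub> x) else \<zero>\<^bsub>R\<^esub>),
     one = (\<lambda>x. if x = \<one>\<^bsub>G\<^esub> then \<one>\<^bsub>R\<^esub> else \<zero>\<^bsub>R\<^esub>),
     ring.zero = (\<lambda>x. \<zero>\<^bsub>R\<^esub>),
     add = (\<lambda>f g x. f x \<oplus>\<^bsub>R\<^esub> g x)\<rparr>"

definition subgroup_algebra ::
    "('r, 'x) ring_scheme \<Rightarrow> ('g, 'y) monoid_scheme \<Rightarrow> 'g set \<Rightarrow> ('g \<Rightarrow> 'r) ring" where
  "subgroup_algebra R G X = group_algebra R (G\<lparr>carrier := X\<rparr>)"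

text \<open>\<open>ga_single R x r\<close> is the element \<open>r x\<close> of the group algebra, and \<open>ga_extend R S \<alpha>\<close> is the
  \<open>R\<close>-linear map between group algebras that extends the map \<open>\<alpha>\<close> defined on the finite group
  with underlying set \<open>S\<close>.\<close>

definition ga_single :: "('r, 'x) ring_scheme \<Rightarrow> 'g \<Rightarrow> 'r \<Rightarrow> 'g \<Rightarrow> 'r" where
  "ga_single R x r = (\<lambda>y. if y = x then r else \<zero>\<^bsub>R\<^esub>)"

definition ga_extend ::
    "('r, 'x) ring_scheme \<Rightarrow> 'g set \<Rightarrow> ('g \<Rightarrow> 'h) \<Rightarrow> ('g \<Rightarrow> 'r) \<Rightarrow> 'h \<Rightarrow> 'r" where
  "ga_extend R S \<alpha> f = (\<lambda>y. \<Oplus>\<^bsub>R\<^esub>x\<in>{x \<in> S. \<alpha> x = y}. f x)"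

definition group_act ::
    "('r, 'x) ring_scheme \<Rightarrow> ('g \<Rightarrow> 'r, 'm, 'z) module_scheme \<Rightarrow> 'g \<Rightarrow> 'm \<Rightarrow> 'm" where
  "group_act R M x m = ga_single R x \<one>\<^bsub>R\<^esub> \<odot>\<^bsub>M\<^esub> m"

text \<open>\<open>R G\<close> as an \<open>(R G, R X)\<close>-bimodule for a subgroup \<open>X\<close> of \<open>G\<close>.\<close>

definition regular_bimodule ::
    "('r, 'x) ring_scheme \<Rightarrow> ('g, 'y) monoid_scheme \<Rightarrow> ('g \<Rightarrow> 'r, 'g \<Rightarrow> 'r, 'g \<Rightarrow> 'r) bimodule" where
  "regular_bimodule R G = (let RG = group_algebra R G in \<lparr>
     carrier = carrier RG, monoid.mult = (\<otimes>\<^bsub>RG\<^esub>), one = \<one>\<^bsub>RG\<^esub>, ring.zero = \<zero>\<^bsub>RG\<^esub>, add = (\<oplus>\<^bsub>RG\<^esub>),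
     smult = (\<otimes>\<^bsub>RG\<^esub>), rsmult = (\<otimes>\<^bsub>RG\<^esub>)\<rparr>)"

definition Ind ::
    "('r, 'x) ring_scheme \<Rightarrow> ('g, 'y) monoid_scheme \<Rightarrow> 'g set \<Rightarrow> ('g \<Rightarrow> 'r, 'm, 'z) module_scheme \<Rightarrow>
     ('g \<Rightarrow> 'r, (('g \<Rightarrow> 'r) \<times> 'm \<Rightarrow>\<^sub>0 int) set) module" where
  "Ind R G X M = tensor_module (subgroup_algebra R G X) (regular_bimodule R G) M"

text \<open>An \<open>R(A \<times> B)\<close>-module as an \<open>(R A, R B)\<close>-bimodule, via \<open>a \<cdot> w \<cdot> b\<^sup>-\<^sup>1 = (a, b) \<cdot> w\<close>.\<close>

definition as_bimodule ::
    "('r, 'x) ring_scheme \<Rightarrow> ('a, 'y) monoid_scheme \<Rightarrow> ('b, 'z) monoid_scheme \<Rightarrow>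
     ('a \<times> 'b \<Rightarrow> 'r, 'm, 'w) module_scheme \<Rightarrow> ('a \<Rightarrow> 'r, 'b \<Rightarrow> 'r, 'm) bimodule" where
  "as_bimodule R A B W = \<lparr>
     carrier = carrier W, monoid.mult = undefined, one = undefined, ring.zero = \<zero>\<^bsub>W\<^esub>, add = (\<oplus>\<^bsub>W\<^esub>),
     smult = (\<lambda>f w. ga_extend R (carrier A) (\<lambda>a. (a, \<one>\<^bsub>B\<^esub>)) f \<odot>\<^bsub>W\<^esub> w),
     rsmult = (\<lambda>w f. ga_extend R (carrier B) (\<lambda>b. (\<one>\<^bsub>A\<^esub>, inv\<^bsub>B\<^esub> b)) f \<odot>\<^bsub>W\<^esub> w)\<rparr>"


section \<open>Subgroups of direct products\<close>

definition proj1 :: "('a, 'y) monoid_scheme \<Rightarrow> ('b, 'z) monoid_scheme \<Rightarrow> ('a \<times> 'b) set \<Rightarrow> 'a set" where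
  "proj1 A B X = {a \<in> carrier A. \<exists>b\<in>carrier B. (a, b) \<in> X}"

definition proj2 :: "('a, 'y) monoid_scheme \<Rightarrow> ('b, 'z) monoid_scheme \<Rightarrow> ('a \<times> 'b) set \<Rightarrow> 'b set" where
  "proj2 A B X = {b \<in> carrier B. \<exists>a\<in>carrier A. (a, b) \<in> X}"

definition ker1 :: "('a, 'y) monoid_scheme \<Rightarrow> ('b, 'z) monoid_scheme \<Rightarrow> ('a \<times> 'b) set \<Rightarrow> 'a set" where
  "ker1 A B X = {a \<in> carrier A. (a, \<one>\<^bsub>B\<^esub>) \<in> X}"

definition ker2 :: "('a, 'y) monoid_scheme \<Rightarrow> ('b, 'z) monoid_scheme \<Rightarrow> ('a \<times> 'b) set \<Rightarrow> 'b set" where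
  "ker2 A B X = {b \<in> carrier B. (\<one>\<^bsub>A\<^esub>, b) \<in> X}"

definition double_cosets :: "('h, 'y) monoid_scheme \<Rightarrow> 'h set \<Rightarrow> 'h set \<Rightarrow> 'h set set" where
  "double_cosets H U V = {U <#>\<^bsub>H\<^esub> {h} <#>\<^bsub>H\<^esub> V | h. h \<in> carrier H}"

definition double_coset_reps :: "('h, 'y) monoid_scheme \<Rightarrow> 'h set \<Rightarrow> 'h set \<Rightarrow> 'h set \<Rightarrow> bool" where
  "double_coset_reps H U V T \<longleftrightarrow>
     T \<subseteq> carrier H \<and> (\<forall>D\<in>double_cosets H U V. \<exists>!t. t \<in> T \<and> t \<in> D)"

text \<open>\<open>conj_by H t h\<close> is \<open>h\<^sup>t = t\<^sup>-\<^sup>1 h t\<close>, whereas the superscript \<open>t\<close> on the left, as in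
  \<open>conj_left\<close>, stands for \<open>t U t\<^sup>-\<^sup>1\<close>.\<close>

definition conj_by :: "('h, 'y) monoid_scheme \<Rightarrow> 'h \<Rightarrow> 'h \<Rightarrow> 'h" where
  "conj_by H t h = inv\<^bsub>H\<^esub> t \<otimes>\<^bsub>H\<^esub> h \<otimes>\<^bsub>H\<^esub> t"

definition conj_left :: "('h, 'y) monoid_scheme \<Rightarrow> 'h \<Rightarrow> 'h set \<Rightarrow> 'h set" where
  "conj_left H t U = (\<lambda>h. t \<otimes>\<^bsub>H\<^esub> h \<otimes>\<^bsub>H\<^esub> inv\<^bsub>H\<^esub> t) ` U"

text \<open>The composite of \<open>Y\<close> with the conjugate of \<open>X\<close> by \<open>(t, 1)\<close>.\<close>

definition star_conj ::
    "('k, 'u) monoid_scheme \<Rightarrow> ('h, 'v) monoid_scheme \<Rightarrow> ('g, 'w) monoid_scheme \<Rightarrow>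
     ('k \<times> 'h) set \<Rightarrow> 'h \<Rightarrow> ('h \<times> 'g) set \<Rightarrow> ('k \<times> 'g) set" where
  "star_conj K H G Y t X = {(k, g) \<in> carrier K \<times> carrier G.
     \<exists>h\<in>carrier H. (k, h) \<in> Y \<and> (conj_by H t h, g) \<in> X}"

definition mid_group ::
    "('k, 'u) monoid_scheme \<Rightarrow> ('h, 'v) monoid_scheme \<Rightarrow> ('g, 'w) monoid_scheme \<Rightarrow>
     ('k \<times> 'h) set \<Rightarrow> 'h \<Rightarrow> ('h \<times> 'g) set \<Rightarrow> 'h set" where
  "mid_group K H G Y t X = ker2 K H Y \<inter> conj_left H t (ker1 H G X)"


section \<open>The modules on the right-hand side of the formula\<close>

text \<open>The conjugate by \<open>(t, 1)\<close> of the \<open>R X\<close>-module \<open>M\<close>: a group element \<open>(h, g)\<close> acts on it as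
  \<open>(h\<^sup>t, g)\<close> does on \<open>M\<close>.\<close>

definition conj_module ::
    "('r, 'x) ring_scheme \<Rightarrow> ('h, 'v) monoid_scheme \<Rightarrow> ('g, 'w) monoid_scheme \<Rightarrow> ('h \<times> 'g) set \<Rightarrow> 'h \<Rightarrow>
     ('h \<times> 'g \<Rightarrow> 'r, 'm, 'z) module_scheme \<Rightarrow> ('h \<times> 'g \<Rightarrow> 'r, 'm) module" where
  "conj_module R H G X t M = \<lparr>
     carrier = carrier M, monoid.mult = undefined, one = undefined, ring.zero = \<zero>\<^bsub>M\<^esub>, add = (\<oplus>\<^bsub>M\<^esub>),
     smult = (\<lambda>f m. ga_extend R (conj_left (H \<times>\<times> G) (t, \<one>\<^bsub>G\<^esub>) X)
       (\<lambda>(h, g). (conj_by H t h, g)) f \<odot>\<^bsub>M\<^esub> m)\<rparr>"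

text \<open>For a subgroup \<open>S\<close> of \<open>ker1\<close> and of \<open>ker2\<close> respectively: the restriction to a left
  \<open>R S\<close>-module, where \<open>h\<close> acts as \<open>(h, 1)\<close>, and to an \<open>(R, R S)\<close>-bimodule, where \<open>h\<close> acts on the
  right as \<open>(1, h\<^sup>-\<^sup>1)\<close>.\<close>

definition left_restriction ::
    "('r, 'x) ring_scheme \<Rightarrow> ('b, 'z) monoid_scheme \<Rightarrow> 'a set \<Rightarrow>
     ('a \<times> 'b \<Rightarrow> 'r, 'm, 'w) module_scheme \<Rightarrow> ('a \<Rightarrow> 'r, 'm) module" where
  "left_restriction R B S M = \<lparr>
     carrier = carrier M, monoid.mult = undefined, one = undefined, ring.zero = \<zero>\<^bsub>M\<^esub>, add = (\<oplus>\<^bsub>M\<^esub>),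
     smult = (\<lambda>f m. ga_extend R S (\<lambda>h. (h, \<one>\<^bsub>B\<^esub>)) f \<odot>\<^bsub>M\<^esub> m)\<rparr>"

definition right_restriction ::
    "('r, 'x) ring_scheme \<Rightarrow> ('a, 'y) monoid_scheme \<Rightarrow> ('b, 'z) monoid_scheme \<Rightarrow> 'b set \<Rightarrow>
     ('a \<times> 'b \<Rightarrow> 'r, 'm, 'w) module_scheme \<Rightarrow> ('r, 'b \<Rightarrow> 'r, 'm) bimodule" where
  "right_restriction R A B S N = \<lparr>
     carrier = carrier N, monoid.mult = undefined, one = undefined, ring.zero = \<zero>\<^bsub>N\<^esub>, add = (\<oplus>\<^bsub>N\<^esub>),
     smult = (\<lambda>r n. ga_single R (\<one>\<^bsub>A\<^esub>, \<one>\<^bsub>B\<^esub>) r \<odot>\<^bsub>N\<^esub> n),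
     rsmult = (\<lambda>n f. ga_extend R S (\<lambda>h. (\<one>\<^bsub>A\<^esub>, inv\<^bsub>B\<^esub> h)) f \<odot>\<^bsub>N\<^esub> n)\<rparr>"

text \<open>The tensor product of \<open>N\<close> and the conjugate of \<open>M\<close> over the group algebra of
  \<^const>\<open>mid_group\<close>, first as an \<open>R\<close>-module, with its pure tensors and the operator
  \<open>n \<otimes> m \<mapsto> (k, h) n \<otimes> (h\<^sup>t, g) m\<close>, and then as a module over the group algebra of
  \<^const>\<open>star_conj\<close>.\<close>

definition mid_tensor ::
    "('r, 'x) ring_scheme \<Rightarrow> ('k, 'u) monoid_scheme \<Rightarrow> ('h, 'v) monoid_scheme \<Rightarrow>
     ('g, 'w) monoid_scheme \<Rightarrow> ('k \<times> 'h) set \<Rightarrow> 'h \<Rightarrow> ('h \<times> 'g) set \<Rightarrow>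
     ('k \<times> 'h \<Rightarrow> 'r, 'n, 'c) module_scheme \<Rightarrow> ('h \<times> 'g \<Rightarrow> 'r, 'm, 'd) module_scheme \<Rightarrow>
     ('r, ('n \<times> 'm \<Rightarrow>\<^sub>0 int) set) module" where
  "mid_tensor R K H G Y t X N M = (let S = mid_group K H G Y t X in
     tensor_module (subgroup_algebra R H S)
       (right_restriction R K H S N) (left_restriction R G S (conj_module R H G X t M)))"

definition mid_pure_tensor ::
    "('r, 'x) ring_scheme \<Rightarrow> ('k, 'u) monoid_scheme \<Rightarrow> ('h, 'v) monoid_scheme \<Rightarrow>
     ('g, 'w) monoid_scheme \<Rightarrow> ('k \<times> 'h) set \<Rightarrow> 'h \<Rightarrow> ('h \<times> 'g) set \<Rightarrow>
     ('k \<times> 'h \<Rightarrow> 'r, 'n, 'c) module_scheme \<Rightarrow> ('h \<times> 'g \<Rightarrow> 'r, 'm, 'd) module_scheme \<Rightarrow>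
     'n \<Rightarrow> 'm \<Rightarrow> ('n \<times> 'm \<Rightarrow>\<^sub>0 int) set" where
  "mid_pure_tensor R K H G Y t X N M = (let S = mid_group K H G Y t X in
     pure_tensor (subgroup_algebra R H S)
       (right_restriction R K H S N) (left_restriction R G S (conj_module R H G X t M)))"

definition mid_act ::
    "('r, 'x) ring_scheme \<Rightarrow> ('k, 'u) monoid_scheme \<Rightarrow> ('h, 'v) monoid_scheme \<Rightarrow>
     ('g, 'w) monoid_scheme \<Rightarrow> ('k \<times> 'h) set \<Rightarrow> 'h \<Rightarrow> ('h \<times> 'g) set \<Rightarrow>
     ('k \<times> 'h \<Rightarrow> 'r, 'n, 'c) module_scheme \<Rightarrow> ('h \<times> 'g \<Rightarrow> 'r, 'm, 'd) module_scheme \<Rightarrow>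
     'k \<Rightarrow> 'h \<Rightarrow> 'g \<Rightarrow> ('n \<times> 'm \<Rightarrow>\<^sub>0 int) set \<Rightarrow> ('n \<times> 'm \<Rightarrow>\<^sub>0 int) set" where
  "mid_act R K H G Y t X N M k h g = (let S = mid_group K H G Y t X in
     tensor_map (subgroup_algebra R H S)
       (right_restriction R K H S N) (left_restriction R G S (conj_module R H G X t M))
       (group_act R N (k, h)) (group_act R M (conj_by H t h, g)))"

text \<open>The group element \<open>(k, g)\<close> acts through an arbitrary choice of a linking element \<open>h\<close>; that the
  choice does not matter is part of the theorem.\<close>

definition mid_module ::
    "('r, 'x) ring_scheme \<Rightarrow> ('k, 'u) monoid_scheme \<Rightarrow> ('h, 'v) monoid_scheme \<Rightarrow>
     ('g, 'w) monoid_scheme \<Rightarrow> ('k \<times> 'h) set \<Rightarrow> 'h \<Rightarrow> ('h \<times> 'g) set \<Rightarrow>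
     ('k \<times> 'h \<Rightarrow> 'r, 'n, 'c) module_scheme \<Rightarrow> ('h \<times> 'g \<Rightarrow> 'r, 'm, 'd) module_scheme \<Rightarrow>
     ('k \<times> 'g \<Rightarrow> 'r, ('n \<times> 'm \<Rightarrow>\<^sub>0 int) set) module" where
  "mid_module R K H G Y t X N M = (let W = mid_tensor R K H G Y t X N M in \<lparr>
     carrier = carrier W, monoid.mult = undefined, one = undefined, ring.zero = \<zero>\<^bsub>W\<^esub>, add = (\<oplus>\<^bsub>W\<^esub>),
     smult = (\<lambda>f w. finsum W (\<lambda>(k, g). f (k, g) \<odot>\<^bsub>W\<^esub>
       mid_act R K H G Y t X N M k
         (SOME h. h \<in> carrier H \<and> (k, h) \<in> Y \<and> (conj_by H t h, g) \<in> X) g w)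
       (star_conj K H G Y t X))\<rparr>)"

end

theory Submission
  imports Defs
begin

text \<open>
  Both sides of the formula are described by additive generators and a universal property. The
  left-hand side is generated by the elements \<open>E k h g n m = ((k, 1) \<otimes> n) \<otimes> ((h, g) \<otimes> m)\<close> (\<open>ind_pure\<close>), and additive
  maps out of it are the families that are biadditive and \<open>R\<close>-balanced in \<open>(n, m)\<close> and satisfy
  \<open>E (k k\<^sub>0) h g n m = E k (u h) g ((k\<^sub>0, u) n) m\<close> for \<open>(k\<^sub>0, u) \<in> Y\<close> and
  \<open>E k (h v) (g g\<^sub>0) n m = E k h g n ((v, g\<^sub>0) m)\<close> for \<open>(v, g\<^sub>0) \<in> X\<close>. The summand at \<open>t\<close> is generated by
  \<open>D t k g n m = (k, g) \<otimes> (n \<otimes> m)\<close> (\<open>mid_ind\<close>) with the relation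
  \<open>D t (k k\<^sub>0) (g g\<^sub>0) n m = D t k g ((k\<^sub>0, h) n) ((h\<^sup>t, g\<^sub>0) m)\<close>, which for \<open>k\<^sub>0 = 1\<close> and \<open>g\<^sub>0 = 1\<close> contains
  the balancing over \<open>k\<^sub>2(Y) \<inter> \<^sup>tk\<^sub>1(X)\<close>. If \<open>h = u t v\<close> with \<open>(k\<^sub>0, u) \<in> Y\<close> and \<open>(v, g\<^sub>0) \<in> X\<close>, then
  \<open>E k h g n m \<mapsto> D t (k k\<^sub>0) (g g\<^sub>0\<^sup>-\<^sup>1) ((k\<^sub>0, u)\<^sup>-\<^sup>1 n) ((v, g\<^sub>0) m)\<close> does not depend on the choice
  of \<open>(k\<^sub>0, u)\<close> and \<open>(v, g\<^sub>0)\<close>, and its inverse is \<open>D t k g n m \<mapsto> E k t g n m\<close>.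
\<close>


section \<open>Additive maps and additive generators\<close>

text \<open>Both sides are iterated quotients of groups of formal sums, so no map out of them is
  given by a formula on elements. Maps are therefore obtained from universal properties for merely
  additive maps, and identities are checked on additive generators. Linearity over \<open>R\<close>
  can be left out of these universal properties because a coefficient can always be moved into
  \<open>n\<close> or \<open>m\<close>; it returns at the end as one more identity on generators.
  The forward map is forced by its inverse: for \<open>h = u t v\<close> the relations of the
  left-hand side rewrite \<open>E k h g n m\<close> as
  \<open>E (k k0) t (g g0^-1) ((k0, u)^-1 n) ((v, g0) m)\<close>. Independence of the choices has a
  single source. If \<open>u t v = u' t' v'\<close>, then \<open>t' = t\<close> by uniqueness of
  representatives, and \<open>w = u'^-1 u\<close> satisfies \<open>w^t = v' v^-1\<close>. Hence
  \<open>w\<close> links \<open>k0'^-1 k0\<close> with \<open>g0' g0^-1\<close>, and the relation of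
  the summand at \<open>t\<close> absorbs the difference of the two formulas.\<close>

definition add_hom :: "('a, 'x) ring_scheme \<Rightarrow> ('b, 'y) ring_scheme \<Rightarrow> ('a \<Rightarrow> 'b) set" where
  "add_hom P Z = {F. F \<in> carrier P \<rightarrow> carrier Z \<and>
     (\<forall>x\<in>carrier P. \<forall>y\<in>carrier P. F (x \<oplus>\<^bsub>P\<^esub> y) = F x \<oplus>\<^bsub>Z\<^esub> F y)}"

lemma add_homI:
  assumes "\<And>x. x \<in> carrier P \<Longrightarrow> F x \<in> carrier Z"
    and "\<And>x y. \<lbrakk>x \<in> carrier P; y \<in> carrier P\<rbrakk> \<Longrightarrow> F (x \<oplus>\<^bsub>P\<^esub> y) = F x \<oplus>\<^bsub>Z\<^esub> F y"
  shows "F \<in> add_hom P Z"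
  using assms by (auto simp: add_hom_def)

lemma add_hom_closed: "\<lbrakk>F \<in> add_hom P Z; x \<in> carrier P\<rbrakk> \<Longrightarrow> F x \<in> carrier Z"
  by (auto simp: add_hom_def)

lemma add_hom_add:
  "\<lbrakk>F \<in> add_hom P Z; x \<in> carrier P; y \<in> carrier P\<rbrakk> \<Longrightarrow> F (x \<oplus>\<^bsub>P\<^esub> y) = F x \<oplus>\<^bsub>Z\<^esub> F y"
  by (auto simp: add_hom_def)

lemma add_hom_zero:
  assumes "F \<in> add_hom P Z" "abelian_group P" "abelian_group Z"
  shows "F \<zero>\<^bsub>P\<^esub> = \<zero>\<^bsub>Z\<^esub>"
proof -
  interpret P: abelian_group P by fact
  interpret Z: abelian_group Z by fact
  have c: "F \<zero>\<^bsub>P\<^esub> \<in> carrier Z" using assms(1) by (simp add: add_hom_closed)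
  have "F \<zero>\<^bsub>P\<^esub> \<oplus>\<^bsub>Z\<^esub> F \<zero>\<^bsub>P\<^esub> = F \<zero>\<^bsub>P\<^esub>"
    using add_hom_add[OF assms(1), of "\<zero>\<^bsub>P\<^esub>" "\<zero>\<^bsub>P\<^esub>"] by simp
  with c show ?thesis
    by (metis Z.add.l_cancel_one)
qed

lemma add_hom_comp:
  "\<lbrakk>F \<in> add_hom P Q; F' \<in> add_hom Q Z\<rbrakk> \<Longrightarrow> (\<lambda>x. F' (F x)) \<in> add_hom P Z"
  by (auto simp: add_hom_def Pi_iff)

lemma add_hom_ident: "(\<lambda>x. x) \<in> add_hom P P"
  by (auto simp: add_hom_def)

lemma add_hom_plus:
  assumes "abelian_group P" "abelian_group Z" "F \<in> add_hom P Z" "F' \<in> add_hom P Z"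
  shows "(\<lambda>x. F x \<oplus>\<^bsub>Z\<^esub> F' x) \<in> add_hom P Z"
proof -
  interpret P: abelian_group P by fact
  interpret Z: abelian_group Z by fact
  show ?thesis
    using add_hom_closed[OF assms(3)] add_hom_closed[OF assms(4)]
    by (intro add_homI) (simp_all add: add_hom_add[OF assms(3)] add_hom_add[OF assms(4)] Z.a_ac)
qed

lemma add_hom_finsum:
  assumes "abelian_group P" "abelian_group Z" and "\<And>i. i \<in> I \<Longrightarrow> F i \<in> add_hom P Z"
  shows "(\<lambda>x. \<Oplus>\<^bsub>Z\<^esub>i\<in>I. F i x) \<in> add_hom P Z"
proof (rule add_homI)
  interpret P: abelian_group P by fact
  interpret Z: abelian_group Z by fact
  show "(\<Oplus>\<^bsub>Z\<^esub>i\<in>I. F i x) \<in> carrier Z" if "x \<in> carrier P" for x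
    using that assms(3) by (auto intro!: Z.finsum_closed dest: add_hom_closed)
  show "(\<Oplus>\<^bsub>Z\<^esub>i\<in>I. F i (x \<oplus>\<^bsub>P\<^esub> y)) = (\<Oplus>\<^bsub>Z\<^esub>i\<in>I. F i x) \<oplus>\<^bsub>Z\<^esub> (\<Oplus>\<^bsub>Z\<^esub>i\<in>I. F i y)"
    if "x \<in> carrier P" "y \<in> carrier P" for x y
  proof -
    have "(\<Oplus>\<^bsub>Z\<^esub>i\<in>I. F i (x \<oplus>\<^bsub>P\<^esub> y)) = (\<Oplus>\<^bsub>Z\<^esub>i\<in>I. F i x \<oplus>\<^bsub>Z\<^esub> F i y)"
      using that add_hom_add[OF assms(3)] add_hom_closed[OF assms(3)]
      by (intro Z.finsum_cong') auto
    also have "\<dots> = (\<Oplus>\<^bsub>Z\<^esub>i\<in>I. F i x) \<oplus>\<^bsub>Z\<^esub> (\<Oplus>\<^bsub>Z\<^esub>i\<in>I. F i y)"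
      using that assms(3) by (intro Z.finsum_addf) (auto dest: add_hom_closed)
    finally show ?thesis .
  qed
qed

text \<open>Generation by sums alone, without zero and negatives: an induction then has just the
  cases of a generator and of a sum. Nothing is lost for pure tensors and for multiples of group
  elements, since their negatives are again of this form.\<close>

definition add_generates :: "('a, 'x) ring_scheme \<Rightarrow> 'a set \<Rightarrow> bool" where
  "add_generates P S \<longleftrightarrow> S \<subseteq> carrier P \<and>
     (\<forall>U. S \<subseteq> U \<longrightarrow> (\<forall>x\<in>U \<inter> carrier P. \<forall>y\<in>U \<inter> carrier P. x \<oplus>\<^bsub>P\<^esub> y \<in> U) \<longrightarrow> carrier P \<subseteq> U)"

lemma add_generatesI:
  assumes "S \<subseteq> carrier P"
    and "\<And>U x. \<lbrakk>S \<subseteq> U; \<And>x y. \<lbrakk>x \<in> U; y \<in> U; x \<in> carrier P; y \<in> carrier P\<rbrakk> \<Longrightarrow> x \<oplus>\<^bsub>P\<^esub> y \<in> U;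
      x \<in> carrier P\<rbrakk> \<Longrightarrow> x \<in> U"
  shows "add_generates P S"
  unfolding add_generates_def
proof (intro conjI allI impI subsetI)
  fix U x
  assume "S \<subseteq> U" "\<forall>x\<in>U \<inter> carrier P. \<forall>y\<in>U \<inter> carrier P. x \<oplus>\<^bsub>P\<^esub> y \<in> U" "x \<in> carrier P"
  then show "x \<in> U" by (intro assms(2)[of U x]) simp_all
qed (use assms(1) in auto)

lemma add_generates_induct [consumes 2, case_names gen add]:
  assumes "add_generates P S" "x \<in> carrier P"
    and "\<And>s. s \<in> S \<Longrightarrow> A s"
    and "\<And>x y. \<lbrakk>x \<in> carrier P; y \<in> carrier P; A x; A y\<rbrakk> \<Longrightarrow> A (x \<oplus>\<^bsub>P\<^esub> y)"
  shows "A x"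
proof -
  have "carrier P \<subseteq> {x. A x}"
  proof -
    have "S \<subseteq> {x. A x} \<longrightarrow> (\<forall>x\<in>{x. A x} \<inter> carrier P. \<forall>y\<in>{x. A x} \<inter> carrier P.
        x \<oplus>\<^bsub>P\<^esub> y \<in> {x. A x}) \<longrightarrow> carrier P \<subseteq> {x. A x}"
      using assms(1) unfolding add_generates_def by (elim conjE allE)
    with assms(3,4) show ?thesis by (auto simp: subset_iff)
  qed
  with assms(2) show ?thesis by auto
qed

lemma add_generates_carrier: "add_generates P (carrier P)"
  by (rule add_generatesI) auto

text \<open>Transitivity of generation. The last assumption says that \<open>S\<close> lies in every
  additively closed set containing \<open>S'\<close>, which avoids a name for the additive span of
  \<open>S'\<close>.\<close>

lemma add_generates_trans:
  assumes "add_generates P S" "S' \<subseteq> carrier P"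
    and "\<And>U s. \<lbrakk>S' \<subseteq> U; \<And>x y. \<lbrakk>x \<in> U; y \<in> U; x \<in> carrier P; y \<in> carrier P\<rbrakk> \<Longrightarrow> x \<oplus>\<^bsub>P\<^esub> y \<in> U;
      s \<in> S\<rbrakk> \<Longrightarrow> s \<in> U"
  shows "add_generates P S'"
proof (rule add_generatesI)
  fix U x
  assume U: "S' \<subseteq> U" "\<And>x y. \<lbrakk>x \<in> U; y \<in> U; x \<in> carrier P; y \<in> carrier P\<rbrakk> \<Longrightarrow> x \<oplus>\<^bsub>P\<^esub> y \<in> U"
    and x: "x \<in> carrier P"
  from assms(1) x show "x \<in> U"
    by (induction rule: add_generates_induct) (use assms(3)[OF U] U(2) in auto)
qed (rule assms(2))

lemma add_generates_mono:
  assumes "add_generates P S" "S \<subseteq> S'" "S' \<subseteq> carrier P"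
  shows "add_generates P S'"
  by (rule add_generates_trans[OF assms(1,3)]) (use assms(2) in auto)

lemma add_hom_eqI:
  assumes "add_generates P S" "F \<in> add_hom P Z" "F' \<in> add_hom P Z"
    and "\<And>s. s \<in> S \<Longrightarrow> F s = F' s" and "x \<in> carrier P"
  shows "F x = F' x"
  using assms(1,5)
  by (induction rule: add_generates_induct) (simp_all add: assms(4) add_hom_add[OF assms(2)] add_hom_add[OF assms(3)])

section \<open>Biadditive maps\<close>

definition biadditive ::
    "('a, 'x) ring_scheme \<Rightarrow> ('b, 'y) ring_scheme \<Rightarrow> ('c, 'z) ring_scheme \<Rightarrow> ('a \<Rightarrow> 'b \<Rightarrow> 'c) \<Rightarrow> bool" where
  "biadditive P Q Z B \<longleftrightarrow> (\<forall>p\<in>carrier P. B p \<in> add_hom Q Z) \<and>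
     (\<forall>q\<in>carrier Q. (\<lambda>p. B p q) \<in> add_hom P Z)"

lemma biadditiveI:
  assumes "\<And>p q. \<lbrakk>p \<in> carrier P; q \<in> carrier Q\<rbrakk> \<Longrightarrow> B p q \<in> carrier Z"
    and "\<And>p p' q. \<lbrakk>p \<in> carrier P; p' \<in> carrier P; q \<in> carrier Q\<rbrakk> \<Longrightarrow>
      B (p \<oplus>\<^bsub>P\<^esub> p') q = B p q \<oplus>\<^bsub>Z\<^esub> B p' q"
    and "\<And>p q q'. \<lbrakk>p \<in> carrier P; q \<in> carrier Q; q' \<in> carrier Q\<rbrakk> \<Longrightarrow>
      B p (q \<oplus>\<^bsub>Q\<^esub> q') = B p q \<oplus>\<^bsub>Z\<^esub> B p q'"
  shows "biadditive P Q Z B"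
  using assms by (auto simp: biadditive_def intro!: add_homI)

lemma biadditive_homs:
  assumes "biadditive P Q Z B"
  shows "p \<in> carrier P \<Longrightarrow> B p \<in> add_hom Q Z" "q \<in> carrier Q \<Longrightarrow> (\<lambda>p. B p q) \<in> add_hom P Z"
  using assms by (auto simp: biadditive_def)

lemma biadditiveD:
  assumes "biadditive P Q Z B"
  shows "\<lbrakk>p \<in> carrier P; q \<in> carrier Q\<rbrakk> \<Longrightarrow> B p q \<in> carrier Z"
    and "\<lbrakk>p \<in> carrier P; p' \<in> carrier P; q \<in> carrier Q\<rbrakk> \<Longrightarrow>
      B (p \<oplus>\<^bsub>P\<^esub> p') q = B p q \<oplus>\<^bsub>Z\<^esub> B p' q"
    and "\<lbrakk>p \<in> carrier P; q \<in> carrier Q; q' \<in> carrier Q\<rbrakk> \<Longrightarrow>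
      B p (q \<oplus>\<^bsub>Q\<^esub> q') = B p q \<oplus>\<^bsub>Z\<^esub> B p q'"
  using assms by (auto simp: biadditive_def add_hom_def)

text \<open>The standard reduction for identities between actions: scalar multiplication is
  biadditive in scalar and vector, so associativity, balancing and linearity can be tested on
  multiples of single group elements and on pure tensors.\<close>

lemma biadditive_eqI:
  assumes "add_generates P S" "add_generates Q S'"
    and "biadditive P Q Z B" "biadditive P Q Z B'"
    and "\<And>s s'. \<lbrakk>s \<in> S; s' \<in> S'\<rbrakk> \<Longrightarrow> B s s' = B' s s'" and "p \<in> carrier P" "q \<in> carrier Q"
  shows "B p q = B' p q"
proof (rule add_hom_eqI[where F = "\<lambda>p. B p q" and F' = "\<lambda>p. B' p q", OF assms(1)])
  show "B s q = B' s q" if "s \<in> S" for s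
  proof -
    have "s \<in> carrier P" using that assms(1) by (auto simp: add_generates_def)
    then show ?thesis
      using add_hom_eqI[OF assms(2), of "B s" Z "B' s" q] that assms(3,4,5,7)
      by (auto dest: biadditive_homs)
  qed
qed (use assms in \<open>auto dest: biadditive_homs\<close>)

lemma biadditive_comp:
  assumes "biadditive P Q Z B" "F \<in> add_hom P' P" "F' \<in> add_hom Q' Q"
  shows "biadditive P' Q' Z (\<lambda>p q. B (F p) (F' q))"
  by (intro biadditiveI) (simp_all add: biadditiveD[OF assms(1)]
      add_hom_closed[OF assms(2)] add_hom_closed[OF assms(3)] add_hom_add[OF assms(2)] add_hom_add[OF assms(3)])

lemma biadditive_comp_hom:
  assumes "biadditive P Q Z B" "F \<in> add_hom Z Z'"
  shows "biadditive P Q Z' (\<lambda>p q. F (B p q))"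
  by (intro biadditiveI)
    (simp_all add: biadditiveD[OF assms(1)] add_hom_closed[OF assms(2)] add_hom_add[OF assms(2)])

lemma biadditive_flip: "biadditive P Q Z B \<Longrightarrow> biadditive Q P Z (\<lambda>q p. B p q)"
  by (auto simp: biadditive_def)

lemma abelian_group_cong:
  assumes "abelian_group P" "carrier Q = carrier P" "\<zero>\<^bsub>Q\<^esub> = \<zero>\<^bsub>P\<^esub>" "add Q = add P"
  shows "abelian_group Q"
  using abelian_groupE[OF assms(1)] by (intro abelian_groupI) (simp_all add: assms(2-4))

text \<open>Many records below share one additive group and differ in their scalar multiplications.
  The additive notions see only \<open>carrier\<close> and \<open>add\<close>, so these equations
  carry facts from one record to another.\<close>

lemma add_hom_cong:
  assumes "carrier P' = carrier P" "add P' = add P"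
  shows "add_hom P' Z = add_hom P Z" "add_hom Z P' = add_hom Z P"
    "add_generates P' = add_generates P"
    "biadditive P' Q Z = biadditive P Q Z" "biadditive Q P' Z = biadditive Q P Z"
    "biadditive Q Q' P' = biadditive Q Q' P"
  using assms by (auto simp: add_hom_def add_generates_def biadditive_def fun_eq_iff)


section \<open>Group algebras\<close>

lemma group_algebra_simps:
  "carrier (group_algebra R G) =
     {f. (\<forall>x\<in>carrier G. f x \<in> carrier R) \<and> (\<forall>x. x \<notin> carrier G \<longrightarrow> f x = \<zero>\<^bsub>R\<^esub>)}"
  "mult (group_algebra R G) = (\<lambda>f g x. if x \<in> carrier G
     then \<Oplus>\<^bsub>R\<^esub>y\<in>carrier G. f y \<otimes>\<^bsub>R\<^esub> g (inv\<^bsub>G\<^esub> y \<otimes>\<^bsub>G\<^esub> x) else \<zero>\<^bsub>R\<^esub>)"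
  "\<one>\<^bsub>group_algebra R G\<^esub> = ga_single R \<one>\<^bsub>G\<^esub> \<one>\<^bsub>R\<^esub>"
  "\<zero>\<^bsub>group_algebra R G\<^esub> = (\<lambda>x. \<zero>\<^bsub>R\<^esub>)"
  "add (group_algebra R G) = (\<lambda>f g x. f x \<oplus>\<^bsub>R\<^esub> g x)"
  by (auto simp: group_algebra_def ga_single_def fun_eq_iff)

abbreviation ga_singles :: "('r, 'x) ring_scheme \<Rightarrow> 'g set \<Rightarrow> ('g \<Rightarrow> 'r) set" where
  "ga_singles R X \<equiv> {ga_single R x r | x r. x \<in> X \<and> r \<in> carrier R}"

locale finite_group_algebra = R?: cring R + G?: group G
  for R :: "('r, 'x) ring_scheme" (structure) and G :: "('g, 'y) monoid_scheme" (structure) +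
  assumes finite_carrier: "finite (carrier G)"
begin

abbreviation "RG \<equiv> group_algebra R G"

lemma group_algebra_abelian_group: "abelian_group RG"
proof (rule abelian_groupI)
  fix f assume f: "f \<in> carrier RG"
  then have "(\<lambda>x. \<ominus> f x) \<in> carrier RG" "(\<lambda>x. \<ominus> f x) \<oplus>\<^bsub>RG\<^esub> f = \<zero>\<^bsub>RG\<^esub>"
    by (auto simp: group_algebra_simps R.l_neg fun_eq_iff) (metis R.l_neg R.zero_closed)
  then show "\<exists>y\<in>carrier RG. y \<oplus>\<^bsub>RG\<^esub> f = \<zero>\<^bsub>RG\<^esub>" by blast
next
  fix f g h assume *: "f \<in> carrier RG" "g \<in> carrier RG" "h \<in> carrier RG"
  show "f \<oplus>\<^bsub>RG\<^esub> g \<oplus>\<^bsub>RG\<^esub> h = f \<oplus>\<^bsub>RG\<^esub> (g \<oplus>\<^bsub>RG\<^esub> h)"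
  proof
    fix x show "(f \<oplus>\<^bsub>RG\<^esub> g \<oplus>\<^bsub>RG\<^esub> h) x = (f \<oplus>\<^bsub>RG\<^esub> (g \<oplus>\<^bsub>RG\<^esub> h)) x"
      using * by (cases "x \<in> carrier G") (auto simp: group_algebra_simps R.a_assoc)
  qed
next
  fix f g assume *: "f \<in> carrier RG" "g \<in> carrier RG"
  show "f \<oplus>\<^bsub>RG\<^esub> g = g \<oplus>\<^bsub>RG\<^esub> f"
  proof
    fix x show "(f \<oplus>\<^bsub>RG\<^esub> g) x = (g \<oplus>\<^bsub>RG\<^esub> f) x"
      using * by (cases "x \<in> carrier G") (auto simp: group_algebra_simps R.a_comm)
  qed
next
  fix f assume *: "f \<in> carrier RG"
  show "\<zero>\<^bsub>RG\<^esub> \<oplus>\<^bsub>RG\<^esub> f = f"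
  proof
    fix x show "(\<zero>\<^bsub>RG\<^esub> \<oplus>\<^bsub>RG\<^esub> f) x = f x"
      using * by (cases "x \<in> carrier G") (auto simp: group_algebra_simps)
  qed
qed (auto simp: group_algebra_simps)

lemma ga_single_closed: "\<lbrakk>x \<in> carrier G; r \<in> carrier R\<rbrakk> \<Longrightarrow> ga_single R x r \<in> carrier RG"
  by (auto simp: group_algebra_simps ga_single_def)

lemma ga_single_add:
  "\<lbrakk>r \<in> carrier R; s \<in> carrier R\<rbrakk> \<Longrightarrow>
    ga_single R x r \<oplus>\<^bsub>RG\<^esub> ga_single R x s = ga_single R x (r \<oplus> s)"
  by (auto simp: group_algebra_simps ga_single_def)

lemma ga_single_hom: "x \<in> carrier G \<Longrightarrow> ga_single R x \<in> add_hom R RG"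
  by (rule add_homI) (simp_all add: ga_single_closed ga_single_add)

lemma ga_single_zero: "ga_single R x \<zero> = \<zero>\<^bsub>RG\<^esub>"
  by (auto simp: group_algebra_simps ga_single_def)

lemma ga_single_mult:
  assumes "x \<in> carrier G" "y \<in> carrier G" "r \<in> carrier R" "s \<in> carrier R"
  shows "ga_single R x r \<otimes>\<^bsub>RG\<^esub> ga_single R y s = ga_single R (x \<otimes>\<^bsub>G\<^esub> y) (r \<otimes> s)"
proof
  fix z
  show "(ga_single R x r \<otimes>\<^bsub>RG\<^esub> ga_single R y s) z = ga_single R (x \<otimes>\<^bsub>G\<^esub> y) (r \<otimes> s) z"
  proof (cases "z \<in> carrier G")
    case True
    have "(\<Oplus>w\<in>carrier G. ga_single R x r w \<otimes> ga_single R y s (inv\<^bsub>G\<^esub> w \<otimes>\<^bsub>G\<^esub> z)) =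
      (\<Oplus>w\<in>carrier G. if x = w then r \<otimes> ga_single R y s (inv\<^bsub>G\<^esub> w \<otimes>\<^bsub>G\<^esub> z) else \<zero>)"
      using assms by (intro R.finsum_cong') (auto simp: ga_single_def)
    also have "\<dots> = r \<otimes> ga_single R y s (inv\<^bsub>G\<^esub> x \<otimes>\<^bsub>G\<^esub> z)"
      using assms finite_carrier by (intro R.finsum_singleton) (auto simp: ga_single_def)
    also have "\<dots> = ga_single R (x \<otimes>\<^bsub>G\<^esub> y) (r \<otimes> s) z"
      using assms True by (auto simp: ga_single_def G.inv_solve_left G.m_assoc[symmetric])
    finally show ?thesis using True by (simp add: group_algebra_simps)
  next
    case False
    with assms show ?thesis by (auto simp: group_algebra_simps ga_single_def)
  qed
qed

lemma ga_mult_closed: "\<lbrakk>f \<in> carrier RG; g \<in> carrier RG\<rbrakk> \<Longrightarrow> f \<otimes>\<^bsub>RG\<^esub> g \<in> carrier RG"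
  by (auto simp: group_algebra_simps intro!: R.finsum_closed)

lemma ga_mult_biadditive: "biadditive RG RG RG (\<otimes>\<^bsub>RG\<^esub>)"
proof (rule biadditiveI)
  fix f f' g assume *: "f \<in> carrier RG" "f' \<in> carrier RG" "g \<in> carrier RG"
  show "(f \<oplus>\<^bsub>RG\<^esub> f') \<otimes>\<^bsub>RG\<^esub> g = f \<otimes>\<^bsub>RG\<^esub> g \<oplus>\<^bsub>RG\<^esub> f' \<otimes>\<^bsub>RG\<^esub> g"
  proof
    fix x show "((f \<oplus>\<^bsub>RG\<^esub> f') \<otimes>\<^bsub>RG\<^esub> g) x = (f \<otimes>\<^bsub>RG\<^esub> g \<oplus>\<^bsub>RG\<^esub> f' \<otimes>\<^bsub>RG\<^esub> g) x"
      using * by (auto simp: group_algebra_simps Pi_iff R.l_distr simp flip: R.finsum_addf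
          intro!: R.finsum_cong')
  qed
  show "g \<otimes>\<^bsub>RG\<^esub> (f \<oplus>\<^bsub>RG\<^esub> f') = g \<otimes>\<^bsub>RG\<^esub> f \<oplus>\<^bsub>RG\<^esub> g \<otimes>\<^bsub>RG\<^esub> f'"
  proof
    fix x show "(g \<otimes>\<^bsub>RG\<^esub> (f \<oplus>\<^bsub>RG\<^esub> f')) x = (g \<otimes>\<^bsub>RG\<^esub> f \<oplus>\<^bsub>RG\<^esub> g \<otimes>\<^bsub>RG\<^esub> f') x"
      using * by (auto simp: group_algebra_simps Pi_iff R.r_distr simp flip: R.finsum_addf
          intro!: R.finsum_cong')
  qed
qed (rule ga_mult_closed)

lemma ga_generates: "add_generates RG (ga_singles R (carrier G))"
  (is "add_generates RG ?S")
proof (rule add_generatesI)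
  show "?S \<subseteq> carrier RG" by (auto intro: ga_single_closed)
  fix U f
  assume S: "?S \<subseteq> U" and f: "f \<in> carrier RG"
    and U: "\<And>x y. \<lbrakk>x \<in> U; y \<in> U; x \<in> carrier RG; y \<in> carrier RG\<rbrakk> \<Longrightarrow> x \<oplus>\<^bsub>RG\<^esub> y \<in> U"
  have "A \<subseteq> carrier G \<Longrightarrow> (\<lambda>x. if x \<in> A then f x else \<zero>) \<in> U" if "finite A" for A
    using that
  proof induction
    case empty
    \<comment> \<open>The zero function is itself a multiple of a group element, which starts the
      induction although \<open>add_generates\<close> supplies no zero.\<close>
    have "ga_single R \<one>\<^bsub>G\<^esub> \<zero> \<in> ?S" by auto
    with S show ?case by (auto simp: ga_single_zero group_algebra_simps)
  next
    case (insert a A)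
    have "(\<lambda>x. if x \<in> insert a A then f x else \<zero>) =
        ga_single R a (f a) \<oplus>\<^bsub>RG\<^esub> (\<lambda>x. if x \<in> A then f x else \<zero>)"
      using insert f by (auto simp: group_algebra_simps ga_single_def fun_eq_iff)
    moreover have "a \<in> carrier G" "f a \<in> carrier R"
      using insert.prems f by (auto simp: group_algebra_simps)
    then have "ga_single R a (f a) \<in> U" "ga_single R a (f a) \<in> carrier RG"
      using S by (blast, simp add: ga_single_closed)
    moreover have "(\<lambda>x. if x \<in> A then f x else \<zero>) \<in> carrier RG"
      using insert.prems f by (auto simp: group_algebra_simps)
    ultimately show ?case using insert U by auto
  qed
  from this[OF finite_carrier] have "(\<lambda>x. if x \<in> carrier G then f x else \<zero>) \<in> U" by simp
  also have "(\<lambda>x. if x \<in> carrier G then f x else \<zero>) = f"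
    using f by (auto simp: group_algebra_simps)
  finally show "f \<in> U" .
qed

lemma ga_eval_hom: "x \<in> carrier G \<Longrightarrow> (\<lambda>f. f x) \<in> add_hom RG R"
  by (rule add_homI) (auto simp: group_algebra_simps)

lemma ga_one_closed: "\<one>\<^bsub>RG\<^esub> \<in> carrier RG"
  by (simp add: group_algebra_simps(3) ga_single_closed)

lemma ga_mult_homs:
  assumes "f \<in> carrier RG"
  shows "(\<lambda>g. f \<otimes>\<^bsub>RG\<^esub> g) \<in> add_hom RG RG" "(\<lambda>g. g \<otimes>\<^bsub>RG\<^esub> f) \<in> add_hom RG RG"
  using biadditive_homs[OF ga_mult_biadditive] assms by blast+

text \<open>Associativity is additive in each of the three factors: \<open>single\<close> treats the
  third one for fixed multiples of group elements in the first two, and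
  \<open>biadditive_eqI\<close> then treats these.\<close>

lemma group_algebra_ring: "ring RG"
proof (rule ringI)
  show "monoid RG"
  proof (rule monoidI)
    fix f g h assume fgh: "f \<in> carrier RG" "g \<in> carrier RG" "h \<in> carrier RG"
    have single: "a \<otimes>\<^bsub>RG\<^esub> b \<otimes>\<^bsub>RG\<^esub> h = a \<otimes>\<^bsub>RG\<^esub> (b \<otimes>\<^bsub>RG\<^esub> h)"
      if ab_in: "a \<in> ga_singles R (carrier G)" "b \<in> ga_singles R (carrier G)" for a b
    proof (rule add_hom_eqI[OF ga_generates, where F = "\<lambda>h. a \<otimes>\<^bsub>RG\<^esub> b \<otimes>\<^bsub>RG\<^esub> h"
          and F' = "\<lambda>h. a \<otimes>\<^bsub>RG\<^esub> (b \<otimes>\<^bsub>RG\<^esub> h)"])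
      have ab: "a \<in> carrier RG" "b \<in> carrier RG" using that by (auto intro: ga_single_closed)
      show "(\<lambda>h. a \<otimes>\<^bsub>RG\<^esub> b \<otimes>\<^bsub>RG\<^esub> h) \<in> add_hom RG RG"
        using ab by (simp add: ga_mult_homs ga_mult_closed)
      show "(\<lambda>h. a \<otimes>\<^bsub>RG\<^esub> (b \<otimes>\<^bsub>RG\<^esub> h)) \<in> add_hom RG RG"
        using ab by (intro add_hom_comp[of "\<lambda>h. b \<otimes>\<^bsub>RG\<^esub> h" RG RG "\<lambda>h. a \<otimes>\<^bsub>RG\<^esub> h"] ga_mult_homs)
      show "a \<otimes>\<^bsub>RG\<^esub> b \<otimes>\<^bsub>RG\<^esub> s = a \<otimes>\<^bsub>RG\<^esub> (b \<otimes>\<^bsub>RG\<^esub> s)"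
        if "s \<in> ga_singles R (carrier G)" for s
        using that ab_in
        by (auto simp: ga_single_mult R.m_assoc G.m_assoc)
    qed fact
    show "f \<otimes>\<^bsub>RG\<^esub> g \<otimes>\<^bsub>RG\<^esub> h = f \<otimes>\<^bsub>RG\<^esub> (g \<otimes>\<^bsub>RG\<^esub> h)"
    proof (rule biadditive_eqI[OF ga_generates ga_generates, where B = "\<lambda>f g. f \<otimes>\<^bsub>RG\<^esub> g \<otimes>\<^bsub>RG\<^esub> h"
          and B' = "\<lambda>f g. f \<otimes>\<^bsub>RG\<^esub> (g \<otimes>\<^bsub>RG\<^esub> h)"])
      show "biadditive RG RG RG (\<lambda>f g. f \<otimes>\<^bsub>RG\<^esub> g \<otimes>\<^bsub>RG\<^esub> h)"
        using biadditive_comp_hom[OF ga_mult_biadditive ga_mult_homs(2)[OF fgh(3)]] .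
      show "biadditive RG RG RG (\<lambda>f g. f \<otimes>\<^bsub>RG\<^esub> (g \<otimes>\<^bsub>RG\<^esub> h))"
        using biadditive_comp[OF ga_mult_biadditive add_hom_ident ga_mult_homs(2)[OF fgh(3)]] .
    qed (use fgh single in auto)
  next
    fix f assume f: "f \<in> carrier RG"
    show "\<one>\<^bsub>RG\<^esub> \<otimes>\<^bsub>RG\<^esub> f = f"
      by (rule add_hom_eqI[OF ga_generates ga_mult_homs(1)[OF ga_one_closed] add_hom_ident _ f])
        (auto simp: group_algebra_simps(3) ga_single_mult)
    show "f \<otimes>\<^bsub>RG\<^esub> \<one>\<^bsub>RG\<^esub> = f"
      by (rule add_hom_eqI[OF ga_generates ga_mult_homs(2)[OF ga_one_closed] add_hom_ident _ f])
        (auto simp: group_algebra_simps(3) ga_single_mult)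
  qed (auto intro: ga_mult_closed ga_one_closed)
qed (auto simp: biadditiveD[OF ga_mult_biadditive] group_algebra_abelian_group)

section \<open>Linear extension of maps between groups\<close>

lemma ga_extend_closed:
  assumes "f \<in> carrier RG" "\<alpha> \<in> carrier G \<rightarrow> carrier B"
  shows "ga_extend R (carrier G) \<alpha> f \<in> carrier (group_algebra R B)"
proof -
  \<comment> \<open>Off the carrier of \<open>B\<close> the fibres of \<open>\<alpha>\<close> are
    empty, so the extension vanishes there, as membership in the group algebra requires.\<close>
  have *: "{x \<in> carrier G. \<alpha> x = y} = {}" if "y \<notin> carrier B" for y
    using assms(2) that by auto
  show ?thesis
    using assms(1) by (auto simp: group_algebra_simps ga_extend_def * intro!: R.finsum_closed)
qed

lemma ga_extend_hom:
  assumes "\<alpha> \<in> carrier G \<rightarrow> carrier B"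
  shows "ga_extend R (carrier G) \<alpha> \<in> add_hom RG (group_algebra R B)"
proof (rule add_homI)
  fix f g assume *: "f \<in> carrier RG" "g \<in> carrier RG"
  show "ga_extend R (carrier G) \<alpha> (f \<oplus>\<^bsub>RG\<^esub> g) =
      ga_extend R (carrier G) \<alpha> f \<oplus>\<^bsub>group_algebra R B\<^esub> ga_extend R (carrier G) \<alpha> g"
    using * by (auto simp: group_algebra_simps ga_extend_def fun_eq_iff intro!: R.finsum_addf)
qed (use assms in \<open>auto intro: ga_extend_closed\<close>)

lemma ga_extend_single:
  assumes "x \<in> carrier G" "r \<in> carrier R"
  shows "ga_extend R (carrier G) \<alpha> (ga_single R x r) = ga_single R (\<alpha> x) r"
proof
  fix y
  show "ga_extend R (carrier G) \<alpha> (ga_single R x r) y = ga_single R (\<alpha> x) r y"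
  proof (cases "\<alpha> x = y")
    case True
    have "(\<Oplus>z\<in>{z \<in> carrier G. \<alpha> z = y}. ga_single R x r z) =
        (\<Oplus>z\<in>{z \<in> carrier G. \<alpha> z = y}. if x = z then r else \<zero>)"
      using assms by (intro R.finsum_cong') (auto simp: ga_single_def)
    also have "\<dots> = r"
      using assms True finite_carrier
      by (intro R.finsum_singleton[where f = "\<lambda>_. r"]) auto
    finally show ?thesis using True by (simp add: ga_extend_def ga_single_def)
  next
    case False
    have "(\<Oplus>z\<in>{z \<in> carrier G. \<alpha> z = y}. ga_single R x r z) =
        (\<Oplus>z\<in>{z \<in> carrier G. \<alpha> z = y}. \<zero>)"
      using assms False by (intro R.finsum_cong') (auto simp: ga_single_def)
    also have "\<dots> = \<zero>" by (rule R.finsum_zero)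
    finally show ?thesis using False by (simp add: ga_extend_def ga_single_def)
  qed
qed

end

lemma finite_group_algebra_subgroup:
  assumes "finite_group_algebra R G" "subgroup X G"
  shows "finite_group_algebra R (G\<lparr>carrier := X\<rparr>)"
proof -
  interpret finite_group_algebra R G by fact
  interpret X: subgroup X G by fact
  interpret XG: group "G\<lparr>carrier := X\<rparr>" using X.subgroup_is_group G.group_axioms by blast
  show ?thesis
    using finite_subset[OF X.subset finite_carrier]
    by (intro finite_group_algebra.intro finite_group_algebra_axioms.intro R.cring_axioms XG.group_axioms) simp
qed

section \<open>Modules and their scalar multiplications as biadditive maps\<close>

lemma left_module_biadditive:
  assumes "left_module A M"
  shows "biadditive A M M (\<odot>\<^bsub>M\<^esub>)"
proof -
  interpret left_module A M by fact
  show ?thesis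
    by (intro biadditiveI smult_closed smult_l_distr smult_r_distr)
qed

lemma right_module_biadditive:
  assumes "right_module A M"
  shows "biadditive M A M (\<odot>r\<^bsub>M\<^esub>)"
proof -
  interpret right_module A M by fact
  show ?thesis
    by (intro biadditiveI rsmult_closed rsmult_l_distr rsmult_r_distr)
qed

lemma left_moduleI:
  assumes "ring A" "abelian_group M" "biadditive A M M (\<odot>\<^bsub>M\<^esub>)"
    and "\<And>a b x. \<lbrakk>a \<in> carrier A; b \<in> carrier A; x \<in> carrier M\<rbrakk> \<Longrightarrow>
      (a \<otimes>\<^bsub>A\<^esub> b) \<odot>\<^bsub>M\<^esub> x = a \<odot>\<^bsub>M\<^esub> (b \<odot>\<^bsub>M\<^esub> x)"
    and "\<And>x. x \<in> carrier M \<Longrightarrow> \<one>\<^bsub>A\<^esub> \<odot>\<^bsub>M\<^esub> x = x"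
  shows "left_module A M"
  using assms biadditiveD[OF assms(3)]
  by (intro left_module.intro left_module_axioms.intro) auto

lemma right_moduleI:
  assumes "ring A" "abelian_group M" "biadditive M A M (\<odot>r\<^bsub>M\<^esub>)"
    and "\<And>a b x. \<lbrakk>a \<in> carrier A; b \<in> carrier A; x \<in> carrier M\<rbrakk> \<Longrightarrow>
      x \<odot>r\<^bsub>M\<^esub> (a \<otimes>\<^bsub>A\<^esub> b) = (x \<odot>r\<^bsub>M\<^esub> a) \<odot>r\<^bsub>M\<^esub> b"
    and "\<And>x. x \<in> carrier M \<Longrightarrow> x \<odot>r\<^bsub>M\<^esub> \<one>\<^bsub>A\<^esub> = x"
  shows "right_module A M"
  using assms biadditiveD[OF assms(3)]
  by (intro right_module.intro right_module_axioms.intro) auto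

text \<open>Both sides are additive in \<open>p\<close>, in \<open>a\<close> and in \<open>q\<close>
  separately, so three generating sets suffice. Over the concrete group algebras below, balancing is
  verified in this way, with scalar multiples of group elements for \<open>a\<close>.\<close>

lemma balancedI:
  assumes P: "right_module A P" and Q: "left_module A Q" and B: "biadditive P Q Z B"
    and gen: "add_generates P SP" "add_generates A SA" "add_generates Q SQ"
    and bal: "\<And>p a q. \<lbrakk>p \<in> SP; a \<in> SA; q \<in> SQ\<rbrakk> \<Longrightarrow> B (p \<odot>r\<^bsub>P\<^esub> a) q = B p (a \<odot>\<^bsub>Q\<^esub> q)"
    and paq: "p \<in> carrier P" "a \<in> carrier A" "q \<in> carrier Q"
  shows "B (p \<odot>r\<^bsub>P\<^esub> a) q = B p (a \<odot>\<^bsub>Q\<^esub> q)"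
proof -
  note biP = right_module_biadditive[OF P] and biQ = left_module_biadditive[OF Q]
  have sub: "SP \<subseteq> carrier P" "SA \<subseteq> carrier A" using gen by (auto simp: add_generates_def)
  have 1: "B (p \<odot>r\<^bsub>P\<^esub> a) q = B p (a \<odot>\<^bsub>Q\<^esub> q)" if pa: "p \<in> SP" "a \<in> SA" for p a
  proof (rule add_hom_eqI[OF gen(3) _ _ bal[OF pa] paq(3)])
    have pa': "p \<in> carrier P" "a \<in> carrier A" using pa sub by auto
    show "(\<lambda>q. B (p \<odot>r\<^bsub>P\<^esub> a) q) \<in> add_hom Q Z"
      by (rule biadditive_homs(1)[OF B biadditiveD(1)[OF biP pa']])
    show "(\<lambda>q. B p (a \<odot>\<^bsub>Q\<^esub> q)) \<in> add_hom Q Z"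
      by (rule add_hom_comp[OF biadditive_homs(1)[OF biQ pa'(2)] biadditive_homs(1)[OF B pa'(1)]])
  qed
  show ?thesis
  proof (rule biadditive_eqI[OF gen(1,2) _ _ 1 paq(1,2)])
    show "biadditive P A Z (\<lambda>p a. B (p \<odot>r\<^bsub>P\<^esub> a) q)"
      by (rule biadditive_comp_hom[OF biP biadditive_homs(2)[OF B paq(3)]])
    show "biadditive P A Z (\<lambda>p a. B p (a \<odot>\<^bsub>Q\<^esub> q))"
      by (rule biadditive_comp[OF B add_hom_ident biadditive_homs(2)[OF biQ paq(3)]])
  qed
qed

context finite_group_algebra
begin

text \<open>Once the action is biadditive, its associativity is additive in both ring elements. It
  remains to multiply two scalar multiples of group elements, where the product in the group algebra
  is explicit.\<close>

lemma left_module_group_algebraI: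
  assumes "abelian_group M" "biadditive RG M M (\<odot>\<^bsub>M\<^esub>)"
    and mult: "\<And>x y r s m. \<lbrakk>x \<in> carrier G; y \<in> carrier G; r \<in> carrier R; s \<in> carrier R; m \<in> carrier M\<rbrakk> \<Longrightarrow>
      ga_single R x r \<odot>\<^bsub>M\<^esub> (ga_single R y s \<odot>\<^bsub>M\<^esub> m) = ga_single R (x \<otimes>\<^bsub>G\<^esub> y) (r \<otimes> s) \<odot>\<^bsub>M\<^esub> m"
    and "\<And>m. m \<in> carrier M \<Longrightarrow> ga_single R \<one>\<^bsub>G\<^esub> \<one> \<odot>\<^bsub>M\<^esub> m = m"
  shows "left_module RG M"
proof (rule left_moduleI)
  fix a b m assume abm: "a \<in> carrier RG" "b \<in> carrier RG" "m \<in> carrier M"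
  show "(a \<otimes>\<^bsub>RG\<^esub> b) \<odot>\<^bsub>M\<^esub> m = a \<odot>\<^bsub>M\<^esub> (b \<odot>\<^bsub>M\<^esub> m)"
  proof (rule biadditive_eqI[OF ga_generates ga_generates, where B = "\<lambda>a b. (a \<otimes>\<^bsub>RG\<^esub> b) \<odot>\<^bsub>M\<^esub> m"
        and B' = "\<lambda>a b. a \<odot>\<^bsub>M\<^esub> (b \<odot>\<^bsub>M\<^esub> m)"])
    show "biadditive RG RG M (\<lambda>a b. (a \<otimes>\<^bsub>RG\<^esub> b) \<odot>\<^bsub>M\<^esub> m)"
      using biadditive_comp_hom[OF ga_mult_biadditive biadditive_homs(2)[OF assms(2) abm(3)]] .
    show "biadditive RG RG M (\<lambda>a b. a \<odot>\<^bsub>M\<^esub> (b \<odot>\<^bsub>M\<^esub> m))"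
      using biadditive_comp[OF assms(2) add_hom_ident biadditive_homs(2)[OF assms(2) abm(3)]] .
  qed (use abm mult in \<open>auto simp: ga_single_mult\<close>)
qed (use assms group_algebra_ring in \<open>auto simp: group_algebra_simps(3)\<close>)

lemma right_module_group_algebraI:
  assumes "abelian_group M" "biadditive M RG M (\<odot>r\<^bsub>M\<^esub>)"
    and mult: "\<And>x y r s m. \<lbrakk>x \<in> carrier G; y \<in> carrier G; r \<in> carrier R; s \<in> carrier R; m \<in> carrier M\<rbrakk> \<Longrightarrow>
      (m \<odot>r\<^bsub>M\<^esub> ga_single R x r) \<odot>r\<^bsub>M\<^esub> ga_single R y s = m \<odot>r\<^bsub>M\<^esub> ga_single R (x \<otimes>\<^bsub>G\<^esub> y) (r \<otimes> s)"
    and "\<And>m. m \<in> carrier M \<Longrightarrow> m \<odot>r\<^bsub>M\<^esub> ga_single R \<one>\<^bsub>G\<^esub> \<one> = m"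
  shows "right_module RG M"
proof (rule right_moduleI)
  fix a b m assume abm: "a \<in> carrier RG" "b \<in> carrier RG" "m \<in> carrier M"
  show "m \<odot>r\<^bsub>M\<^esub> (a \<otimes>\<^bsub>RG\<^esub> b) = (m \<odot>r\<^bsub>M\<^esub> a) \<odot>r\<^bsub>M\<^esub> b"
  proof (rule biadditive_eqI[OF ga_generates ga_generates, where B = "\<lambda>a b. m \<odot>r\<^bsub>M\<^esub> (a \<otimes>\<^bsub>RG\<^esub> b)"
        and B' = "\<lambda>a b. (m \<odot>r\<^bsub>M\<^esub> a) \<odot>r\<^bsub>M\<^esub> b"])
    show "biadditive RG RG M (\<lambda>a b. m \<odot>r\<^bsub>M\<^esub> (a \<otimes>\<^bsub>RG\<^esub> b))"
      using biadditive_comp_hom[OF ga_mult_biadditive biadditive_homs(1)[OF assms(2) abm(3)]] .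
    show "biadditive RG RG M (\<lambda>a b. (m \<odot>r\<^bsub>M\<^esub> a) \<odot>r\<^bsub>M\<^esub> b)"
      using biadditive_comp[OF assms(2) biadditive_homs(1)[OF assms(2) abm(3)] add_hom_ident] .
  qed (use abm mult in \<open>auto simp: ga_single_mult\<close>)
qed (use assms group_algebra_ring in \<open>auto simp: group_algebra_simps(3)\<close>)

end


section \<open>Tensor products\<close>

locale tensor_pair =
  fixes A :: "('a, 'x) ring_scheme" and P :: "('c, 'a, 'm, 'z) bimodule_scheme"
    and Q :: "('a, 'n, 'w) module_scheme"
  assumes right: "right_module A P" and left: "left_module A Q"
begin

abbreviation "F \<equiv> tensor_free P Q"
abbreviation "N \<equiv> tensor_kernel A P Q"
abbreviation "T \<equiv> tensor_module A P Q"
abbreviation "cls \<equiv> tensor_class A P Q"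
abbreviation "pure \<equiv> pure_tensor A P Q"

sublocale P: abelian_group P using right by (simp add: right_module_def)
sublocale Q: abelian_group Q using left by (simp add: left_module_def)
sublocale F: comm_group F by (simp add: tensor_free_def abelian_free_Abelian_group)

lemma carrier_F: "x \<in> carrier F \<longleftrightarrow> Poly_Mapping.keys x \<subseteq> carrier P \<times> carrier Q"
  by (simp add: tensor_free_def)

lemma F_mult: "x \<otimes>\<^bsub>F\<^esub> y = x + y"
  by (simp add: tensor_free_def)

lemma F_add_closed: "\<lbrakk>x \<in> carrier F; y \<in> carrier F\<rbrakk> \<Longrightarrow> x + y \<in> carrier F"
  using F.m_closed by (simp add: F_mult)

lemma F_diff_closed: "\<lbrakk>x \<in> carrier F; y \<in> carrier F\<rbrakk> \<Longrightarrow> x - y \<in> carrier F"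
  using keys_diff[of x y] by (auto simp: carrier_F)

lemma frag_of_closed: "\<lbrakk>p \<in> carrier P; q \<in> carrier Q\<rbrakk> \<Longrightarrow> frag_of (p, q) \<in> carrier F"
  by (simp add: carrier_F)

lemma F_induct [consumes 1, case_names zero diff frag]:
  assumes "x \<in> carrier F" "S 0"
    and "\<And>x y. \<lbrakk>x \<in> carrier F; y \<in> carrier F; S x; S y\<rbrakk> \<Longrightarrow> S (x - y)"
    and "\<And>p q. \<lbrakk>p \<in> carrier P; q \<in> carrier Q\<rbrakk> \<Longrightarrow> S (frag_of (p, q))"
  shows "S x"
  using assms(1)[unfolded carrier_F]
  by (rule free_Abelian_group_induct) (use assms(2-4) in \<open>auto simp: carrier_F\<close>)

lemma rsmult_closed: "\<lbrakk>p \<in> carrier P; a \<in> carrier A\<rbrakk> \<Longrightarrow> p \<odot>r\<^bsub>P\<^esub> a \<in> carrier P"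
  using right by (rule right_module.rsmult_closed)

lemma smult_closed: "\<lbrakk>a \<in> carrier A; q \<in> carrier Q\<rbrakk> \<Longrightarrow> a \<odot>\<^bsub>Q\<^esub> q \<in> carrier Q"
  using left by (rule left_module.smult_closed)

lemma tensor_relators_subset: "tensor_relators A P Q \<subseteq> carrier F"
  by (auto simp: tensor_relators_def intro!: F_diff_closed F_add_closed frag_of_closed rsmult_closed smult_closed)

lemma N_subgroup: "subgroup N F"
  unfolding tensor_kernel_def by (rule F.generate_is_subgroup[OF tensor_relators_subset])

sublocale N: normal N F
  by (rule F.subgroup_imp_normal[OF N_subgroup])

lemma carrier_T: "carrier T = cls ` carrier F"
  by (simp add: tensor_module_def Let_def carrier_FactGroup tensor_class_def[abs_def])

lemma cls_add: "\<lbrakk>x \<in> carrier F; y \<in> carrier F\<rbrakk> \<Longrightarrow> cls x \<oplus>\<^bsub>T\<^esub> cls y = cls (x + y)"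
  by (simp add: tensor_module_def Let_def FactGroup_def tensor_class_def N.rcos_sum F_mult)

lemma tensor_abelian_group: "abelian_group T"
proof -
  have "comm_group (F Mod N)" by (rule F.abelian_FactGroup[OF N_subgroup])
  from comm_groupE[OF this] show ?thesis
    by (intro abelian_groupI) (auto simp: tensor_module_def Let_def)
qed

sublocale T: abelian_group T by (rule tensor_abelian_group)

lemma cls_zero: "cls 0 = \<zero>\<^bsub>T\<^esub>"
proof -
  have "0 \<in> carrier F" by (simp add: carrier_F)
  then have "cls 0 \<oplus>\<^bsub>T\<^esub> cls 0 = cls 0" "cls 0 \<in> carrier T" by (auto simp: cls_add carrier_T)
  then show ?thesis using T.add.l_cancel_one by auto
qed

lemma cls_eqI:
  assumes "x \<in> carrier F" "y \<in> carrier F" "x - y \<in> tensor_relators A P Q"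
  shows "cls x = cls y"
proof -
  have "x - y \<in> N" using assms(3) by (auto simp: tensor_kernel_def intro: generate.incl)
  then have "(x - y) \<otimes>\<^bsub>F\<^esub> y \<in> N #>\<^bsub>F\<^esub> y" using assms N.subset by (intro F.rcosI) auto
  then have "x \<in> N #>\<^bsub>F\<^esub> y" by (simp add: F_mult)
  from F.repr_independence[OF this assms(2) N_subgroup] show ?thesis
    by (simp add: tensor_class_def)
qed

lemma pure_closed: "\<lbrakk>p \<in> carrier P; q \<in> carrier Q\<rbrakk> \<Longrightarrow> pure p q \<in> carrier T"
  by (auto simp: carrier_T pure_tensor_def frag_of_closed)

lemma pure_biadditive: "biadditive P Q T pure"
proof (rule biadditiveI)
  fix p p' q assume *: "p \<in> carrier P" "p' \<in> carrier P" "q \<in> carrier Q"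
  then have "cls (frag_of (p \<oplus>\<^bsub>P\<^esub> p', q)) = cls (frag_of (p, q) + frag_of (p', q))"
    by (intro cls_eqI) (auto intro!: frag_of_closed F_add_closed simp: tensor_relators_def)
  with * show "pure (p \<oplus>\<^bsub>P\<^esub> p') q = pure p q \<oplus>\<^bsub>T\<^esub> pure p' q"
    by (simp add: pure_tensor_def cls_add frag_of_closed)
next
  fix p q q' assume *: "p \<in> carrier P" "q \<in> carrier Q" "q' \<in> carrier Q"
  then have "cls (frag_of (p, q \<oplus>\<^bsub>Q\<^esub> q')) = cls (frag_of (p, q) + frag_of (p, q'))"
    by (intro cls_eqI) (auto intro!: frag_of_closed F_add_closed simp: tensor_relators_def)
  with * show "pure p (q \<oplus>\<^bsub>Q\<^esub> q') = pure p q \<oplus>\<^bsub>T\<^esub> pure p q'"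
    by (simp add: pure_tensor_def cls_add frag_of_closed)
qed (rule pure_closed)

lemma pure_balanced:
  assumes "p \<in> carrier P" "a \<in> carrier A" "q \<in> carrier Q"
  shows "pure (p \<odot>r\<^bsub>P\<^esub> a) q = pure p (a \<odot>\<^bsub>Q\<^esub> q)"
  unfolding pure_tensor_def using assms
  by (intro cls_eqI frag_of_closed rsmult_closed smult_closed) (auto simp: tensor_relators_def)

text \<open>The negative of \<open>p \<otimes> q\<close> is \<open>p \<otimes> (- q)\<close>, so
  sums of pure tensors already exhaust the quotient of the free abelian group.\<close>

lemma pure_generates_carrier: "add_generates T {pure p q | p q. p \<in> carrier P \<and> q \<in> carrier Q}"
  (is "add_generates T ?S")
proof (rule add_generatesI)
  show "?S \<subseteq> carrier T" by (auto intro: pure_closed)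
  fix U w
  assume S: "?S \<subseteq> U" and w: "w \<in> carrier T"
    and U: "\<And>x y. \<lbrakk>x \<in> U; y \<in> U; x \<in> carrier T; y \<in> carrier T\<rbrakk> \<Longrightarrow> x \<oplus>\<^bsub>T\<^esub> y \<in> U"
  have homs: "\<And>p. p \<in> carrier P \<Longrightarrow> pure p \<zero>\<^bsub>Q\<^esub> = \<zero>\<^bsub>T\<^esub>"
    using add_hom_zero[OF biadditive_homs(1)[OF pure_biadditive] Q.abelian_group_axioms T.abelian_group_axioms] .
  have zero_U: "\<zero>\<^bsub>T\<^esub> \<in> U"
    using S homs[of "\<zero>\<^bsub>P\<^esub>"] by auto
  have neg: "pure p (\<ominus>\<^bsub>Q\<^esub> q) = \<ominus>\<^bsub>T\<^esub> pure p q" if "p \<in> carrier P" "q \<in> carrier Q" for p q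
  proof -
    have "pure p (\<ominus>\<^bsub>Q\<^esub> q) \<oplus>\<^bsub>T\<^esub> pure p q = \<zero>\<^bsub>T\<^esub>"
      using that homs by (simp add: biadditiveD(3)[OF pure_biadditive, symmetric] Q.l_neg)
    then show ?thesis using that pure_closed by (simp add: T.minus_equality)
  qed
  obtain x where x: "x \<in> carrier F" "w = cls x" using w by (auto simp: carrier_T)
  \<comment> \<open>Induction on the free abelian group runs over differences, while
    \<open>U\<close> is closed under sums only; hence the negative is carried along.\<close>
  have "cls x \<in> U \<and> \<ominus>\<^bsub>T\<^esub> cls x \<in> U"
    using x(1)
  proof (induction x rule: F_induct)
    case zero
    then show ?case using zero_U T.minus_equality[OF T.l_zero[OF T.zero_closed] T.zero_closed T.zero_closed]
      by (simp only: cls_zero)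
  next
    case (diff x y)
    then have xy: "x \<in> carrier F" "y \<in> carrier F" "x - y \<in> carrier F"
      by (auto intro: F_diff_closed)
    then have c: "cls x \<in> carrier T" "cls y \<in> carrier T" "cls (x - y) \<in> carrier T"
      by (auto simp: carrier_T)
    have "cls (x - y) \<oplus>\<^bsub>T\<^esub> cls y = cls x" using xy by (simp add: cls_add)
    then have eq: "cls (x - y) = cls x \<oplus>\<^bsub>T\<^esub> \<ominus>\<^bsub>T\<^esub> cls y"
      using c by (metis T.add.inv_solve_right)
    then have "\<ominus>\<^bsub>T\<^esub> cls (x - y) = \<ominus>\<^bsub>T\<^esub> cls x \<oplus>\<^bsub>T\<^esub> cls y"
      using c by (simp add: T.minus_add)
    with eq diff c U show ?case by auto
  next
    case (frag p q)
    note pq = frag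
    have "pure p q \<in> U" "pure p (\<ominus>\<^bsub>Q\<^esub> q) \<in> U" using S pq by blast+
    then show ?case using neg[OF pq] by (simp add: pure_tensor_def)
  qed
  with x show "w \<in> U" by simp
qed

text \<open>Each factor is reduced to its generators in turn: the second one while the first is a
  generator, then the first one for an arbitrary second.\<close>

lemma pure_generates:
  assumes "add_generates P SP" "add_generates Q SQ"
  shows "add_generates T {pure p q | p q. p \<in> SP \<and> q \<in> SQ}" (is "add_generates T ?S")
proof (rule add_generates_trans[OF pure_generates_carrier])
  have sub: "SP \<subseteq> carrier P" "SQ \<subseteq> carrier Q" using assms by (auto simp: add_generates_def)
  then show "?S \<subseteq> carrier T" by (auto intro: pure_closed)
  fix U s
  assume S: "?S \<subseteq> U" and "s \<in> {pure p q | p q. p \<in> carrier P \<and> q \<in> carrier Q}"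
    and U: "\<And>x y. \<lbrakk>x \<in> U; y \<in> U; x \<in> carrier T; y \<in> carrier T\<rbrakk> \<Longrightarrow> x \<oplus>\<^bsub>T\<^esub> y \<in> U"
  then obtain p q where pq: "s = pure p q" "p \<in> carrier P" "q \<in> carrier Q" by blast
  have 1: "pure p' q \<in> U" if "p' \<in> SP" for p'
    using assms(2) pq(3)
  proof (induction q rule: add_generates_induct)
    case (gen q)
    with that S show ?case by auto
  next
    case (add q q')
    moreover have "p' \<in> carrier P" using that sub by auto
    ultimately show ?case by (simp add: biadditiveD(3)[OF pure_biadditive] U pure_closed)
  qed
  have "pure p q \<in> U"
    using assms(1) pq(2)
    by (induction p rule: add_generates_induct)
      (use 1 in \<open>simp_all add: biadditiveD(2)[OF pure_biadditive] U pure_closed pq(3)\<close>)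
  with pq show "s \<in> U" by simp
qed

lemma tensor_universal:
  assumes Z: "abelian_group Z" and B: "biadditive P Q Z B"
    and bal: "\<And>p a q. \<lbrakk>p \<in> carrier P; a \<in> carrier A; q \<in> carrier Q\<rbrakk> \<Longrightarrow>
      B (p \<odot>r\<^bsub>P\<^esub> a) q = B p (a \<odot>\<^bsub>Q\<^esub> q)"
  obtains \<Phi> where "\<Phi> \<in> add_hom T Z"
    "\<And>p q. \<lbrakk>p \<in> carrier P; q \<in> carrier Q\<rbrakk> \<Longrightarrow> \<Phi> (pure p q) = B p q"
proof -
  interpret Z: abelian_group Z by fact
  note c = rsmult_closed smult_closed biadditiveD(1)[OF B]
  have "(\<lambda>(p, q). B p q) ` (carrier P \<times> carrier Q) \<subseteq> carrier Z"
    using c(3) by auto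
  from Z.add.free_Abelian_group_universal[OF this]
  obtain h where h: "h \<in> hom F (add_monoid Z)"
    "\<And>x. x \<in> carrier P \<times> carrier Q \<Longrightarrow> h (frag_of x) = (\<lambda>(p, q). B p q) x"
    unfolding tensor_free_def by metis
  interpret h: group_hom F "add_monoid Z" h
    using h(1) Z.a_group F.is_group by (simp add: group_hom_def group_hom_axioms_def)
  have h_of: "h (frag_of (p, q)) = B p q" if "p \<in> carrier P" "q \<in> carrier Q" for p q
    using h(2)[of "(p, q)"] that by simp
  have h_add: "h (x + y) = h x \<oplus>\<^bsub>Z\<^esub> h y" if "x \<in> carrier F" "y \<in> carrier F" for x y
    using h.hom_mult[OF that] by (simp add: F_mult)
  \<comment> \<open>Every relator is a difference of two elements with the same image, so one
    argument serves for all three families of relators.\<close>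
  have h_rel: "h (x - y) = \<zero>\<^bsub>Z\<^esub>" if "x \<in> carrier F" "y \<in> carrier F" "h x = h y" for x y
  proof -
    have "h (x - y) \<oplus>\<^bsub>Z\<^esub> h y = h y"
      using that h_add[of "x - y" y] F_diff_closed by simp
    moreover have "h (x - y) \<in> carrier Z" "h y \<in> carrier Z"
      using that F_diff_closed h.hom_closed by auto
    ultimately show ?thesis using Z.add.r_cancel_one by auto
  qed
  have "tensor_relators A P Q \<subseteq> kernel F (add_monoid Z) h"
  proof
    fix x assume x: "x \<in> tensor_relators A P Q"
    then have "h x = \<zero>\<^bsub>Z\<^esub>"
      unfolding tensor_relators_def
      by (elim UnE CollectE exE conjE; simp)
        (rule h_rel, simp_all add: h_add h_of frag_of_closed F_add_closed biadditiveD[OF B] bal c)+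
    with x tensor_relators_subset show "x \<in> kernel F (add_monoid Z) h"
      by (auto simp: kernel_def)
  qed
  then have "N \<subseteq> kernel F (add_monoid Z) h"
    unfolding tensor_kernel_def by (rule F.generate_subgroup_incl[OF _ h.subgroup_kernel])
  then obtain g where g: "g \<in> hom (F Mod N) (add_monoid Z)" "\<And>x. x \<in> carrier F \<Longrightarrow> g (N #>\<^bsub>F\<^esub> x) = h x"
    using h.FactGroup_universal_kernel[OF N.normal_axioms] by blast
  show thesis
  proof (rule that)
    show "g \<in> add_hom T Z"
      using g(1) by (auto simp: add_hom_def hom_def tensor_module_def Let_def)
    show "g (pure p q) = B p q" if "p \<in> carrier P" "q \<in> carrier Q" for p q
      using that g(2)[OF frag_of_closed[OF that]] by (simp add: pure_tensor_def tensor_class_def h_of)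
  qed
qed

text \<open>The definition applies \<open>\<phi>\<close> and \<open>\<psi>\<close> to all
  representatives of a class and takes the only class that results. By the universal property the
  balancing hypothesis yields an additive map, and every representative leads to the value of that
  map. The hypothesis concerns the composite and does not ask for linearity of \<open>\<phi>\<close>
  and \<open>\<psi>\<close>: the operators of \<open>mid_act\<close> commute with the middle group
  only up to conjugation.\<close>

lemma tensor_map:
  assumes "\<phi> \<in> add_hom P P" "\<psi> \<in> add_hom Q Q"
    and bal: "\<And>p a q. \<lbrakk>p \<in> carrier P; a \<in> carrier A; q \<in> carrier Q\<rbrakk> \<Longrightarrow>
      pure (\<phi> (p \<odot>r\<^bsub>P\<^esub> a)) (\<psi> q) = pure (\<phi> p) (\<psi> (a \<odot>\<^bsub>Q\<^esub> q))"
  shows "tensor_map A P Q \<phi> \<psi> \<in> add_hom T T"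
    and "\<And>p q. \<lbrakk>p \<in> carrier P; q \<in> carrier Q\<rbrakk> \<Longrightarrow> tensor_map A P Q \<phi> \<psi> (pure p q) = pure (\<phi> p) (\<psi> q)"
proof -
  obtain \<Phi> where \<Phi>: "\<Phi> \<in> add_hom T T"
    "\<And>p q. \<lbrakk>p \<in> carrier P; q \<in> carrier Q\<rbrakk> \<Longrightarrow> \<Phi> (pure p q) = pure (\<phi> p) (\<psi> q)"
    using tensor_universal[OF T.abelian_group_axioms biadditive_comp[OF pure_biadditive assms(1,2)] bal]
    by blast
  let ?e = "frag_extend (\<lambda>(p, q). frag_of (\<phi> p, \<psi> q))"
  have e: "?e x \<in> carrier F \<and> cls (?e x) = \<Phi> (cls x)" if "x \<in> carrier F" for x
    using that
  proof (induction x rule: F_induct)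
    case zero
    show ?case
      using add_hom_zero[OF \<Phi>(1) T.abelian_group_axioms T.abelian_group_axioms]
      by (simp add: carrier_F cls_zero)
  next
    case (diff x y)
    then have xy: "x \<in> carrier F" "y \<in> carrier F" "x - y \<in> carrier F"
      by (auto intro: F_diff_closed)
    then have c: "cls x \<in> carrier T" "cls y \<in> carrier T" "cls (x - y) \<in> carrier T"
      by (auto simp: carrier_T)
    have e: "?e (x - y) \<in> carrier F" "?e y \<in> carrier F" "?e x = ?e (x - y) + ?e y"
      using diff by (auto simp: frag_extend_diff intro: F_diff_closed)
    then have "cls (?e (x - y)) \<oplus>\<^bsub>T\<^esub> cls (?e y) = cls (?e x)" by (simp add: cls_add)
    also have "\<dots> = \<Phi> (cls (x - y) \<oplus>\<^bsub>T\<^esub> cls y)" using diff xy by (simp add: cls_add)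
    also have "\<dots> = \<Phi> (cls (x - y)) \<oplus>\<^bsub>T\<^esub> cls (?e y)" using c diff by (simp add: add_hom_add[OF \<Phi>(1)])
    finally have "cls (?e (x - y)) = \<Phi> (cls (x - y))"
      using e c add_hom_closed[OF \<Phi>(1)] T.add.right_cancel[of "cls (?e y)"] by (simp add: carrier_T)
    with e show ?case by simp
  next
    case (frag p q)
    note pq = frag
    then show ?case
      using \<Phi>(2)[of p q] by (auto simp: pure_tensor_def intro!: frag_of_closed add_hom_closed[OF assms(1)] add_hom_closed[OF assms(2)])
  qed
  have eq: "tensor_map A P Q \<phi> \<psi> w = \<Phi> w" if w: "w \<in> carrier T" for w
  proof -
    obtain x where x: "x \<in> carrier F" "w = cls x" using w by (auto simp: carrier_T)
    have "cls (?e y) = \<Phi> w" if "y \<in> w" for y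
    proof -
      have y: "y \<in> N #>\<^bsub>F\<^esub> x" using that x by (simp add: tensor_class_def)
      then have "cls y = w" "y \<in> carrier F"
        using F.repr_independence[OF y x(1) N_subgroup] x N.elemrcos_carrier[OF F.is_group x(1)]
        by (auto simp: tensor_class_def)
      with e show ?thesis by auto
    qed
    moreover have "x \<in> w" using F.rcos_self[OF x(1) N_subgroup] x by (simp add: tensor_class_def)
    ultimately have "(\<lambda>x. cls (?e x)) ` w = {\<Phi> w}" by auto
    then show ?thesis by (simp add: tensor_map_def)
  qed
  show "tensor_map A P Q \<phi> \<psi> \<in> add_hom T T"
    by (rule add_homI) (simp_all add: eq add_hom_closed[OF \<Phi>(1)] add_hom_add[OF \<Phi>(1)])
  show "\<And>p q. \<lbrakk>p \<in> carrier P; q \<in> carrier Q\<rbrakk> \<Longrightarrow> tensor_map A P Q \<phi> \<psi> (pure p q) = pure (\<phi> p) (\<psi> q)"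
    by (simp add: eq pure_closed \<Phi>(2))
qed

end

lemma tensor_module_smult:
  "c \<odot>\<^bsub>tensor_module A P Q\<^esub> w = tensor_map A P Q (\<lambda>p. c \<odot>\<^bsub>P\<^esub> p) (\<lambda>q. q) w"
  by (simp add: tensor_module_def Let_def)

lemma tensor_bimodule_simps:
  "carrier (tensor_bimodule A P Q) = carrier (tensor_module A P Q)"
  "\<zero>\<^bsub>tensor_bimodule A P Q\<^esub> = \<zero>\<^bsub>tensor_module A P Q\<^esub>"
  "add (tensor_bimodule A P Q) = add (tensor_module A P Q)"
  "smult (tensor_bimodule A P Q) = smult (tensor_module A P Q)"
  "w \<odot>r\<^bsub>tensor_bimodule A P Q\<^esub> d = tensor_map A P Q (\<lambda>p. p) (\<lambda>q. q \<odot>r\<^bsub>Q\<^esub> d) w"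
  by (simp_all add: tensor_bimodule_def Let_def)

text \<open>The left action descends because it commutes with the right action of \<open>A\<close>.
  The second factor carries no right action here, as in induced modules and in the middle tensor
  product.\<close>

lemma (in tensor_pair) tensor_left_module:
  assumes C: "left_module C P"
    and comm: "\<And>c p a. \<lbrakk>c \<in> carrier C; p \<in> carrier P; a \<in> carrier A\<rbrakk> \<Longrightarrow>
      (c \<odot>\<^bsub>P\<^esub> p) \<odot>r\<^bsub>P\<^esub> a = c \<odot>\<^bsub>P\<^esub> (p \<odot>r\<^bsub>P\<^esub> a)"
  shows "left_module C T"
    and "\<And>c p q. \<lbrakk>c \<in> carrier C; p \<in> carrier P; q \<in> carrier Q\<rbrakk> \<Longrightarrow>
      c \<odot>\<^bsub>T\<^esub> pure p q = pure (c \<odot>\<^bsub>P\<^esub> p) q"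
proof -
  interpret C: left_module C P by fact
  note bi = left_module_biadditive[OF C]
  have bal: "pure (c \<odot>\<^bsub>P\<^esub> (p \<odot>r\<^bsub>P\<^esub> a)) q = pure (c \<odot>\<^bsub>P\<^esub> p) (a \<odot>\<^bsub>Q\<^esub> q)"
    if "c \<in> carrier C" "p \<in> carrier P" "a \<in> carrier A" "q \<in> carrier Q" for c p a q
    using that pure_balanced[of "c \<odot>\<^bsub>P\<^esub> p" a q] by (simp add: comm C.smult_closed)
  have hom: "(\<odot>\<^bsub>T\<^esub>) c \<in> add_hom T T" if "c \<in> carrier C" for c
    using tensor_map(1)[OF biadditive_homs(1)[OF bi that] add_hom_ident bal[OF that]] by (simp add: tensor_module_def Let_def)
  show pure: "c \<odot>\<^bsub>T\<^esub> pure p q = pure (c \<odot>\<^bsub>P\<^esub> p) q"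
    if "c \<in> carrier C" "p \<in> carrier P" "q \<in> carrier Q" for c p q
    using tensor_map(2)[OF biadditive_homs(1)[OF bi that(1)] add_hom_ident bal[OF that(1)] that(2,3)]
    by (simp add: tensor_module_smult)
  show "left_module C T"
  proof (rule left_moduleI)
    show "biadditive C T T (\<odot>\<^bsub>T\<^esub>)"
    proof (rule biadditiveI)
      fix c c' w assume c: "c \<in> carrier C" "c' \<in> carrier C" and w: "w \<in> carrier T"
      show "(c \<oplus>\<^bsub>C\<^esub> c') \<odot>\<^bsub>T\<^esub> w = c \<odot>\<^bsub>T\<^esub> w \<oplus>\<^bsub>T\<^esub> c' \<odot>\<^bsub>T\<^esub> w"
        by (rule add_hom_eqI[OF pure_generates_carrier hom add_hom_plus[OF T.abelian_group_axioms T.abelian_group_axioms hom hom] _ w])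
          (use c in \<open>auto simp: pure C.smult_l_distr C.smult_closed biadditiveD[OF pure_biadditive]\<close>)
    qed (auto simp: add_hom_closed[OF hom] add_hom_add[OF hom])
  next
    fix c c' w assume c: "c \<in> carrier C" "c' \<in> carrier C" and w: "w \<in> carrier T"
    show "(c \<otimes>\<^bsub>C\<^esub> c') \<odot>\<^bsub>T\<^esub> w = c \<odot>\<^bsub>T\<^esub> (c' \<odot>\<^bsub>T\<^esub> w)"
      by (rule add_hom_eqI[OF pure_generates_carrier hom add_hom_comp[OF hom hom] _ w])
        (use c in \<open>auto simp: pure C.smult_assoc C.smult_closed\<close>)
  next
    fix w assume w: "w \<in> carrier T"
    show "\<one>\<^bsub>C\<^esub> \<odot>\<^bsub>T\<^esub> w = w"
      by (rule add_hom_eqI[OF pure_generates_carrier hom add_hom_ident _ w]) (auto simp: pure C.smult_one)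
  qed (rule C.ring_axioms T.abelian_group_axioms)+
qed

lemma tensor_bimodule:
  assumes P: "bimodule C A P" and Q: "bimodule A D Q"
  shows "bimodule C D (tensor_bimodule A P Q)"
    and "\<And>c p q. \<lbrakk>c \<in> carrier C; p \<in> carrier P; q \<in> carrier Q\<rbrakk> \<Longrightarrow>
      c \<odot>\<^bsub>tensor_bimodule A P Q\<^esub> pure_tensor A P Q p q = pure_tensor A P Q (c \<odot>\<^bsub>P\<^esub> p) q"
    and "\<And>d p q. \<lbrakk>d \<in> carrier D; p \<in> carrier P; q \<in> carrier Q\<rbrakk> \<Longrightarrow>
      pure_tensor A P Q p q \<odot>r\<^bsub>tensor_bimodule A P Q\<^esub> d = pure_tensor A P Q p (q \<odot>r\<^bsub>Q\<^esub> d)"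
proof -
  interpret P: bimodule C A P by fact
  interpret Q: bimodule A D Q by fact
  interpret tensor_pair A P Q by unfold_locales
  let ?W = "tensor_bimodule A P Q"
  note W = tensor_bimodule_simps[of A P Q]
  have left: "left_module C T"
    "\<And>c p q. \<lbrakk>c \<in> carrier C; p \<in> carrier P; q \<in> carrier Q\<rbrakk> \<Longrightarrow> c \<odot>\<^bsub>T\<^esub> pure p q = pure (c \<odot>\<^bsub>P\<^esub> p) q"
    using P.smult_rsmult by (intro tensor_left_module[OF P.left_module_axioms]; blast)+
  note bi = right_module_biadditive[OF Q.right_module_axioms]
  have bal: "pure (p \<odot>r\<^bsub>P\<^esub> a) (q \<odot>r\<^bsub>Q\<^esub> d) = pure p ((a \<odot>\<^bsub>Q\<^esub> q) \<odot>r\<^bsub>Q\<^esub> d)"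
    if "d \<in> carrier D" "p \<in> carrier P" "a \<in> carrier A" "q \<in> carrier Q" for d p a q
    using that pure_balanced[of p a "q \<odot>r\<^bsub>Q\<^esub> d"] by (simp add: Q.smult_rsmult Q.rsmult_closed)
  have hom: "(\<lambda>w. w \<odot>r\<^bsub>?W\<^esub> d) \<in> add_hom T T" if "d \<in> carrier D" for d
    using tensor_map(1)[OF add_hom_ident biadditive_homs(2)[OF bi that] bal[OF that]] by (simp add: W)
  have pureR: "pure p q \<odot>r\<^bsub>?W\<^esub> d = pure p (q \<odot>r\<^bsub>Q\<^esub> d)"
    if "d \<in> carrier D" "p \<in> carrier P" "q \<in> carrier Q" for d p q
    using tensor_map(2)[OF add_hom_ident biadditive_homs(2)[OF bi that(1)] bal[OF that(1)] that(2,3)]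
    by (simp add: W)
  have ab: "abelian_group ?W" by (rule abelian_group_cong[OF T.abelian_group_axioms W(1-3)])
  have leftW: "left_module C ?W"
  proof (rule left_moduleI)
    show "biadditive C ?W ?W (\<odot>\<^bsub>?W\<^esub>)"
      using left_module_biadditive[OF left(1)] by (simp add: W add_hom_cong[OF W(1,3)])
  qed (simp_all add: ab W P.A.ring_axioms left_module.smult_assoc[OF left(1)] left_module.smult_one[OF left(1)])
  have rightW: "right_module D ?W"
  proof (rule right_moduleI)
    show "biadditive ?W D ?W (\<odot>r\<^bsub>?W\<^esub>)"
      unfolding add_hom_cong[OF W(1,3)]
    proof (rule biadditiveI)
      fix d d' w assume d: "d \<in> carrier D" "d' \<in> carrier D" and w: "w \<in> carrier T"
      show "w \<odot>r\<^bsub>?W\<^esub> (d \<oplus>\<^bsub>D\<^esub> d') = w \<odot>r\<^bsub>?W\<^esub> d \<oplus>\<^bsub>T\<^esub> w \<odot>r\<^bsub>?W\<^esub> d'"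
        by (rule add_hom_eqI[OF pure_generates_carrier hom add_hom_plus[OF T.abelian_group_axioms T.abelian_group_axioms hom hom] _ w])
          (use d in \<open>auto simp: pureR Q.rsmult_r_distr Q.rsmult_closed biadditiveD[OF pure_biadditive]\<close>)
    qed (auto simp: add_hom_closed[OF hom] add_hom_add[OF hom])
  next
    fix d d' w assume d: "d \<in> carrier D" "d' \<in> carrier D" and w: "w \<in> carrier ?W"
    show "w \<odot>r\<^bsub>?W\<^esub> (d \<otimes>\<^bsub>D\<^esub> d') = (w \<odot>r\<^bsub>?W\<^esub> d) \<odot>r\<^bsub>?W\<^esub> d'"
      by (rule add_hom_eqI[OF pure_generates_carrier hom add_hom_comp[OF hom hom] _ w[unfolded W]])
        (use d in \<open>auto simp: pureR Q.rsmult_assoc Q.rsmult_closed\<close>)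
  next
    fix w assume w: "w \<in> carrier ?W"
    show "w \<odot>r\<^bsub>?W\<^esub> \<one>\<^bsub>D\<^esub> = w"
      by (rule add_hom_eqI[OF pure_generates_carrier hom add_hom_ident _ w[unfolded W]]) (auto simp: pureR Q.rsmult_one)
  qed (rule Q.B.ring_axioms ab)+
  show pureL: "c \<odot>\<^bsub>?W\<^esub> pure p q = pure (c \<odot>\<^bsub>P\<^esub> p) q"
    if "c \<in> carrier C" "p \<in> carrier P" "q \<in> carrier Q" for c p q
    using left(2)[OF that] by (simp add: W)
  show "pure p q \<odot>r\<^bsub>?W\<^esub> d = pure p (q \<odot>r\<^bsub>Q\<^esub> d)"
    if "d \<in> carrier D" "p \<in> carrier P" "q \<in> carrier Q" for d p q
    using pureR[OF that] .
  have homL: "(\<lambda>w. c \<odot>\<^bsub>?W\<^esub> w) \<in> add_hom T T" if "c \<in> carrier C" for c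
    using biadditive_homs(1)[OF left_module_biadditive[OF left(1)] that] by (simp add: W)
  show "bimodule C D ?W"
  proof (intro bimodule.intro leftW rightW bimodule_axioms.intro)
    fix c w d assume c: "c \<in> carrier C" and w: "w \<in> carrier ?W" and d: "d \<in> carrier D"
    show "(c \<odot>\<^bsub>?W\<^esub> w) \<odot>r\<^bsub>?W\<^esub> d = c \<odot>\<^bsub>?W\<^esub> (w \<odot>r\<^bsub>?W\<^esub> d)"
      by (rule add_hom_eqI[OF pure_generates_carrier add_hom_comp[OF homL hom] add_hom_comp[OF hom homL] _ w[unfolded W]])
        (use c d in \<open>auto simp: pureL pureR P.smult_closed Q.rsmult_closed\<close>)
  qed
qed


section \<open>Finite direct sums of bimodules\<close>

definition sum_inj :: "'i set \<Rightarrow> ('i \<Rightarrow> ('a, 'b, 'm, 'z) bimodule_scheme) \<Rightarrow> 'i \<Rightarrow> 'm \<Rightarrow> 'i \<Rightarrow> 'm" where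
  "sum_inj I M i w = (\<lambda>j\<in>I. if j = i then w else \<zero>\<^bsub>M j\<^esub>)"

lemma bimodule_direct_sum_simps:
  "f \<oplus>\<^bsub>bimodule_direct_sum I M\<^esub> g = (\<lambda>i\<in>I. f i \<oplus>\<^bsub>M i\<^esub> g i)"
  "\<zero>\<^bsub>bimodule_direct_sum I M\<^esub> = (\<lambda>i\<in>I. \<zero>\<^bsub>M i\<^esub>)"
  "a \<odot>\<^bsub>bimodule_direct_sum I M\<^esub> f = (\<lambda>i\<in>I. a \<odot>\<^bsub>M i\<^esub> f i)"
  "f \<odot>r\<^bsub>bimodule_direct_sum I M\<^esub> b = (\<lambda>i\<in>I. f i \<odot>r\<^bsub>M i\<^esub> b)"
  by (simp_all add: bimodule_direct_sum_def)

text \<open>The index set has to be nonempty because \<^const>\<open>add_generates\<close> does not supply a zero.\<close>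

locale finite_bimodule_sum =
  fixes I :: "'i set" and A :: "('a, 'x) ring_scheme" and B :: "('b, 'y) ring_scheme"
    and M :: "'i \<Rightarrow> ('a, 'b, 'm, 'z) bimodule_scheme"
  assumes finite_I: "finite I" and I_nonempty: "I \<noteq> {}"
    and bimodule_M: "\<And>i. i \<in> I \<Longrightarrow> bimodule A B (M i)"
begin

abbreviation "D \<equiv> bimodule_direct_sum I M"

lemma left_M: "i \<in> I \<Longrightarrow> left_module A (M i)" and right_M: "i \<in> I \<Longrightarrow> right_module B (M i)"
  using bimodule_M by (simp_all add: bimodule_def)

lemma abelian_group_M: "i \<in> I \<Longrightarrow> abelian_group (M i)"
  using left_M by (simp add: left_module_def)

lemma ring_A: "ring A" and ring_B: "ring B"
  using I_nonempty left_M right_M by (auto simp: left_module_def right_module_def)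

lemma carrier_D: "carrier D = (\<Pi>\<^sub>E i\<in>I. carrier (M i))"
  using finite_I by (simp add: bimodule_direct_sum_def)

lemma D_mem: "\<lbrakk>f \<in> carrier D; i \<in> I\<rbrakk> \<Longrightarrow> f i \<in> carrier (M i)"
  by (auto simp: carrier_D)

lemma D_abelian_group: "abelian_group D"
proof (rule abelian_groupI)
  fix f assume f: "f \<in> carrier D"
  have "(\<lambda>i\<in>I. \<ominus>\<^bsub>M i\<^esub> f i) \<in> carrier D"
    using D_mem[OF f] abelian_group.a_inv_closed[OF abelian_group_M] by (auto simp: carrier_D)
  moreover have "(\<lambda>i\<in>I. \<ominus>\<^bsub>M i\<^esub> f i) \<oplus>\<^bsub>D\<^esub> f = \<zero>\<^bsub>D\<^esub>"
    using D_mem[OF f] abelian_group.l_neg[OF abelian_group_M]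
    by (auto simp: bimodule_direct_sum_simps fun_eq_iff)
  ultimately show "\<exists>g\<in>carrier D. g \<oplus>\<^bsub>D\<^esub> f = \<zero>\<^bsub>D\<^esub>" by blast
next
  fix f assume f: "f \<in> carrier D"
  show "\<zero>\<^bsub>D\<^esub> \<oplus>\<^bsub>D\<^esub> f = f"
    using D_mem[OF f] f abelian_groupE(5)[OF abelian_group_M]
    by (auto simp: bimodule_direct_sum_simps fun_eq_iff carrier_D PiE_def extensional_def)
next
  fix f g assume f: "f \<in> carrier D" and g: "g \<in> carrier D"
  show "f \<oplus>\<^bsub>D\<^esub> g \<in> carrier D"
    using D_mem[OF f] D_mem[OF g] abelian_groupE(1)[OF abelian_group_M]
    by (auto simp: bimodule_direct_sum_simps carrier_D)
  show "f \<oplus>\<^bsub>D\<^esub> g = g \<oplus>\<^bsub>D\<^esub> f"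
    using D_mem[OF f] D_mem[OF g] abelian_groupE(4)[OF abelian_group_M]
    by (auto simp: bimodule_direct_sum_simps fun_eq_iff)
  fix h assume h: "h \<in> carrier D"
  show "f \<oplus>\<^bsub>D\<^esub> g \<oplus>\<^bsub>D\<^esub> h = f \<oplus>\<^bsub>D\<^esub> (g \<oplus>\<^bsub>D\<^esub> h)"
    using D_mem[OF f] D_mem[OF g] D_mem[OF h] abelian_groupE(3)[OF abelian_group_M]
    by (auto simp: bimodule_direct_sum_simps fun_eq_iff)
qed (use abelian_groupE(2)[OF abelian_group_M] in \<open>auto simp: bimodule_direct_sum_simps carrier_D\<close>)

lemma D_bimodule: "bimodule A B D"
proof (intro bimodule.intro bimodule_axioms.intro)
  show "left_module A D"
    by (intro left_module.intro left_module_axioms.intro ring_A D_abelian_group)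
      (auto simp: bimodule_direct_sum_simps carrier_D fun_eq_iff PiE_def extensional_def Pi_iff
        left_module.smult_closed[OF left_M] left_module.smult_l_distr[OF left_M]
        left_module.smult_r_distr[OF left_M] left_module.smult_assoc[OF left_M] left_module.smult_one[OF left_M])
  show "right_module B D"
    by (intro right_module.intro right_module_axioms.intro ring_B D_abelian_group)
      (auto simp: bimodule_direct_sum_simps carrier_D fun_eq_iff PiE_def extensional_def Pi_iff
        right_module.rsmult_closed[OF right_M] right_module.rsmult_l_distr[OF right_M]
        right_module.rsmult_r_distr[OF right_M] right_module.rsmult_assoc[OF right_M] right_module.rsmult_one[OF right_M])
  show "(a \<odot>\<^bsub>D\<^esub> f) \<odot>r\<^bsub>D\<^esub> b = a \<odot>\<^bsub>D\<^esub> (f \<odot>r\<^bsub>D\<^esub> b)"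
    if "a \<in> carrier A" "f \<in> carrier D" "b \<in> carrier B" for a f b
    using that D_mem[OF that(2)]
    by (auto simp: bimodule_direct_sum_simps fun_eq_iff bimodule.smult_rsmult[OF bimodule_M])
qed

lemma sum_inj_closed: "\<lbrakk>i \<in> I; w \<in> carrier (M i)\<rbrakk> \<Longrightarrow> sum_inj I M i w \<in> carrier D"
  using abelian_groupE(2)[OF abelian_group_M] by (auto simp: sum_inj_def carrier_D)

lemma sum_inj_hom:
  assumes "i \<in> I"
  shows "sum_inj I M i \<in> add_hom (M i) D"
proof (rule add_homI)
  fix w w' assume "w \<in> carrier (M i)" "w' \<in> carrier (M i)"
  then show "sum_inj I M i (w \<oplus>\<^bsub>M i\<^esub> w') = sum_inj I M i w \<oplus>\<^bsub>D\<^esub> sum_inj I M i w'"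
    using abelian_groupE(2,5)[OF abelian_group_M] by (auto simp: sum_inj_def bimodule_direct_sum_simps fun_eq_iff)
qed (rule sum_inj_closed[OF assms])

lemma sum_inj_smult:
  assumes "i \<in> I" "a \<in> carrier A" "w \<in> carrier (M i)"
  shows "a \<odot>\<^bsub>D\<^esub> sum_inj I M i w = sum_inj I M i (a \<odot>\<^bsub>M i\<^esub> w)"
proof -
  have "a \<odot>\<^bsub>M j\<^esub> \<zero>\<^bsub>M j\<^esub> = \<zero>\<^bsub>M j\<^esub>" if "j \<in> I" for j
    using add_hom_zero[OF biadditive_homs(1)[OF left_module_biadditive[OF left_M[OF that]] assms(2)]]
      abelian_group_M[OF that] by blast
  then show ?thesis by (auto simp: sum_inj_def bimodule_direct_sum_simps fun_eq_iff)
qed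

lemma sum_inj_rsmult:
  assumes "i \<in> I" "b \<in> carrier B" "w \<in> carrier (M i)"
  shows "sum_inj I M i w \<odot>r\<^bsub>D\<^esub> b = sum_inj I M i (w \<odot>r\<^bsub>M i\<^esub> b)"
proof -
  have "\<zero>\<^bsub>M j\<^esub> \<odot>r\<^bsub>M j\<^esub> b = \<zero>\<^bsub>M j\<^esub>" if "j \<in> I" for j
    using add_hom_zero[OF biadditive_homs(2)[OF right_module_biadditive[OF right_M[OF that]] assms(2)]]
      abelian_group_M[OF that] by blast
  then show ?thesis by (auto simp: sum_inj_def bimodule_direct_sum_simps fun_eq_iff)
qed

lemma D_generates:
  assumes "\<And>i. i \<in> I \<Longrightarrow> add_generates (M i) (S i)"
  shows "add_generates D {sum_inj I M i w | i w. i \<in> I \<and> w \<in> S i}" (is "add_generates D ?S")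
proof (rule add_generatesI)
  have sub: "S i \<subseteq> carrier (M i)" if "i \<in> I" for i using assms[OF that] by (simp add: add_generates_def)
  then show "?S \<subseteq> carrier D" by (auto intro!: sum_inj_closed)
  fix U f
  assume S: "?S \<subseteq> U" and f: "f \<in> carrier D"
    and U: "\<And>x y. \<lbrakk>x \<in> U; y \<in> U; x \<in> carrier D; y \<in> carrier D\<rbrakk> \<Longrightarrow> x \<oplus>\<^bsub>D\<^esub> y \<in> U"
  have inj: "sum_inj I M i w \<in> U" if i: "i \<in> I" and w: "w \<in> carrier (M i)" for i w
    using assms[OF i] w
  proof (induction w rule: add_generates_induct)
    case (gen w)
    with S i show ?case by blast
  next
    case (add w w')
    with i show ?case by (simp add: add_hom_add[OF sum_inj_hom] U sum_inj_closed)
  qed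
  have zero: "sum_inj I M i \<zero>\<^bsub>M i\<^esub> = \<zero>\<^bsub>D\<^esub>" for i
    by (auto simp: sum_inj_def bimodule_direct_sum_simps fun_eq_iff)
  define F where "F J = (\<lambda>i\<in>I. if i \<in> J then f i else \<zero>\<^bsub>M i\<^esub>)" for J
  have F_closed: "F J \<in> carrier D" for J
    using D_mem[OF f] abelian_groupE(2)[OF abelian_group_M] by (auto simp: F_def carrier_D)
  have "J \<subseteq> I \<Longrightarrow> F J \<in> U" if "finite J" for J
    using that
  proof induction
    case empty
    obtain i where "i \<in> I" using I_nonempty by blast
    moreover have "F {} = \<zero>\<^bsub>D\<^esub>" by (auto simp: F_def bimodule_direct_sum_simps)
    ultimately show ?case
      using inj[of i "\<zero>\<^bsub>M i\<^esub>"] abelian_groupE(2)[OF abelian_group_M] zero[of i] by simp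
  next
    case (insert j J)
    have "F (insert j J) = sum_inj I M j (f j) \<oplus>\<^bsub>D\<^esub> F J"
      using insert D_mem[OF f] abelian_groupE(2,5)[OF abelian_group_M]
        abelian_monoid.r_zero[OF abelian_group.axioms(1)[OF abelian_group_M]]
      by (auto simp: F_def sum_inj_def bimodule_direct_sum_simps fun_eq_iff)
    with insert D_mem[OF f] show ?case by (simp add: U inj sum_inj_closed F_closed)
  qed
  from this[OF finite_I] have "F I \<in> U" by simp
  also have "F I = f"
    using f by (auto simp: F_def carrier_D fun_eq_iff PiE_def extensional_def)
  finally show "f \<in> U" .
qed

lemma D_universal:
  assumes Z: "abelian_group Z" and \<psi>: "\<And>i. i \<in> I \<Longrightarrow> \<psi> i \<in> add_hom (M i) Z"
  shows "\<exists>\<Psi>\<in>add_hom D Z. \<forall>i\<in>I. \<forall>w\<in>carrier (M i). \<Psi> (sum_inj I M i w) = \<psi> i w"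
proof (intro bexI ballI)
  interpret Z: abelian_group Z by fact
  have "(\<lambda>f. \<psi> i (f i)) \<in> add_hom D Z" if "i \<in> I" for i
  proof -
    have "(\<lambda>f. f i) \<in> add_hom D (M i)"
      by (rule add_homI) (use that in \<open>auto simp: D_mem bimodule_direct_sum_simps\<close>)
    from add_hom_comp[OF this \<psi>[OF that]] show ?thesis .
  qed
  from add_hom_finsum[OF D_abelian_group Z this]
  show "(\<lambda>f. \<Oplus>\<^bsub>Z\<^esub>i\<in>I. \<psi> i (f i)) \<in> add_hom D Z" .
  fix i w assume i: "i \<in> I" and w: "w \<in> carrier (M i)"
  have zero: "\<psi> j \<zero>\<^bsub>M j\<^esub> = \<zero>\<^bsub>Z\<^esub>" if "j \<in> I" for j
    using add_hom_zero[OF \<psi>[OF that] abelian_group_M[OF that] Z] .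
  have "(\<Oplus>\<^bsub>Z\<^esub>j\<in>I. \<psi> j (sum_inj I M i w j)) = (\<Oplus>\<^bsub>Z\<^esub>j\<in>I. if i = j then \<psi> i w else \<zero>\<^bsub>Z\<^esub>)"
    using i w zero add_hom_closed[OF \<psi>] by (intro Z.finsum_cong') (auto simp: sum_inj_def)
  also have "\<dots> = \<psi> i w"
    using i w finite_I add_hom_closed[OF \<psi>[OF i]]
    by (intro Z.finsum_singleton[where f = "\<lambda>_. \<psi> i w"]) auto
  finally show "(\<Oplus>\<^bsub>Z\<^esub>j\<in>I. \<psi> j (sum_inj I M i w j)) = \<psi> i w" .
qed

end


section \<open>Restriction along group homomorphisms\<close>

text \<open>Restriction along the algebra map extending \<open>\<alpha>\<close>, whose
  multiplicativity is tested on multiples of group elements, where it is that of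
  \<open>\<alpha>\<close>. The record \<open>W\<close> is described by equations so that bimodules,
  conjugates and restrictions all become instances.\<close>

lemma left_module_pullback:
  assumes S: "finite_group_algebra R S" and \<alpha>: "\<alpha> \<in> hom S X" "\<alpha> \<one>\<^bsub>S\<^esub> = \<one>\<^bsub>X\<^esub>"
    and M: "left_module (group_algebra R X) M"
    and W: "carrier W = carrier M" "\<zero>\<^bsub>W\<^esub> = \<zero>\<^bsub>M\<^esub>" "add W = add M"
      "\<And>f m. f \<odot>\<^bsub>W\<^esub> m = ga_extend R (carrier S) \<alpha> f \<odot>\<^bsub>M\<^esub> m"
    and X: "finite_group_algebra R X"
  shows "left_module (group_algebra R S) W"
    and "\<And>x r m. \<lbrakk>x \<in> carrier S; r \<in> carrier R\<rbrakk> \<Longrightarrow>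
      ga_single R x r \<odot>\<^bsub>W\<^esub> m = ga_single R (\<alpha> x) r \<odot>\<^bsub>M\<^esub> m"
proof -
  interpret S: finite_group_algebra R S by fact
  interpret X: finite_group_algebra R X by fact
  interpret M: left_module "group_algebra R X" M by fact
  have \<alpha>c: "\<alpha> \<in> carrier S \<rightarrow> carrier X" and \<alpha>m: "\<And>x. x \<in> carrier S \<Longrightarrow> \<alpha> x \<in> carrier X"
    using \<alpha>(1) by (auto simp: hom_def)
  show single: "ga_single R x r \<odot>\<^bsub>W\<^esub> m = ga_single R (\<alpha> x) r \<odot>\<^bsub>M\<^esub> m"
    if "x \<in> carrier S" "r \<in> carrier R" for x r m
    using that by (simp add: W S.ga_extend_single)
  show "left_module (group_algebra R S) W"
  proof (rule S.left_module_group_algebraI)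
    show "abelian_group W" by (rule abelian_group_cong[OF M.abelian_group_axioms W(1-3)])
    show "biadditive (group_algebra R S) W W (\<odot>\<^bsub>W\<^esub>)"
      using biadditive_comp[OF left_module_biadditive[OF M] S.ga_extend_hom[OF \<alpha>c] add_hom_ident]
      by (simp add: add_hom_cong[OF W(1,3)] W(4)[abs_def])
  next
    fix x y r s m
    assume *: "x \<in> carrier S" "y \<in> carrier S" "r \<in> carrier R" "s \<in> carrier R" "m \<in> carrier W"
    then show "ga_single R x r \<odot>\<^bsub>W\<^esub> (ga_single R y s \<odot>\<^bsub>W\<^esub> m) =
        ga_single R (x \<otimes>\<^bsub>S\<^esub> y) (r \<otimes>\<^bsub>R\<^esub> s) \<odot>\<^bsub>W\<^esub> m"
      by (simp add: single \<alpha>m W(1) X.ga_single_closed X.ga_single_mult hom_mult[OF \<alpha>(1)] flip: M.smult_assoc)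
  next
    fix m assume "m \<in> carrier W"
    then show "ga_single R \<one>\<^bsub>S\<^esub> \<one>\<^bsub>R\<^esub> \<odot>\<^bsub>W\<^esub> m = m"
      using M.smult_one[of m] by (simp add: single \<alpha> W(1) group_algebra_simps(3))
  qed
qed

text \<open>An antihomomorphism turns the left action into a right one. The scalars come out in the
  opposite order too, and commutativity of \<open>R\<close> restores it.\<close>

lemma right_module_pullback:
  assumes S: "finite_group_algebra R S" and \<alpha>: "\<alpha> \<in> carrier S \<rightarrow> carrier X" "\<alpha> \<one>\<^bsub>S\<^esub> = \<one>\<^bsub>X\<^esub>"
      "\<And>x y. \<lbrakk>x \<in> carrier S; y \<in> carrier S\<rbrakk> \<Longrightarrow> \<alpha> (x \<otimes>\<^bsub>S\<^esub> y) = \<alpha> y \<otimes>\<^bsub>X\<^esub> \<alpha> x"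
    and M: "left_module (group_algebra R X) M"
    and W: "carrier W = carrier M" "\<zero>\<^bsub>W\<^esub> = \<zero>\<^bsub>M\<^esub>" "add W = add M"
      "\<And>f m. m \<odot>r\<^bsub>W\<^esub> f = ga_extend R (carrier S) \<alpha> f \<odot>\<^bsub>M\<^esub> m"
    and X: "finite_group_algebra R X"
  shows "right_module (group_algebra R S) W"
    and "\<And>x r m. \<lbrakk>x \<in> carrier S; r \<in> carrier R\<rbrakk> \<Longrightarrow>
      m \<odot>r\<^bsub>W\<^esub> ga_single R x r = ga_single R (\<alpha> x) r \<odot>\<^bsub>M\<^esub> m"
proof -
  interpret S: finite_group_algebra R S by fact
  interpret X: finite_group_algebra R X by fact
  interpret M: left_module "group_algebra R X" M by fact
  have \<alpha>m: "\<And>x. x \<in> carrier S \<Longrightarrow> \<alpha> x \<in> carrier X"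
    using \<alpha>(1) by auto
  show single: "m \<odot>r\<^bsub>W\<^esub> ga_single R x r = ga_single R (\<alpha> x) r \<odot>\<^bsub>M\<^esub> m"
    if "x \<in> carrier S" "r \<in> carrier R" for x r m
    using that by (simp add: W S.ga_extend_single)
  show "right_module (group_algebra R S) W"
  proof (rule S.right_module_group_algebraI)
    show "abelian_group W" by (rule abelian_group_cong[OF M.abelian_group_axioms W(1-3)])
    show "biadditive W (group_algebra R S) W (\<odot>r\<^bsub>W\<^esub>)"
      using biadditive_flip[OF biadditive_comp[OF left_module_biadditive[OF M] S.ga_extend_hom[OF \<alpha>(1)] add_hom_ident]]
      by (simp add: add_hom_cong[OF W(1,3)] W(4)[abs_def])
  next
    fix x y r s m
    assume *: "x \<in> carrier S" "y \<in> carrier S" "r \<in> carrier R" "s \<in> carrier R" "m \<in> carrier W"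
    then show "(m \<odot>r\<^bsub>W\<^esub> ga_single R x r) \<odot>r\<^bsub>W\<^esub> ga_single R y s =
        m \<odot>r\<^bsub>W\<^esub> ga_single R (x \<otimes>\<^bsub>S\<^esub> y) (r \<otimes>\<^bsub>R\<^esub> s)"
      by (simp add: single \<alpha>m W(1) X.ga_single_closed X.ga_single_mult \<alpha>(3) S.R.m_comm flip: M.smult_assoc)
  next
    fix m assume "m \<in> carrier W"
    then show "m \<odot>r\<^bsub>W\<^esub> ga_single R \<one>\<^bsub>S\<^esub> \<one>\<^bsub>R\<^esub> = m"
      using M.smult_one[of m] by (simp add: single \<alpha> W(1) group_algebra_simps(3))
  qed
qed

lemma finite_group_algebra_DirProd:
  assumes "finite_group_algebra R A" "finite_group_algebra R B"
  shows "finite_group_algebra R (A \<times>\<times> B)"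
proof -
  interpret A: finite_group_algebra R A by fact
  interpret B: finite_group_algebra R B by fact
  show ?thesis
    by (intro finite_group_algebra.intro finite_group_algebra_axioms.intro A.R.cring_axioms
        DirProd_group A.G.group_axioms B.G.group_axioms) (simp add: A.finite_carrier B.finite_carrier)
qed

lemma as_bimodule_simps:
  "carrier (as_bimodule R A B W) = carrier W"
  "\<zero>\<^bsub>as_bimodule R A B W\<^esub> = \<zero>\<^bsub>W\<^esub>"
  "add (as_bimodule R A B W) = add W"
  "f \<odot>\<^bsub>as_bimodule R A B W\<^esub> w = ga_extend R (carrier A) (\<lambda>a. (a, \<one>\<^bsub>B\<^esub>)) f \<odot>\<^bsub>W\<^esub> w"
  "w \<odot>r\<^bsub>as_bimodule R A B W\<^esub> f' = ga_extend R (carrier B) (\<lambda>b. (\<one>\<^bsub>A\<^esub>, inv\<^bsub>B\<^esub> b)) f' \<odot>\<^bsub>W\<^esub> w"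
  by (simp_all add: as_bimodule_def)

text \<open>The two actions commute because \<open>(a, 1)\<close> and \<open>(1, b^-1)\<close>
  commute in the direct product and because \<open>R\<close> is commutative.\<close>

lemma as_bimodule:
  assumes A: "finite_group_algebra R A" and B: "finite_group_algebra R B"
    and W: "left_module (group_algebra R (A \<times>\<times> B)) W"
  shows "bimodule (group_algebra R A) (group_algebra R B) (as_bimodule R A B W)"
    and "\<And>a r w. \<lbrakk>a \<in> carrier A; r \<in> carrier R\<rbrakk> \<Longrightarrow>
      ga_single R a r \<odot>\<^bsub>as_bimodule R A B W\<^esub> w = ga_single R (a, \<one>\<^bsub>B\<^esub>) r \<odot>\<^bsub>W\<^esub> w"
    and "\<And>b r w. \<lbrakk>b \<in> carrier B; r \<in> carrier R\<rbrakk> \<Longrightarrow>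
      w \<odot>r\<^bsub>as_bimodule R A B W\<^esub> ga_single R b r = ga_single R (\<one>\<^bsub>A\<^esub>, inv\<^bsub>B\<^esub> b) r \<odot>\<^bsub>W\<^esub> w"
proof -
  interpret A: finite_group_algebra R A by fact
  interpret B: finite_group_algebra R B by fact
  interpret AB: finite_group_algebra R "A \<times>\<times> B" by (rule finite_group_algebra_DirProd[OF A B])
  interpret W: left_module "group_algebra R (A \<times>\<times> B)" W by fact
  let ?W = "as_bimodule R A B W"
  note simps = as_bimodule_simps[of R A B W]
  have h1: "(\<lambda>a. (a, \<one>\<^bsub>B\<^esub>)) \<in> hom A (A \<times>\<times> B)" "(\<one>\<^bsub>A\<^esub>, \<one>\<^bsub>B\<^esub>) = \<one>\<^bsub>A \<times>\<times> B\<^esub>"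
    by (auto simp: hom_def DirProd_def)
  note L = left_module_pullback[OF A h1 W simps(1-4) AB.finite_group_algebra_axioms]
  have h2: "(\<lambda>b. (\<one>\<^bsub>A\<^esub>, inv\<^bsub>B\<^esub> b)) \<in> carrier B \<rightarrow> carrier (A \<times>\<times> B)"
    "(\<one>\<^bsub>A\<^esub>, inv\<^bsub>B\<^esub> \<one>\<^bsub>B\<^esub>) = \<one>\<^bsub>A \<times>\<times> B\<^esub>"
    "\<And>x y. \<lbrakk>x \<in> carrier B; y \<in> carrier B\<rbrakk> \<Longrightarrow> (\<one>\<^bsub>A\<^esub>, inv\<^bsub>B\<^esub> (x \<otimes>\<^bsub>B\<^esub> y)) =
      (\<one>\<^bsub>A\<^esub>, inv\<^bsub>B\<^esub> y) \<otimes>\<^bsub>A \<times>\<times> B\<^esub> (\<one>\<^bsub>A\<^esub>, inv\<^bsub>B\<^esub> x)"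
    by (auto simp: DirProd_def B.G.inv_mult_group)
  note R = right_module_pullback[OF B h2 W simps(1-3,5) AB.finite_group_algebra_axioms]
  show L2: "\<And>a r w. \<lbrakk>a \<in> carrier A; r \<in> carrier R\<rbrakk> \<Longrightarrow>
      ga_single R a r \<odot>\<^bsub>?W\<^esub> w = ga_single R (a, \<one>\<^bsub>B\<^esub>) r \<odot>\<^bsub>W\<^esub> w"
    by (rule L(2))
  show R2: "\<And>b r w. \<lbrakk>b \<in> carrier B; r \<in> carrier R\<rbrakk> \<Longrightarrow>
      w \<odot>r\<^bsub>?W\<^esub> ga_single R b r = ga_single R (\<one>\<^bsub>A\<^esub>, inv\<^bsub>B\<^esub> b) r \<odot>\<^bsub>W\<^esub> w"
    by (rule R(2))
  show "bimodule (group_algebra R A) (group_algebra R B) ?W"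
  proof (intro bimodule.intro L(1) R(1) bimodule_axioms.intro)
    fix f w g assume f: "f \<in> carrier (group_algebra R A)" and w: "w \<in> carrier ?W"
      and g: "g \<in> carrier (group_algebra R B)"
    note biL = left_module_biadditive[OF L(1)] and biR = right_module_biadditive[OF R(1)]
    show "(f \<odot>\<^bsub>?W\<^esub> w) \<odot>r\<^bsub>?W\<^esub> g = f \<odot>\<^bsub>?W\<^esub> (w \<odot>r\<^bsub>?W\<^esub> g)"
    proof (rule biadditive_eqI[OF A.ga_generates B.ga_generates _ _ _ f g])
      show "biadditive (group_algebra R A) (group_algebra R B) ?W (\<lambda>f g. (f \<odot>\<^bsub>?W\<^esub> w) \<odot>r\<^bsub>?W\<^esub> g)"
        using biadditive_comp[OF biR biadditive_homs(2)[OF biL w] add_hom_ident] .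
      show "biadditive (group_algebra R A) (group_algebra R B) ?W (\<lambda>f g. f \<odot>\<^bsub>?W\<^esub> (w \<odot>r\<^bsub>?W\<^esub> g))"
        using biadditive_comp[OF biL add_hom_ident biadditive_homs(1)[OF biR w]] .
      fix a b
      assume a: "a \<in> ga_singles R (carrier A)"
        and b: "b \<in> ga_singles R (carrier B)"
      from a b show "(a \<odot>\<^bsub>?W\<^esub> w) \<odot>r\<^bsub>?W\<^esub> b = a \<odot>\<^bsub>?W\<^esub> (w \<odot>r\<^bsub>?W\<^esub> b)"
        using w
        by (auto simp: L2 R2 simps(1) AB.ga_single_closed AB.ga_single_mult A.R.m_comm simp flip: W.smult_assoc)
    qed
  qed
qed

lemma regular_bimodule_simps:
  "carrier (regular_bimodule R G) = carrier (group_algebra R G)"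
  "\<zero>\<^bsub>regular_bimodule R G\<^esub> = \<zero>\<^bsub>group_algebra R G\<^esub>"
  "add (regular_bimodule R G) = add (group_algebra R G)"
  "smult (regular_bimodule R G) = mult (group_algebra R G)"
  "rsmult (regular_bimodule R G) = mult (group_algebra R G)"
  by (simp_all add: regular_bimodule_def Let_def)

text \<open>Elements of a group algebra vanish outside the group, so the inclusion of the subgroup
  algebra is the identity on functions.\<close>

lemma (in finite_group_algebra) subgroup_algebra_hom:
  assumes "X \<subseteq> carrier G"
  shows "(\<lambda>f. f) \<in> add_hom (subgroup_algebra R G X) RG"
proof (rule add_homI)
  fix f assume f: "f \<in> carrier (subgroup_algebra R G X)"
  have "f x \<in> carrier R" for x
    using f by (cases "x \<in> X") (auto simp: subgroup_algebra_def group_algebra_simps)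
  with f assms show "f \<in> carrier RG"
    by (auto simp: subgroup_algebra_def group_algebra_simps)
qed (simp add: subgroup_algebra_def group_algebra_simps)

lemma (in finite_group_algebra) regular_bimodule:
  assumes X: "subgroup X G"
  shows "bimodule RG (subgroup_algebra R G X) (regular_bimodule R G)"
proof (intro bimodule.intro bimodule_axioms.intro)
  let ?W = "regular_bimodule R G"
  interpret X: finite_group_algebra R "G\<lparr>carrier := X\<rparr>"
    by (rule finite_group_algebra_subgroup[OF finite_group_algebra_axioms X])
  interpret RG: ring RG by (rule group_algebra_ring)
  note W = regular_bimodule_simps[of R G]
  have ab: "abelian_group ?W" by (rule abelian_group_cong[OF RG.is_abelian_group W(1-3)])
  have XG: "X \<subseteq> carrier G" by (rule subgroup.subset[OF X])
  note incl = subgroup_algebra_hom[OF XG]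
  show "left_module RG ?W"
    by (intro left_moduleI ab) (use ga_mult_biadditive in \<open>simp_all add: W add_hom_cong[OF W(1,3)] RG.ring_axioms RG.m_assoc\<close>)
  show "right_module (subgroup_algebra R G X) ?W"
    unfolding subgroup_algebra_def
  proof (rule X.right_module_group_algebraI[OF ab])
    show "biadditive ?W (group_algebra R (G\<lparr>carrier := X\<rparr>)) ?W (\<odot>r\<^bsub>?W\<^esub>)"
      using biadditive_comp[OF ga_mult_biadditive add_hom_ident incl]
      by (simp add: W add_hom_cong[OF W(1,3)] subgroup_algebra_def)
  next
    fix m assume "m \<in> carrier ?W"
    then show "m \<odot>r\<^bsub>?W\<^esub> ga_single R \<one>\<^bsub>G\<lparr>carrier := X\<rparr>\<^esub> \<one> = m"
      using RG.r_one by (simp add: W group_algebra_simps(3))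
  next
    fix x y r s m
    assume "x \<in> carrier (G\<lparr>carrier := X\<rparr>)" "y \<in> carrier (G\<lparr>carrier := X\<rparr>)"
      "r \<in> carrier R" "s \<in> carrier R" "m \<in> carrier ?W"
    moreover from this XG have "x \<in> carrier G" "y \<in> carrier G" by auto
    ultimately show "(m \<odot>r\<^bsub>?W\<^esub> ga_single R x r) \<odot>r\<^bsub>?W\<^esub> ga_single R y s =
        m \<odot>r\<^bsub>?W\<^esub> ga_single R (x \<otimes>\<^bsub>G\<lparr>carrier := X\<rparr>\<^esub> y) (r \<otimes> s)"
      by (simp add: W ga_single_closed RG.m_assoc ga_single_mult)
  qed
  show "(a \<odot>\<^bsub>?W\<^esub> x) \<odot>r\<^bsub>?W\<^esub> b = a \<odot>\<^bsub>?W\<^esub> (x \<odot>r\<^bsub>?W\<^esub> b)"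
    if "a \<in> carrier RG" "x \<in> carrier ?W" "b \<in> carrier (subgroup_algebra R G X)" for a x b
    using that add_hom_closed[OF incl that(3)] by (simp add: W RG.m_assoc)
qed


section \<open>Induced modules\<close>

text \<open>With the coefficient fixed to one, generators of an induced module are indexed by a
  group element and a vector only; \<open>pure_eq_gen\<close> recovers the other
  coefficients.\<close>

definition ind_tensor ::
    "('r, 'x) ring_scheme \<Rightarrow> ('g, 'y) monoid_scheme \<Rightarrow> 'g set \<Rightarrow> ('g \<Rightarrow> 'r, 'm, 'z) module_scheme \<Rightarrow>
     'g \<Rightarrow> 'm \<Rightarrow> (('g \<Rightarrow> 'r) \<times> 'm \<Rightarrow>\<^sub>0 int) set" where
  "ind_tensor R G X M x m =
     pure_tensor (subgroup_algebra R G X) (regular_bimodule R G) M (ga_single R x \<one>\<^bsub>R\<^esub>) m"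

locale induced_module = finite_group_algebra R G
  for R :: "('r, 'x) ring_scheme" (structure) and G :: "('g, 'y) monoid_scheme" (structure) +
  fixes X :: "'g set" and M :: "('g \<Rightarrow> 'r, 'm, 'z) module_scheme"
  assumes subgroup_X: "subgroup X G" and module_M: "left_module (subgroup_algebra R G X) M"
begin

abbreviation "RX \<equiv> subgroup_algebra R G X"
abbreviation "act \<equiv> group_act R M"
abbreviation "scal r m \<equiv> ga_single R \<one>\<^bsub>G\<^esub> r \<odot>\<^bsub>M\<^esub> m"
abbreviation "gen \<equiv> ind_tensor R G X M"

lemma X_algebra: "finite_group_algebra R (G\<lparr>carrier := X\<rparr>)"
  by (rule finite_group_algebra_subgroup[OF finite_group_algebra_axioms subgroup_X])

lemma X_sub: "x \<in> X \<Longrightarrow> x \<in> carrier G"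
  using subgroup.subset[OF subgroup_X] by auto

lemma RX_single_closed: "\<lbrakk>x \<in> X; r \<in> carrier R\<rbrakk> \<Longrightarrow> ga_single R x r \<in> carrier RX"
  using finite_group_algebra.ga_single_closed[OF X_algebra] by (simp add: subgroup_algebra_def)

lemma RX_single_mult:
  "\<lbrakk>x \<in> X; y \<in> X; r \<in> carrier R; s \<in> carrier R\<rbrakk> \<Longrightarrow>
    ga_single R x r \<otimes>\<^bsub>RX\<^esub> ga_single R y s = ga_single R (x \<otimes>\<^bsub>G\<^esub> y) (r \<otimes> s)"
  using finite_group_algebra.ga_single_mult[OF X_algebra] by (simp add: subgroup_algebra_def)

lemma RX_single_hom: "x \<in> X \<Longrightarrow> ga_single R x \<in> add_hom R RX"
  using finite_group_algebra.ga_single_hom[OF X_algebra] by (simp add: subgroup_algebra_def)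

lemma RX_generates: "add_generates RX (ga_singles R X)"
  using finite_group_algebra.ga_generates[OF X_algebra] by (simp add: subgroup_algebra_def)

lemma one_X: "\<one>\<^bsub>G\<^esub> \<in> X"
  by (rule subgroup.one_closed[OF subgroup_X])

sublocale M: left_module RX M by (rule module_M)

sublocale ten: tensor_pair RX "regular_bimodule R G" M
  using regular_bimodule[OF subgroup_X] module_M by (simp add: tensor_pair_def bimodule_def)

lemma single_act:
  "\<lbrakk>x \<in> X; y \<in> X; r \<in> carrier R; s \<in> carrier R; m \<in> carrier M\<rbrakk> \<Longrightarrow>
    ga_single R x r \<odot>\<^bsub>M\<^esub> (ga_single R y s \<odot>\<^bsub>M\<^esub> m) = ga_single R (x \<otimes>\<^bsub>G\<^esub> y) (r \<otimes> s) \<odot>\<^bsub>M\<^esub> m"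
  by (simp add: RX_single_closed RX_single_mult flip: M.smult_assoc)

lemma single_closed: "\<lbrakk>x \<in> X; r \<in> carrier R; m \<in> carrier M\<rbrakk> \<Longrightarrow> ga_single R x r \<odot>\<^bsub>M\<^esub> m \<in> carrier M"
  by (simp add: RX_single_closed M.smult_closed)

lemma single_hom: "\<lbrakk>x \<in> X; r \<in> carrier R\<rbrakk> \<Longrightarrow> (\<lambda>m. ga_single R x r \<odot>\<^bsub>M\<^esub> m) \<in> add_hom M M"
  by (simp add: biadditive_homs(1)[OF left_module_biadditive[OF module_M]] RX_single_closed)

lemma scal_one: "m \<in> carrier M \<Longrightarrow> scal \<one> m = m"
  using M.smult_one by (simp add: subgroup_algebra_def group_algebra_simps(3))

lemma act_closed: "\<lbrakk>x \<in> X; m \<in> carrier M\<rbrakk> \<Longrightarrow> act x m \<in> carrier M"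
  by (simp add: group_act_def single_closed)

lemma act_act:
  "\<lbrakk>x \<in> X; y \<in> X; m \<in> carrier M\<rbrakk> \<Longrightarrow> act x (act y m) = act (x \<otimes>\<^bsub>G\<^esub> y) m"
  by (simp add: group_act_def single_act)

lemma act_one: "m \<in> carrier M \<Longrightarrow> act \<one>\<^bsub>G\<^esub> m = m"
  by (simp add: group_act_def scal_one)

lemma act_hom: "x \<in> X \<Longrightarrow> act x \<in> add_hom M M"
  using single_hom[of x \<one>] by (simp add: group_act_def[abs_def])

lemma act_scal:
  "\<lbrakk>x \<in> X; r \<in> carrier R; m \<in> carrier M\<rbrakk> \<Longrightarrow> act x (scal r m) = scal r (act x m)"
  by (simp add: group_act_def single_act one_X X_sub)

lemma single_regular_closed:
  "\<lbrakk>x \<in> carrier G; r \<in> carrier R\<rbrakk> \<Longrightarrow> ga_single R x r \<in> carrier (regular_bimodule R G)"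
  by (simp add: regular_bimodule_simps ga_single_closed)

lemma pure_single:
  assumes "x \<in> carrier G" "y \<in> X" "r \<in> carrier R" "s \<in> carrier R" "m \<in> carrier M"
  shows "ten.pure (ga_single R (x \<otimes>\<^bsub>G\<^esub> y) (r \<otimes> s)) m = ten.pure (ga_single R x r) (ga_single R y s \<odot>\<^bsub>M\<^esub> m)"
  using assms ten.pure_balanced[of "ga_single R x r" "ga_single R y s" m]
  by (simp add: single_regular_closed RX_single_closed) (simp add: regular_bimodule_simps ga_single_mult X_sub)

lemma gen_closed: "\<lbrakk>x \<in> carrier G; m \<in> carrier M\<rbrakk> \<Longrightarrow> gen x m \<in> carrier (Ind R G X M)"
  by (simp add: ind_tensor_def Ind_def ten.pure_closed single_regular_closed)

lemma gen_hom: "x \<in> carrier G \<Longrightarrow> gen x \<in> add_hom M (Ind R G X M)"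
  using biadditive_homs(1)[OF ten.pure_biadditive single_regular_closed]
  by (simp add: ind_tensor_def[abs_def] Ind_def)

lemma gen_mult:
  "\<lbrakk>x \<in> carrier G; y \<in> X; m \<in> carrier M\<rbrakk> \<Longrightarrow> gen (x \<otimes>\<^bsub>G\<^esub> y) m = gen x (act y m)"
  using pure_single[of x y \<one> \<one> m] by (simp add: ind_tensor_def group_act_def)

lemma pure_eq_gen:
  "\<lbrakk>x \<in> carrier G; r \<in> carrier R; m \<in> carrier M\<rbrakk> \<Longrightarrow> ten.pure (ga_single R x r) m = gen x (scal r m)"
  using pure_single[of x "\<one>\<^bsub>G\<^esub>" \<one> r m] by (simp add: ind_tensor_def one_X)

lemma Ind_generates: "add_generates (Ind R G X M) {gen x m | x m. x \<in> carrier G \<and> m \<in> carrier M}"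
proof (rule add_generates_mono)
  have "add_generates (regular_bimodule R G) (ga_singles R (carrier G))"
    using ga_generates by (simp add: add_hom_cong(3)[OF regular_bimodule_simps(1,3)])
  from ten.pure_generates[OF this add_generates_carrier]
  show "add_generates (Ind R G X M) {ten.pure p q | p q.
      p \<in> ga_singles R (carrier G) \<and> q \<in> carrier M}"
    by (simp add: Ind_def)
  show "{ten.pure p q | p q. p \<in> ga_singles R (carrier G) \<and> q \<in> carrier M}
      \<subseteq> {gen x m | x m. x \<in> carrier G \<and> m \<in> carrier M}"
    using single_closed[OF one_X] by (auto simp: pure_eq_gen) blast
qed (auto intro: gen_closed)

text \<open>Meant for the right-hand side of the formula, where the inducing module is itself a
  tensor product and is handled through its pure tensors.\<close>

lemma Ind_generates_from:
  assumes "add_generates M S"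
  shows "add_generates (Ind R G X M) {gen x m | x m. x \<in> carrier G \<and> m \<in> S}" (is "add_generates _ ?S")
proof (rule add_generates_trans[OF Ind_generates])
  have sub: "S \<subseteq> carrier M" using assms by (auto simp: add_generates_def)
  then show "?S \<subseteq> carrier (Ind R G X M)" by (auto intro: gen_closed)
  fix U s
  assume S: "?S \<subseteq> U" and "s \<in> {gen x m | x m. x \<in> carrier G \<and> m \<in> carrier M}"
    and U: "\<And>x y. \<lbrakk>x \<in> U; y \<in> U; x \<in> carrier (Ind R G X M); y \<in> carrier (Ind R G X M)\<rbrakk> \<Longrightarrow>
      x \<oplus>\<^bsub>Ind R G X M\<^esub> y \<in> U"
  then obtain x m where s: "s = gen x m" "x \<in> carrier G" "m \<in> carrier M" by blast
  have "gen x m \<in> U"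
    using assms s(3)
  proof (induction m rule: add_generates_induct)
    case (gen m)
    with S s(2) show ?case by blast
  next
    case (add m m')
    then show ?case using s(2) by (simp add: add_hom_add[OF gen_hom] U gen_closed)
  qed
  with s show "s \<in> U" by simp
qed

lemma Ind_left_module: "left_module RG (Ind R G X M)"
  and Ind_single: "\<lbrakk>y \<in> carrier G; x \<in> carrier G; r \<in> carrier R; m \<in> carrier M\<rbrakk> \<Longrightarrow>
    ga_single R y r \<odot>\<^bsub>Ind R G X M\<^esub> gen x m = gen (y \<otimes>\<^bsub>G\<^esub> x) (scal r m)"
proof -
  interpret W: bimodule RG RX "regular_bimodule R G" by (rule regular_bimodule[OF subgroup_X])
  have *: "left_module RG ten.T"
    "\<And>c p q. \<lbrakk>c \<in> carrier RG; p \<in> carrier (regular_bimodule R G); q \<in> carrier M\<rbrakk> \<Longrightarrow>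
      c \<odot>\<^bsub>ten.T\<^esub> ten.pure p q = ten.pure (c \<odot>\<^bsub>regular_bimodule R G\<^esub> p) q"
    using W.smult_rsmult by (intro ten.tensor_left_module[OF W.left_module_axioms]; blast)+
  from *(1) show "left_module RG (Ind R G X M)" by (simp add: Ind_def)
  show "ga_single R y r \<odot>\<^bsub>Ind R G X M\<^esub> gen x m = gen (y \<otimes>\<^bsub>G\<^esub> x) (scal r m)"
    if "y \<in> carrier G" "x \<in> carrier G" "r \<in> carrier R" "m \<in> carrier M"
    using *(2)[OF ga_single_closed single_regular_closed] that
    by (simp add: ind_tensor_def[of R G X M x m] Ind_def regular_bimodule_simps ga_single_mult pure_eq_gen)
qed

text \<open>No linearity over \<open>R\<close> is required of \<open>f\<close>, because \<open>r x \<otimes> m = x \<otimes> r m\<close> moves all scalars into \<open>M\<close>.\<close>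

lemma Ind_universal:
  assumes Z: "abelian_group Z" and f: "\<And>x. x \<in> carrier G \<Longrightarrow> f x \<in> add_hom M Z"
    and fX: "\<And>x y m. \<lbrakk>x \<in> carrier G; y \<in> X; m \<in> carrier M\<rbrakk> \<Longrightarrow> f (x \<otimes>\<^bsub>G\<^esub> y) m = f x (act y m)"
  shows "\<exists>\<Phi>\<in>add_hom (Ind R G X M) Z. \<forall>x\<in>carrier G. \<forall>m\<in>carrier M. \<Phi> (gen x m) = f x m"
proof -
  interpret Z: abelian_group Z by fact
  let ?W = "regular_bimodule R G"
  note W = regular_bimodule_simps[of R G]
  note biM = left_module_biadditive[OF module_M]
  \<comment> \<open>The only possible choice: expand \<open>a\<close> as the sum of its coefficients
    times group elements, move each coefficient into the module and apply \<open>f\<close>.\<close>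
  define B where "B a m = (\<Oplus>\<^bsub>Z\<^esub>x\<in>carrier G. f x (scal (a x) m))" for a m
  note single_hom1 = RX_single_hom[OF one_X]
  have B: "biadditive RG M Z B"
    unfolding biadditive_def
  proof (intro conjI ballI)
    fix a assume a: "a \<in> carrier RG"
    have "(\<lambda>m. f x (scal (a x) m)) \<in> add_hom M Z" if "x \<in> carrier G" for x
      using a that by (intro add_hom_comp[OF single_hom f]) (auto simp: one_X group_algebra_simps)
    from add_hom_finsum[OF M.abelian_group_axioms Z this]
    show "B a \<in> add_hom M Z" by (simp add: B_def[abs_def])
  next
    fix m assume m: "m \<in> carrier M"
    have "(\<lambda>a. f x (scal (a x) m)) \<in> add_hom RG Z" if "x \<in> carrier G" for x
      using add_hom_comp[OF add_hom_comp[OF add_hom_comp[OF ga_eval_hom[OF that] single_hom1] biadditive_homs(2)[OF biM m]] f[OF that]] .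
    from add_hom_finsum[OF group_algebra_abelian_group Z this]
    show "(\<lambda>a. B a m) \<in> add_hom RG Z" by (simp add: B_def)
  qed
  have B_single: "B (ga_single R x r) m = f x (scal r m)"
    if "x \<in> carrier G" "r \<in> carrier R" "m \<in> carrier M" for x r m
  proof -
    \<comment> \<open>The summands away from \<open>x\<close> have coefficient zero and vanish
      because \<open>f y\<close>, being additive, preserves zero.\<close>
    have z: "f y (scal \<zero> m) = \<zero>\<^bsub>Z\<^esub>" if "y \<in> carrier G" for y
    proof -
      have "scal \<zero> m = \<zero>\<^bsub>M\<^esub>"
        using add_hom_zero[OF add_hom_comp[OF single_hom1 biadditive_homs(2)[OF biM]] R.is_abelian_group M.abelian_group_axioms] \<open>m \<in> _\<close>
        by simp
      then show ?thesis using add_hom_zero[OF f[OF that] M.abelian_group_axioms Z] by simp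
    qed
    have fc: "f y (scal r m) \<in> carrier Z" if "y \<in> carrier G" for y
      using add_hom_closed[OF f[OF that] single_closed[OF one_X]] \<open>r \<in> _\<close> \<open>m \<in> _\<close> by simp
    have "B (ga_single R x r) m = (\<Oplus>\<^bsub>Z\<^esub>y\<in>carrier G. if x = y then f y (scal r m) else \<zero>\<^bsub>Z\<^esub>)"
      unfolding B_def using that fc z by (intro Z.finsum_cong') (auto simp: ga_single_def)
    also have "\<dots> = f x (scal r m)"
      using that fc finite_carrier by (intro Z.finsum_singleton) auto
    finally show ?thesis .
  qed
  have bal: "B (p \<odot>r\<^bsub>?W\<^esub> a) q = B p (a \<odot>\<^bsub>M\<^esub> q)"
    if "p \<in> carrier ?W" "a \<in> carrier RX" "q \<in> carrier M" for p a q
  proof (rule balancedI[OF ten.right module_M _ _ RX_generates add_generates_carrier _ that])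
    show "biadditive ?W M Z B" using B by (simp add: add_hom_cong[OF W(1,3)])
    show "add_generates ?W (ga_singles R (carrier G))"
      using ga_generates by (simp add: add_hom_cong[OF W(1,3)])
    fix p a q assume "p \<in> ga_singles R (carrier G)"
      and "a \<in> ga_singles R X" and q: "q \<in> carrier M"
    then obtain x r y s where *: "p = ga_single R x r" "x \<in> carrier G" "r \<in> carrier R"
      "a = ga_single R y s" "y \<in> X" "s \<in> carrier R" by blast
    \<comment> \<open>For \<open>p = r x\<close> and \<open>a = s y\<close> both sides are
      \<open>f x\<close> at the vector \<open>(r s) y q\<close>: on the left by the hypothesis
      \<open>fX\<close>, on the right by associativity in \<open>M\<close>.\<close>
    then show "B (p \<odot>r\<^bsub>?W\<^esub> a) q = B p (a \<odot>\<^bsub>M\<^esub> q)"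
      using q by (simp add: W ga_single_mult X_sub B_single single_closed fX one_X single_act group_act_def)
  qed
  from B have "biadditive ?W M Z B" by (simp add: add_hom_cong[OF W(1,3)])
  from ten.tensor_universal[OF Z this bal]
  obtain \<Phi> where \<Phi>: "\<Phi> \<in> add_hom ten.T Z"
    "\<And>p q. \<lbrakk>p \<in> carrier ?W; q \<in> carrier M\<rbrakk> \<Longrightarrow> \<Phi> (ten.pure p q) = B p q" by blast
  have "\<Phi> (gen x m) = f x m" if "x \<in> carrier G" "m \<in> carrier M" for x m
    using that \<Phi>(2)[OF single_regular_closed] by (simp add: ind_tensor_def B_single scal_one)
  with \<Phi>(1) show ?thesis by (auto simp: Ind_def)
qed

end

section \<open>The tensor product of two induced bimodules\<close>

locale induced_pair =
  K: finite_group_algebra R K + H: finite_group_algebra R H + G: finite_group_algebra R G +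
  N: induced_module R "K \<times>\<times> H" Y N + M: induced_module R "H \<times>\<times> G" X M
  for R :: "('r, 'x) ring_scheme" and K :: "('k, 'u) monoid_scheme" and H :: "('h, 'v) monoid_scheme"
    and G :: "('g, 'w) monoid_scheme" and Y :: "('k \<times> 'h) set" and X :: "('h \<times> 'g) set"
    and N :: "('k \<times> 'h \<Rightarrow> 'r, 'n, 'c) module_scheme" and M :: "('h \<times> 'g \<Rightarrow> 'r, 'm, 'd) module_scheme"
begin

abbreviation "IN \<equiv> as_bimodule R K H (Ind R (K \<times>\<times> H) Y N)"
abbreviation "IM \<equiv> as_bimodule R H G (Ind R (H \<times>\<times> G) X M)"
abbreviation "IN_gens \<equiv> {N.gen (k, h) n | k h n. k \<in> carrier K \<and> h \<in> carrier H \<and> n \<in> carrier N}"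
abbreviation "IM_gens \<equiv> {M.gen (h, g) m | h g m. h \<in> carrier H \<and> g \<in> carrier G \<and> m \<in> carrier M}"
abbreviation "IT \<equiv> tensor_bimodule H.RG IN IM"

text \<open>The \<open>H\<close>-component of the first factor is normalised to the identity. Since
  the tensor product is taken over the group algebra of \<open>H\<close>, any other value can be
  moved into the second factor.\<close>

definition ind_pure :: "'k \<Rightarrow> 'h \<Rightarrow> 'g \<Rightarrow> 'n \<Rightarrow> 'm \<Rightarrow>
    ((('k \<times> 'h \<Rightarrow> 'r) \<times> 'n \<Rightarrow>\<^sub>0 int) set \<times> (('h \<times> 'g \<Rightarrow> 'r) \<times> 'm \<Rightarrow>\<^sub>0 int) set \<Rightarrow>\<^sub>0 int) set" where
  "ind_pure k h g n m =
     pure_tensor H.RG IN IM (N.gen (k, \<one>\<^bsub>H\<^esub>) n) (M.gen (h, g) m)"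

abbreviation "IT_gens \<equiv> {ind_pure k h g n m | k h g n m. k \<in> carrier K \<and> h \<in> carrier H \<and>
     g \<in> carrier G \<and> n \<in> carrier N \<and> m \<in> carrier M}"

lemma Y_closed: "(k, h) \<in> Y \<Longrightarrow> k \<in> carrier K" "(k, h) \<in> Y \<Longrightarrow> h \<in> carrier H"
  using N.X_sub by auto

lemma X_closed: "(h, g) \<in> X \<Longrightarrow> h \<in> carrier H" "(h, g) \<in> X \<Longrightarrow> g \<in> carrier G"
  using M.X_sub by auto

lemma IN_bimodule: "bimodule K.RG H.RG IN"
  by (rule as_bimodule(1)[OF K.finite_group_algebra_axioms H.finite_group_algebra_axioms N.Ind_left_module])

lemma IM_bimodule: "bimodule H.RG G.RG IM"
  by (rule as_bimodule(1)[OF H.finite_group_algebra_axioms G.finite_group_algebra_axioms M.Ind_left_module])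

lemma IT_bimodule: "bimodule K.RG G.RG IT"
  by (rule tensor_bimodule(1)[OF IN_bimodule IM_bimodule])

sublocale ten: tensor_pair H.RG IN IM
  using IN_bimodule IM_bimodule by (simp add: tensor_pair_def bimodule_def)

lemma IN_gen_closed:
  "\<lbrakk>k \<in> carrier K; h \<in> carrier H; n \<in> carrier N\<rbrakk> \<Longrightarrow> N.gen (k, h) n \<in> carrier IN"
  by (simp add: as_bimodule_simps N.gen_closed)

lemma IM_gen_closed:
  "\<lbrakk>h \<in> carrier H; g \<in> carrier G; m \<in> carrier M\<rbrakk> \<Longrightarrow> M.gen (h, g) m \<in> carrier IM"
  by (simp add: as_bimodule_simps M.gen_closed)

lemma IN_gen_hom: "\<lbrakk>k \<in> carrier K; h \<in> carrier H\<rbrakk> \<Longrightarrow> N.gen (k, h) \<in> add_hom N IN"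
  using N.gen_hom[of "(k, h)"] by (simp add: add_hom_cong(2)[OF as_bimodule_simps(1,3)])

lemma IM_gen_hom: "\<lbrakk>h \<in> carrier H; g \<in> carrier G\<rbrakk> \<Longrightarrow> M.gen (h, g) \<in> add_hom M IM"
  using M.gen_hom[of "(h, g)"] by (simp add: add_hom_cong(2)[OF as_bimodule_simps(1,3)])

lemma IN_generates: "add_generates IN IN_gens"
proof -
  have "{N.gen x n | x n. x \<in> carrier (K \<times>\<times> H) \<and> n \<in> carrier N} =
      IN_gens" by auto
  with N.Ind_generates show ?thesis by (simp add: add_hom_cong(3)[OF as_bimodule_simps(1,3)])
qed

lemma IM_generates: "add_generates IM IM_gens"
proof -
  have "{M.gen x m | x m. x \<in> carrier (H \<times>\<times> G) \<and> m \<in> carrier M} =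
      IM_gens" by auto
  with M.Ind_generates show ?thesis by (simp add: add_hom_cong(3)[OF as_bimodule_simps(1,3)])
qed

lemma IN_left:
  assumes "k' \<in> carrier K" "k \<in> carrier K" "h \<in> carrier H" "r \<in> carrier R" "n \<in> carrier N"
  shows "ga_single R k' r \<odot>\<^bsub>IN\<^esub> N.gen (k, h) n = N.gen (k' \<otimes>\<^bsub>K\<^esub> k, h) (N.scal r n)"
  using assms N.Ind_single[of "(k', \<one>\<^bsub>H\<^esub>)" "(k, h)" r n]
  by (simp add: as_bimodule(2)[OF K.finite_group_algebra_axioms H.finite_group_algebra_axioms N.Ind_left_module])

lemma IN_right:
  assumes "h' \<in> carrier H" "k \<in> carrier K" "h \<in> carrier H" "r \<in> carrier R" "n \<in> carrier N"
  shows "N.gen (k, h) n \<odot>r\<^bsub>IN\<^esub> ga_single R h' r = N.gen (k, inv\<^bsub>H\<^esub> h' \<otimes>\<^bsub>H\<^esub> h) (N.scal r n)"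
  using assms N.Ind_single[of "(\<one>\<^bsub>K\<^esub>, inv\<^bsub>H\<^esub> h')" "(k, h)" r n]
  by (simp add: as_bimodule(3)[OF K.finite_group_algebra_axioms H.finite_group_algebra_axioms N.Ind_left_module])

lemma IM_left:
  assumes "h' \<in> carrier H" "h \<in> carrier H" "g \<in> carrier G" "r \<in> carrier R" "m \<in> carrier M"
  shows "ga_single R h' r \<odot>\<^bsub>IM\<^esub> M.gen (h, g) m = M.gen (h' \<otimes>\<^bsub>H\<^esub> h, g) (M.scal r m)"
  using assms M.Ind_single[of "(h', \<one>\<^bsub>G\<^esub>)" "(h, g)" r m]
  by (simp add: as_bimodule(2)[OF H.finite_group_algebra_axioms G.finite_group_algebra_axioms M.Ind_left_module])

lemma IM_right:
  assumes "g' \<in> carrier G" "h \<in> carrier H" "g \<in> carrier G" "r \<in> carrier R" "m \<in> carrier M"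
  shows "M.gen (h, g) m \<odot>r\<^bsub>IM\<^esub> ga_single R g' r = M.gen (h, inv\<^bsub>G\<^esub> g' \<otimes>\<^bsub>G\<^esub> g) (M.scal r m)"
  using assms M.Ind_single[of "(\<one>\<^bsub>H\<^esub>, inv\<^bsub>G\<^esub> g')" "(h, g)" r m]
  by (simp add: as_bimodule(3)[OF H.finite_group_algebra_axioms G.finite_group_algebra_axioms M.Ind_left_module])

text \<open>An element of \<open>H\<close> acts on the right of the first factor through its
  inverse. So \<open>h'\<close> in that factor is the right action of \<open>h'^-1\<close> on the
  normalised generator, and \<open>h'^-1\<close> is what crosses the tensor sign.\<close>

lemma pure_gen_gen:
  assumes "k \<in> carrier K" "h' \<in> carrier H" "h \<in> carrier H" "g \<in> carrier G" "n \<in> carrier N" "m \<in> carrier M"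
  shows "ten.pure (N.gen (k, h') n) (M.gen (h, g) m) = ind_pure k (inv\<^bsub>H\<^esub> h' \<otimes>\<^bsub>H\<^esub> h) g n m"
proof -
  have s: "N.scal \<one>\<^bsub>R\<^esub> n = n" "M.scal \<one>\<^bsub>R\<^esub> m = m" using assms N.scal_one M.scal_one by auto
  have "N.gen (k, \<one>\<^bsub>H\<^esub>) n \<odot>r\<^bsub>IN\<^esub> ga_single R (inv\<^bsub>H\<^esub> h') \<one>\<^bsub>R\<^esub> = N.gen (k, h') n"
    "ga_single R (inv\<^bsub>H\<^esub> h') \<one>\<^bsub>R\<^esub> \<odot>\<^bsub>IM\<^esub> M.gen (h, g) m = M.gen (inv\<^bsub>H\<^esub> h' \<otimes>\<^bsub>H\<^esub> h, g) m"
    using assms s IN_right[of "inv\<^bsub>H\<^esub> h'" k "\<one>\<^bsub>H\<^esub>" "\<one>\<^bsub>R\<^esub>" n] IM_left[of "inv\<^bsub>H\<^esub> h'" h g "\<one>\<^bsub>R\<^esub>" m] by simp_all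
  then show ?thesis
    using assms ten.pure_balanced[OF IN_gen_closed[of k "\<one>\<^bsub>H\<^esub>" n] _ IM_gen_closed[of h g m],
        of "ga_single R (inv\<^bsub>H\<^esub> h') \<one>\<^bsub>R\<^esub>"]
    by (simp add: ind_pure_def H.ga_single_closed)
qed

lemma ind_pure_closed:
  "\<lbrakk>k \<in> carrier K; h \<in> carrier H; g \<in> carrier G; n \<in> carrier N; m \<in> carrier M\<rbrakk> \<Longrightarrow>
    ind_pure k h g n m \<in> carrier IT"
  by (simp add: ind_pure_def tensor_bimodule_simps ten.pure_closed IN_gen_closed IM_gen_closed)

lemma ind_pure_biadditive:
  "\<lbrakk>k \<in> carrier K; h \<in> carrier H; g \<in> carrier G\<rbrakk> \<Longrightarrow> biadditive N M IT (ind_pure k h g)"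
  using biadditive_comp[OF ten.pure_biadditive IN_gen_hom[of k "\<one>\<^bsub>H\<^esub>"] IM_gen_hom[of h g]]
  by (simp add: ind_pure_def[abs_def] add_hom_cong(6)[OF tensor_bimodule_simps(1,3)])

text \<open>Write \<open>(k k0, 1) = (k, u^-1) (k0, u)\<close>: the second element acts on
  \<open>n\<close>, and the component \<open>u^-1\<close> left behind reaches the second factor as
  \<open>u\<close>.\<close>

lemma ind_pure_Y:
  assumes "k \<in> carrier K" "h \<in> carrier H" "g \<in> carrier G" "n \<in> carrier N" "m \<in> carrier M" "(k0, u) \<in> Y"
  shows "ind_pure (k \<otimes>\<^bsub>K\<^esub> k0) h g n m = ind_pure k (u \<otimes>\<^bsub>H\<^esub> h) g (N.act (k0, u) n) m"
proof -
  note c = Y_closed[OF assms(6)]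
  have "N.gen (k \<otimes>\<^bsub>K\<^esub> k0, \<one>\<^bsub>H\<^esub>) n = N.gen (k, inv\<^bsub>H\<^esub> u) (N.act (k0, u) n)"
    using assms c N.gen_mult[of "(k, inv\<^bsub>H\<^esub> u)" "(k0, u)" n] by simp
  then have "ind_pure (k \<otimes>\<^bsub>K\<^esub> k0) h g n m = ten.pure (N.gen (k, inv\<^bsub>H\<^esub> u) (N.act (k0, u) n)) (M.gen (h, g) m)"
    by (simp add: ind_pure_def)
  then show ?thesis using assms c by (simp add: pure_gen_gen N.act_closed)
qed

lemma ind_pure_X:
  assumes "k \<in> carrier K" "h \<in> carrier H" "g \<in> carrier G" "n \<in> carrier N" "m \<in> carrier M" "(v, g0) \<in> X"
  shows "ind_pure k (h \<otimes>\<^bsub>H\<^esub> v) (g \<otimes>\<^bsub>G\<^esub> g0) n m = ind_pure k h g n (M.act (v, g0) m)"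
  using assms M.gen_mult[of "(h, g)" "(v, g0)" m] by (simp add: ind_pure_def)

lemma ind_pure_scal:
  assumes "k \<in> carrier K" "h \<in> carrier H" "g \<in> carrier G" "n \<in> carrier N" "m \<in> carrier M" "r \<in> carrier R"
  shows "ind_pure k h g (N.scal r n) m = ind_pure k h g n (M.scal r m)"
  using assms ten.pure_balanced[OF IN_gen_closed[of k "\<one>\<^bsub>H\<^esub>" n] _ IM_gen_closed[of h g m],
      of "ga_single R \<one>\<^bsub>H\<^esub> r"]
  by (simp add: IN_right IM_left ind_pure_def H.ga_single_closed)

lemma IT_left:
  assumes "k' \<in> carrier K" "r \<in> carrier R" "k \<in> carrier K" "h \<in> carrier H" "g \<in> carrier G"
    "n \<in> carrier N" "m \<in> carrier M"
  shows "ga_single R k' r \<odot>\<^bsub>IT\<^esub> ind_pure k h g n m = ind_pure (k' \<otimes>\<^bsub>K\<^esub> k) h g (N.scal r n) m"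
  using assms tensor_bimodule(2)[OF IN_bimodule IM_bimodule K.ga_single_closed[of k' r]
      IN_gen_closed[of k "\<one>\<^bsub>H\<^esub>" n] IM_gen_closed[of h g m]]
  by (simp add: ind_pure_def IN_left)

lemma IT_right:
  assumes "g' \<in> carrier G" "r \<in> carrier R" "k \<in> carrier K" "h \<in> carrier H" "g \<in> carrier G"
    "n \<in> carrier N" "m \<in> carrier M"
  shows "ind_pure k h g n m \<odot>r\<^bsub>IT\<^esub> ga_single R g' r = ind_pure k h (inv\<^bsub>G\<^esub> g' \<otimes>\<^bsub>G\<^esub> g) n (M.scal r m)"
  using assms tensor_bimodule(3)[OF IN_bimodule IM_bimodule G.ga_single_closed[of g' r]
      IN_gen_closed[of k "\<one>\<^bsub>H\<^esub>" n] IM_gen_closed[of h g m]]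
  by (simp add: ind_pure_def IM_right)

lemma IT_generates:
  "add_generates IT IT_gens"
proof (rule add_generates_mono)
  show "add_generates IT {ten.pure p q | p q. p \<in> IN_gens \<and> q \<in> IM_gens}"
    using ten.pure_generates[OF IN_generates IM_generates]
    by (simp add: add_hom_cong(3)[OF tensor_bimodule_simps(1,3)])
  show "{ten.pure p q | p q. p \<in> IN_gens \<and> q \<in> IM_gens} \<subseteq> IT_gens"
  proof
    fix w assume "w \<in> {ten.pure p q | p q. p \<in> IN_gens \<and> q \<in> IM_gens}"
    then obtain k h' n h g m where *: "w = ten.pure (N.gen (k, h') n) (M.gen (h, g) m)"
      "k \<in> carrier K" "h' \<in> carrier H" "n \<in> carrier N" "h \<in> carrier H" "g \<in> carrier G" "m \<in> carrier M" by blast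
    then have "w = ind_pure k (inv\<^bsub>H\<^esub> h' \<otimes>\<^bsub>H\<^esub> h) g n m" "inv\<^bsub>H\<^esub> h' \<otimes>\<^bsub>H\<^esub> h \<in> carrier H"
      by (simp_all add: pure_gen_gen)
    with * show "w \<in> IT_gens" by blast
  qed
qed (auto intro: ind_pure_closed)

text \<open>Three universal properties are nested: induction from \<open>X\<close> for fixed
  \<open>(k, h', n)\<close>, induction from \<open>Y\<close> for a fixed element \<open>q\<close> of
  the second factor, and the tensor product over the group algebra of \<open>H\<close>. They consume
  \<open>fX\<close>, \<open>fY\<close> and \<open>fR\<close> in this order.\<close>

lemma IT_universal:
  assumes Z: "abelian_group Z"
    and bi: "\<And>k h g. \<lbrakk>k \<in> carrier K; h \<in> carrier H; g \<in> carrier G\<rbrakk> \<Longrightarrow> biadditive N M Z (f k h g)"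
    and fY: "\<And>k h g n m k0 u. \<lbrakk>k \<in> carrier K; h \<in> carrier H; g \<in> carrier G; n \<in> carrier N; m \<in> carrier M;
      (k0, u) \<in> Y\<rbrakk> \<Longrightarrow> f (k \<otimes>\<^bsub>K\<^esub> k0) h g n m = f k (u \<otimes>\<^bsub>H\<^esub> h) g (N.act (k0, u) n) m"
    and fX: "\<And>k h g n m v g0. \<lbrakk>k \<in> carrier K; h \<in> carrier H; g \<in> carrier G; n \<in> carrier N; m \<in> carrier M;
      (v, g0) \<in> X\<rbrakk> \<Longrightarrow> f k (h \<otimes>\<^bsub>H\<^esub> v) (g \<otimes>\<^bsub>G\<^esub> g0) n m = f k h g n (M.act (v, g0) m)"
    and fR: "\<And>k h g n m r. \<lbrakk>k \<in> carrier K; h \<in> carrier H; g \<in> carrier G; n \<in> carrier N; m \<in> carrier M;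
      r \<in> carrier R\<rbrakk> \<Longrightarrow> f k h g (N.scal r n) m = f k h g n (M.scal r m)"
  obtains \<Phi> where "\<Phi> \<in> add_hom IT Z"
    "\<And>k h g n m. \<lbrakk>k \<in> carrier K; h \<in> carrier H; g \<in> carrier G; n \<in> carrier N; m \<in> carrier M\<rbrakk> \<Longrightarrow>
      \<Phi> (ind_pure k h g n m) = f k h g n m"
proof -
  interpret Z: abelian_group Z by fact
  let ?IN = "Ind R (K \<times>\<times> H) Y N" and ?IM = "Ind R (H \<times>\<times> G) X M"
  note addN = add_hom_cong[OF as_bimodule_simps(1,3)[of R K H ?IN]]
  note addM = add_hom_cong[OF as_bimodule_simps(1,3)[of R H G ?IM]]
  \<comment> \<open>The argument \<open>h'^-1 h\<close> anticipates \<open>pure_gen_gen\<close>: a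
    map defined on all pairs of generators has to respect this normal form.\<close>
  have "\<exists>\<Phi>\<in>add_hom ?IM Z. \<forall>x\<in>carrier (H \<times>\<times> G). \<forall>m\<in>carrier M.
      \<Phi> (M.gen x m) = (\<lambda>(h, g). f k (inv\<^bsub>H\<^esub> h' \<otimes>\<^bsub>H\<^esub> h) g n) x m"
    if "k \<in> carrier K" "h' \<in> carrier H" "n \<in> carrier N" for k h' n
  proof (rule M.Ind_universal[OF Z])
    show "(case x of (h, g) \<Rightarrow> f k (inv\<^bsub>H\<^esub> h' \<otimes>\<^bsub>H\<^esub> h) g n) \<in> add_hom M Z"
      if "x \<in> carrier (H \<times>\<times> G)" for x
      using that \<open>k \<in> _\<close> \<open>h' \<in> _\<close> \<open>n \<in> _\<close> by (auto intro!: biadditive_homs(1)[OF bi])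
    fix x y m assume "x \<in> carrier (H \<times>\<times> G)" "y \<in> X" "m \<in> carrier M"
    with that show "(case x \<otimes>\<^bsub>H \<times>\<times> G\<^esub> y of (h, g) \<Rightarrow> f k (inv\<^bsub>H\<^esub> h' \<otimes>\<^bsub>H\<^esub> h) g n) m =
        (case x of (h, g) \<Rightarrow> f k (inv\<^bsub>H\<^esub> h' \<otimes>\<^bsub>H\<^esub> h) g n) (M.act y m)"
      by (cases y) (auto simp: X_closed fX H.G.m_assoc[symmetric])
  qed
  then have "\<forall>p\<in>carrier K \<times> carrier H \<times> carrier N. \<exists>\<Phi>. \<Phi> \<in> add_hom IM Z \<and>
      (\<forall>h\<in>carrier H. \<forall>g\<in>carrier G. \<forall>m\<in>carrier M. \<Phi> (M.gen (h, g) m) =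
        f (fst p) (inv\<^bsub>H\<^esub> (fst (snd p)) \<otimes>\<^bsub>H\<^esub> h) g (snd (snd p)) m)"
    by (fastforce simp: addM)
  from bchoice[OF this] obtain \<phi> where \<phi>: "\<forall>p\<in>carrier K \<times> carrier H \<times> carrier N. \<phi> p \<in> add_hom IM Z \<and>
      (\<forall>h\<in>carrier H. \<forall>g\<in>carrier G. \<forall>m\<in>carrier M. \<phi> p (M.gen (h, g) m) =
        f (fst p) (inv\<^bsub>H\<^esub> (fst (snd p)) \<otimes>\<^bsub>H\<^esub> h) g (snd (snd p)) m)" ..
  have \<phi>_hom: "\<phi> (k, h', n) \<in> add_hom IM Z" if "k \<in> carrier K" "h' \<in> carrier H" "n \<in> carrier N" for k h' n
    using \<phi> that by auto
  have \<phi>_gen: "\<phi> (k, h', n) (M.gen (h, g) m) = f k (inv\<^bsub>H\<^esub> h' \<otimes>\<^bsub>H\<^esub> h) g n m"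
    if "k \<in> carrier K" "h' \<in> carrier H" "n \<in> carrier N" "h \<in> carrier H" "g \<in> carrier G" "m \<in> carrier M"
    for k h' n h g m
    using \<phi> that by auto
  \<comment> \<open>Now \<open>q\<close> is fixed and \<open>\<phi> (k, h', n) q\<close> is a family
    in \<open>(k, h', n)\<close>. Its additivity in \<open>n\<close> and its compatibility with
    \<open>Y\<close> are identities between additive maps of \<open>q\<close>, hence they can be
    tested on generators of the second factor.\<close>
  have "\<exists>\<Theta>\<in>add_hom ?IN Z. \<forall>x\<in>carrier (K \<times>\<times> H). \<forall>n\<in>carrier N.
      \<Theta> (N.gen x n) = (\<lambda>(k, h') n. \<phi> (k, h', n) q) x n" if q: "q \<in> carrier IM" for q
  proof (rule N.Ind_universal[OF Z])
    fix x assume "x \<in> carrier (K \<times>\<times> H)"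
    then obtain k h' where x: "x = (k, h')" "k \<in> carrier K" "h' \<in> carrier H" by auto
    show "(case x of (k, h') \<Rightarrow> \<lambda>n. \<phi> (k, h', n) q) \<in> add_hom N Z"
      unfolding x prod.case
    proof (rule add_homI)
      fix n n' assume n: "n \<in> carrier N" "n' \<in> carrier N"
      show "\<phi> (k, h', n \<oplus>\<^bsub>N\<^esub> n') q = \<phi> (k, h', n) q \<oplus>\<^bsub>Z\<^esub> \<phi> (k, h', n') q"
        by (rule add_hom_eqI[OF IM_generates \<phi>_hom add_hom_plus[OF ten.Q.abelian_group_axioms Z \<phi>_hom \<phi>_hom] _ q])
          (use x n in \<open>auto simp: \<phi>_gen biadditiveD[OF bi]\<close>)
    qed (use x q in \<open>auto intro: add_hom_closed[OF \<phi>_hom]\<close>)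
    fix y n assume y: "y \<in> Y" and n: "n \<in> carrier N"
    then obtain k0 u where y': "y = (k0, u)" "(k0, u) \<in> Y" by (cases y) auto
    note yc = Y_closed[OF y'(2)]
    have "\<phi> (k \<otimes>\<^bsub>K\<^esub> k0, h' \<otimes>\<^bsub>H\<^esub> u, n) q = \<phi> (k, h', N.act (k0, u) n) q"
    proof (rule add_hom_eqI[OF IM_generates \<phi>_hom \<phi>_hom _ q])
      fix s assume "s \<in> IM_gens"
      then obtain h g m where s: "s = M.gen (h, g) m" "h \<in> carrier H" "g \<in> carrier G" "m \<in> carrier M" by blast
      have "u \<otimes>\<^bsub>H\<^esub> (inv\<^bsub>H\<^esub> (h' \<otimes>\<^bsub>H\<^esub> u) \<otimes>\<^bsub>H\<^esub> h) = inv\<^bsub>H\<^esub> h' \<otimes>\<^bsub>H\<^esub> h"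
        using x yc s by (simp add: H.G.inv_mult_group H.G.m_assoc[symmetric])
      then show "\<phi> (k \<otimes>\<^bsub>K\<^esub> k0, h' \<otimes>\<^bsub>H\<^esub> u, n) s = \<phi> (k, h', N.act (k0, u) n) s"
        using x yc y'(2) s n by (simp add: \<phi>_gen N.act_closed fY)
    qed (use x yc y' n in \<open>auto simp: N.act_closed\<close>)
    then show "(case x \<otimes>\<^bsub>K \<times>\<times> H\<^esub> y of (k, h') \<Rightarrow> \<lambda>n. \<phi> (k, h', n) q) n =
        (case x of (k, h') \<Rightarrow> \<lambda>n. \<phi> (k, h', n) q) (N.act y n)"
      by (simp add: x y')
  qed
  then have "\<forall>q\<in>carrier IM. \<exists>\<Theta>. \<Theta> \<in> add_hom IN Z \<and> (\<forall>k\<in>carrier K. \<forall>h'\<in>carrier H. \<forall>n\<in>carrier N.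
      \<Theta> (N.gen (k, h') n) = \<phi> (k, h', n) q)"
    by (fastforce simp: addN)
  from bchoice[OF this] obtain \<theta> where \<theta>: "\<forall>q\<in>carrier IM. \<theta> q \<in> add_hom IN Z \<and>
      (\<forall>k\<in>carrier K. \<forall>h'\<in>carrier H. \<forall>n\<in>carrier N. \<theta> q (N.gen (k, h') n) = \<phi> (k, h', n) q)" ..
  have \<theta>_hom: "\<theta> q \<in> add_hom IN Z" if "q \<in> carrier IM" for q using \<theta> that by auto
  have \<theta>_gen: "\<theta> q (N.gen (k, h') n) = \<phi> (k, h', n) q"
    if "q \<in> carrier IM" "k \<in> carrier K" "h' \<in> carrier H" "n \<in> carrier N" for q k h' n
    using \<theta> that by auto
  have B: "biadditive IN IM Z (\<lambda>p q. \<theta> q p)"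
  proof (rule biadditiveI)
    fix p q q' assume p: "p \<in> carrier IN" and q: "q \<in> carrier IM" "q' \<in> carrier IM"
    show "\<theta> (q \<oplus>\<^bsub>IM\<^esub> q') p = \<theta> q p \<oplus>\<^bsub>Z\<^esub> \<theta> q' p"
      by (rule add_hom_eqI[OF IN_generates \<theta>_hom add_hom_plus[OF ten.P.abelian_group_axioms Z \<theta>_hom \<theta>_hom] _ p])
        (use q in \<open>auto simp: \<theta>_gen add_hom_add[OF \<phi>_hom]\<close>)
  qed (auto simp: add_hom_closed[OF \<theta>_hom] add_hom_add[OF \<theta>_hom])
  have bal: "\<theta> q (p \<odot>r\<^bsub>IN\<^esub> a) = \<theta> (a \<odot>\<^bsub>IM\<^esub> q) p"
    if "p \<in> carrier IN" "a \<in> carrier H.RG" "q \<in> carrier IM" for p a q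
  proof (rule balancedI[OF ten.right ten.left B IN_generates H.ga_generates IM_generates _ that])
    fix p a q assume "p \<in> IN_gens" "a \<in> ga_singles R (carrier H)" "q \<in> IM_gens"
    then obtain k h' n h0 r h g m where *: "p = N.gen (k, h') n" "k \<in> carrier K" "h' \<in> carrier H" "n \<in> carrier N"
      "a = ga_single R h0 r" "h0 \<in> carrier H" "r \<in> carrier R"
      "q = M.gen (h, g) m" "h \<in> carrier H" "g \<in> carrier G" "m \<in> carrier M" by blast
    have c: "N.scal r n \<in> carrier N" "M.scal r m \<in> carrier M"
      using * N.single_closed[OF N.one_X] M.single_closed[OF M.one_X] by auto
    \<comment> \<open>On generators the balancing splits: the group element \<open>h0\<close> is
      absorbed by this identity in \<open>H\<close>, and the scalar \<open>r\<close> by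
      \<open>fR\<close>.\<close>
    have eq: "inv\<^bsub>H\<^esub> (inv\<^bsub>H\<^esub> h0 \<otimes>\<^bsub>H\<^esub> h') \<otimes>\<^bsub>H\<^esub> h = inv\<^bsub>H\<^esub> h' \<otimes>\<^bsub>H\<^esub> (h0 \<otimes>\<^bsub>H\<^esub> h)"
      using * by (simp add: H.G.inv_mult_group H.G.m_assoc)
    show "\<theta> q (p \<odot>r\<^bsub>IN\<^esub> a) = \<theta> (a \<odot>\<^bsub>IM\<^esub> q) p"
      using * c eq by (simp add: IN_right IM_left \<theta>_gen \<phi>_gen IM_gen_closed fR[unfolded one_DirProd])
  qed
  from ten.tensor_universal[OF Z B bal]
  obtain \<Phi> where \<Phi>: "\<Phi> \<in> add_hom ten.T Z"
    "\<And>p q. \<lbrakk>p \<in> carrier IN; q \<in> carrier IM\<rbrakk> \<Longrightarrow> \<Phi> (ten.pure p q) = \<theta> q p" by blast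
  show thesis
  proof (rule that)
    show "\<Phi> \<in> add_hom IT Z"
      using \<Phi>(1) by (simp add: add_hom_cong[OF tensor_bimodule_simps(1,3)])
    show "\<Phi> (ind_pure k h g n m) = f k h g n m"
      if "k \<in> carrier K" "h \<in> carrier H" "g \<in> carrier G" "n \<in> carrier N" "m \<in> carrier M" for k h g n m
      using that \<Phi>(2)[OF IN_gen_closed[of k "\<one>\<^bsub>H\<^esub>" n] IM_gen_closed[of h g m]]
      by (simp add: ind_pure_def \<theta>_gen \<phi>_gen IM_gen_closed)
  qed
qed

end

section \<open>The modules attached to the double cosets\<close>

lemma (in group) conj_by_mult:
  "\<lbrakk>t \<in> carrier G; h \<in> carrier G; h' \<in> carrier G\<rbrakk> \<Longrightarrow>
    conj_by G t (h \<otimes> h') = conj_by G t h \<otimes> conj_by G t h'"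
  by (simp add: conj_by_def m_assoc) (simp add: m_assoc[symmetric])

lemma (in group) conj_by_closed:
  "\<lbrakk>t \<in> carrier G; h \<in> carrier G\<rbrakk> \<Longrightarrow> conj_by G t h \<in> carrier G"
  by (simp add: conj_by_def)

lemma (in group) conj_by_one: "t \<in> carrier G \<Longrightarrow> conj_by G t \<one> = \<one>"
  by (simp add: conj_by_def)

lemma (in group) conj_by_inv:
  "\<lbrakk>t \<in> carrier G; h \<in> carrier G\<rbrakk> \<Longrightarrow> conj_by G t (inv h) = inv (conj_by G t h)"
  by (simp add: conj_by_def inv_mult_group m_assoc)

text \<open>\<open>conj_by\<close> inverts the map whose image is \<open>conj_left\<close>.
  Membership in a conjugate thus becomes a condition on \<open>h^t\<close>, the element through
  which the conjugate module is acted upon.\<close>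

lemma (in group) mem_conj_left_iff:
  assumes "t \<in> carrier G" "U \<subseteq> carrier G"
  shows "h \<in> conj_left G t U \<longleftrightarrow> h \<in> carrier G \<and> conj_by G t h \<in> U"
proof
  assume "h \<in> conj_left G t U"
  then obtain u where u: "h = t \<otimes> u \<otimes> inv t" "u \<in> U" by (auto simp: conj_left_def)
  with assms have "u \<in> carrier G" by auto
  then have "conj_by G t h = u" using assms u by (simp add: conj_by_def m_assoc) (simp add: m_assoc[symmetric])
  with u assms \<open>u \<in> carrier G\<close> show "h \<in> carrier G \<and> conj_by G t h \<in> U" by simp
next
  assume h: "h \<in> carrier G \<and> conj_by G t h \<in> U"
  then have "h = t \<otimes> conj_by G t h \<otimes> inv t"
    using assms by (simp add: conj_by_def m_assoc) (simp add: m_assoc[symmetric])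
  with h show "h \<in> conj_left G t U" unfolding conj_left_def by blast
qed

context induced_pair
begin

lemma Y_mult: "\<lbrakk>(k, h) \<in> Y; (k', h') \<in> Y\<rbrakk> \<Longrightarrow> (k \<otimes>\<^bsub>K\<^esub> k', h \<otimes>\<^bsub>H\<^esub> h') \<in> Y"
  using subgroup.m_closed[OF N.subgroup_X] by fastforce

lemma X_mult: "\<lbrakk>(h, g) \<in> X; (h', g') \<in> X\<rbrakk> \<Longrightarrow> (h \<otimes>\<^bsub>H\<^esub> h', g \<otimes>\<^bsub>G\<^esub> g') \<in> X"
  using subgroup.m_closed[OF M.subgroup_X] by fastforce

lemma Y_one: "(\<one>\<^bsub>K\<^esub>, \<one>\<^bsub>H\<^esub>) \<in> Y"
  using N.one_X by simp

lemma X_one: "(\<one>\<^bsub>H\<^esub>, \<one>\<^bsub>G\<^esub>) \<in> X"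
  using M.one_X by simp

lemma Y_inv: "(k, h) \<in> Y \<Longrightarrow> (inv\<^bsub>K\<^esub> k, inv\<^bsub>H\<^esub> h) \<in> Y"
  using subgroup.m_inv_closed[OF N.subgroup_X, of "(k, h)"] Y_closed[of k h]
  by (simp add: inv_DirProd K.G.group_axioms H.G.group_axioms)

lemma X_inv: "(h, g) \<in> X \<Longrightarrow> (inv\<^bsub>H\<^esub> h, inv\<^bsub>G\<^esub> g) \<in> X"
  using subgroup.m_inv_closed[OF M.subgroup_X, of "(h, g)"] X_closed[of h g]
  by (simp add: inv_DirProd H.G.group_axioms G.G.group_axioms)

section \<open>Subgroups attached to a fixed element \<open>t\<close>\<close>

context
  fixes t assumes t: "t \<in> carrier H"
begin

abbreviation "S \<equiv> mid_group K H G Y t X"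
abbreviation "RS \<equiv> subgroup_algebra R H S"
abbreviation "link k g \<equiv> SOME h. h \<in> carrier H \<and> (k, h) \<in> Y \<and> (conj_by H t h, g) \<in> X"
abbreviation "XC \<equiv> conj_left (H \<times>\<times> G) (t, \<one>\<^bsub>G\<^esub>) X"
abbreviation "St \<equiv> star_conj K H G Y t X"
abbreviation "cj \<equiv> conj_by H t"

lemma conj_by_DirProd:
  "\<lbrakk>h \<in> carrier H; g \<in> carrier G\<rbrakk> \<Longrightarrow> conj_by (H \<times>\<times> G) (t, \<one>\<^bsub>G\<^esub>) (h, g) = (cj h, g)"
  using t inv_DirProd[OF H.G.group_axioms G.G.group_axioms t G.G.one_closed]
  by (simp add: conj_by_def)

lemma mem_XC: "(h, g) \<in> XC \<longleftrightarrow> h \<in> carrier H \<and> g \<in> carrier G \<and> (cj h, g) \<in> X"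
  using group.mem_conj_left_iff[OF DirProd_group[OF H.G.group_axioms G.G.group_axioms], of "(t, \<one>\<^bsub>G\<^esub>)" X "(h, g)"]
    t subgroup.subset[OF M.subgroup_X] conj_by_DirProd[of h g] by auto

text \<open>Thus \<open>S\<close> consists of the elements linking the identity of \<open>K\<close>
  with the identity of \<open>G\<close>. Two linking elements of the same pair differ by such an
  element, which explains the choice of the middle group.\<close>

lemma mem_S: "h \<in> S \<longleftrightarrow> h \<in> carrier H \<and> (\<one>\<^bsub>K\<^esub>, h) \<in> Y \<and> (cj h, \<one>\<^bsub>G\<^esub>) \<in> X"
  using H.G.mem_conj_left_iff[OF t, of "ker1 H G X" h] H.G.conj_by_closed[OF t]
  by (auto simp: mid_group_def ker1_def ker2_def)

lemma mem_St: "(k, g) \<in> St \<longleftrightarrow> (\<exists>h. (k, h) \<in> Y \<and> (cj h, g) \<in> X)"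
  using Y_closed X_closed by (auto simp: star_conj_def)

lemma S_subgroup: "subgroup S H"
proof (rule H.G.subgroupI)
  show "S \<subseteq> carrier H" by (auto simp: mem_S)
  show "S \<noteq> {}" using Y_one X_one t by (auto simp: set_eq_iff mem_S H.G.conj_by_one intro!: exI[of _ "\<one>\<^bsub>H\<^esub>"])
  show "inv\<^bsub>H\<^esub> a \<in> S" if "a \<in> S" for a
    using that Y_inv[of "\<one>\<^bsub>K\<^esub>" a] X_inv[of "cj a" "\<one>\<^bsub>G\<^esub>"] t by (simp add: mem_S H.G.conj_by_inv)
  show "a \<otimes>\<^bsub>H\<^esub> b \<in> S" if "a \<in> S" "b \<in> S" for a b
    using that Y_mult[of "\<one>\<^bsub>K\<^esub>" a "\<one>\<^bsub>K\<^esub>" b] X_mult[of "cj a" "\<one>\<^bsub>G\<^esub>" "cj b" "\<one>\<^bsub>G\<^esub>"] t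
    by (simp add: mem_S H.G.conj_by_mult)
qed

lemma XC_subgroup: "subgroup XC (H \<times>\<times> G)"
proof (rule group.subgroupI[OF DirProd_group[OF H.G.group_axioms G.G.group_axioms]])
  show "XC \<subseteq> carrier (H \<times>\<times> G)" by (auto simp: mem_XC)
  have "(\<one>\<^bsub>H\<^esub>, \<one>\<^bsub>G\<^esub>) \<in> XC" using X_one t by (simp add: mem_XC H.G.conj_by_one)
  then show "XC \<noteq> {}" by blast
  show "inv\<^bsub>H \<times>\<times> G\<^esub> a \<in> XC" if "a \<in> XC" for a
    using that t X_inv[of "cj (fst a)" "snd a"]
    by (cases a) (simp add: mem_XC inv_DirProd H.G.group_axioms G.G.group_axioms H.G.conj_by_inv)
  show "a \<otimes>\<^bsub>H \<times>\<times> G\<^esub> b \<in> XC" if "a \<in> XC" "b \<in> XC" for a b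
    using that t X_mult[of "cj (fst a)" "snd a" "cj (fst b)" "snd b"]
    by (cases a; cases b) (simp add: mem_XC H.G.conj_by_mult)
qed

text \<open>Linking elements can be multiplied and inverted together with the pairs that they link,
  because \<open>h \<mapsto> h^t\<close> is a homomorphism.\<close>

lemma St_subgroup: "subgroup St (K \<times>\<times> G)"
proof (rule group.subgroupI[OF DirProd_group[OF K.G.group_axioms G.G.group_axioms]])
  show "St \<subseteq> carrier (K \<times>\<times> G)" by (auto simp: star_conj_def)
  have "(\<one>\<^bsub>K\<^esub>, \<one>\<^bsub>G\<^esub>) \<in> St"
    unfolding mem_St using Y_one X_one t by (intro exI[of _ "\<one>\<^bsub>H\<^esub>"]) (simp add: H.G.conj_by_one)
  then show "St \<noteq> {}" by blast
  show "inv\<^bsub>K \<times>\<times> G\<^esub> a \<in> St" if "a \<in> St" for a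
  proof -
    obtain k g where a: "a = (k, g)" by (cases a)
    with that obtain h where h: "(k, h) \<in> Y" "(cj h, g) \<in> X" by (auto simp: mem_St)
    then have "(inv\<^bsub>K\<^esub> k, inv\<^bsub>H\<^esub> h) \<in> Y" "(cj (inv\<^bsub>H\<^esub> h), inv\<^bsub>G\<^esub> g) \<in> X"
      using t Y_closed[OF h(1)] by (auto simp: H.G.conj_by_inv intro: Y_inv X_inv)
    then show ?thesis
      using a Y_closed[OF h(1)] X_closed[OF h(2)]
      by (auto simp: inv_DirProd K.G.group_axioms G.G.group_axioms mem_St)
  qed
  show "a \<otimes>\<^bsub>K \<times>\<times> G\<^esub> b \<in> St" if "a \<in> St" "b \<in> St" for a b
  proof -
    obtain k g k' g' where a: "a = (k, g)" "b = (k', g')" by (cases a; cases b)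
    with that obtain h h' where h: "(k, h) \<in> Y" "(cj h, g) \<in> X" "(k', h') \<in> Y" "(cj h', g') \<in> X"
      by (auto simp: mem_St)
    then have "(k \<otimes>\<^bsub>K\<^esub> k', h \<otimes>\<^bsub>H\<^esub> h') \<in> Y" "(cj (h \<otimes>\<^bsub>H\<^esub> h'), g \<otimes>\<^bsub>G\<^esub> g') \<in> X"
      using t Y_closed[OF h(1)] Y_closed[OF h(3)] by (auto simp: H.G.conj_by_mult intro: Y_mult X_mult)
    then show ?thesis using a by (auto simp: mem_St)
  qed
qed

lemma S_algebra: "finite_group_algebra R (H\<lparr>carrier := S\<rparr>)"
  by (rule finite_group_algebra_subgroup[OF H.finite_group_algebra_axioms S_subgroup])

lemma S_generates: "add_generates RS (ga_singles R S)"
  using finite_group_algebra.ga_generates[OF S_algebra] by (simp add: subgroup_algebra_def)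

lemma XC_algebra: "finite_group_algebra R ((H \<times>\<times> G)\<lparr>carrier := XC\<rparr>)"
  by (rule finite_group_algebra_subgroup[OF M.finite_group_algebra_axioms XC_subgroup])

lemma St_algebra: "finite_group_algebra R ((K \<times>\<times> G)\<lparr>carrier := St\<rparr>)"
  by (rule finite_group_algebra_subgroup[OF finite_group_algebra_DirProd[OF K.finite_group_algebra_axioms
        G.finite_group_algebra_axioms] St_subgroup])

section \<open>Conjugate and restricted modules\<close>

abbreviation "CM \<equiv> conj_module R H G X t M"
abbreviation "LM \<equiv> left_restriction R G S CM"
abbreviation "RN \<equiv> right_restriction R K H S N"

lemma CM_module: "left_module (subgroup_algebra R (H \<times>\<times> G) XC) CM"
  and CM_single: "\<lbrakk>(h, g) \<in> XC; r \<in> carrier R\<rbrakk> \<Longrightarrow>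
    ga_single R (h, g) r \<odot>\<^bsub>CM\<^esub> m = ga_single R (cj h, g) r \<odot>\<^bsub>M\<^esub> m"
proof -
  have hom: "(\<lambda>(h, g). (cj h, g)) \<in> hom ((H \<times>\<times> G)\<lparr>carrier := XC\<rparr>) ((H \<times>\<times> G)\<lparr>carrier := X\<rparr>)"
    using t by (auto simp: hom_def mem_XC H.G.conj_by_mult)
  have one: "(\<lambda>(h, g). (cj h, g)) \<one>\<^bsub>(H \<times>\<times> G)\<lparr>carrier := XC\<rparr>\<^esub> = \<one>\<^bsub>(H \<times>\<times> G)\<lparr>carrier := X\<rparr>\<^esub>"
    using t by (simp add: H.G.conj_by_one)
  have CM: "carrier CM = carrier M" "\<zero>\<^bsub>CM\<^esub> = \<zero>\<^bsub>M\<^esub>" "add CM = add M"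
    "\<And>f m. f \<odot>\<^bsub>CM\<^esub> m = ga_extend R (carrier ((H \<times>\<times> G)\<lparr>carrier := XC\<rparr>)) (\<lambda>(h, g). (cj h, g)) f \<odot>\<^bsub>M\<^esub> m"
    by (simp_all add: conj_module_def)
  note * = left_module_pullback[OF XC_algebra hom one M.module_M[unfolded subgroup_algebra_def] CM M.X_algebra]
  show "left_module (subgroup_algebra R (H \<times>\<times> G) XC) CM"
    unfolding subgroup_algebra_def by (rule *(1))
  show "ga_single R (h, g) r \<odot>\<^bsub>CM\<^esub> m = ga_single R (cj h, g) r \<odot>\<^bsub>M\<^esub> m"
    if "(h, g) \<in> XC" "r \<in> carrier R"
    using *(2)[of "(h, g)" r m] that by simp
qed

lemma LM_module: "left_module RS LM"
  and LM_single: "\<lbrakk>h \<in> S; r \<in> carrier R\<rbrakk> \<Longrightarrow>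
    ga_single R h r \<odot>\<^bsub>LM\<^esub> m = ga_single R (cj h, \<one>\<^bsub>G\<^esub>) r \<odot>\<^bsub>M\<^esub> m"
proof -
  have hom: "(\<lambda>h. (h, \<one>\<^bsub>G\<^esub>)) \<in> hom (H\<lparr>carrier := S\<rparr>) ((H \<times>\<times> G)\<lparr>carrier := XC\<rparr>)"
    by (auto simp: hom_def mem_S mem_XC)
  have one: "(\<one>\<^bsub>H\<lparr>carrier := S\<rparr>\<^esub>, \<one>\<^bsub>G\<^esub>) = \<one>\<^bsub>(H \<times>\<times> G)\<lparr>carrier := XC\<rparr>\<^esub>"
    by simp
  have LM: "carrier LM = carrier CM" "\<zero>\<^bsub>LM\<^esub> = \<zero>\<^bsub>CM\<^esub>" "add LM = add CM"
    "\<And>f m. f \<odot>\<^bsub>LM\<^esub> m = ga_extend R (carrier (H\<lparr>carrier := S\<rparr>)) (\<lambda>h. (h, \<one>\<^bsub>G\<^esub>)) f \<odot>\<^bsub>CM\<^esub> m"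
    by (simp_all add: left_restriction_def)
  note * = left_module_pullback[OF S_algebra hom one CM_module[unfolded subgroup_algebra_def] LM XC_algebra]
  show "left_module RS LM"
    unfolding subgroup_algebra_def by (rule *(1))
  show "ga_single R h r \<odot>\<^bsub>LM\<^esub> m = ga_single R (cj h, \<one>\<^bsub>G\<^esub>) r \<odot>\<^bsub>M\<^esub> m"
    if "h \<in> S" "r \<in> carrier R"
    using *(2)[of h r m] that by (simp add: CM_single mem_XC mem_S)
qed

lemma RN_module: "right_module RS RN"
  and RN_single: "\<lbrakk>h \<in> S; r \<in> carrier R\<rbrakk> \<Longrightarrow>
    n \<odot>r\<^bsub>RN\<^esub> ga_single R h r = ga_single R (\<one>\<^bsub>K\<^esub>, inv\<^bsub>H\<^esub> h) r \<odot>\<^bsub>N\<^esub> n"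
proof -
  have anti: "(\<lambda>h. (\<one>\<^bsub>K\<^esub>, inv\<^bsub>H\<^esub> h)) \<in> carrier (H\<lparr>carrier := S\<rparr>) \<rightarrow> carrier ((K \<times>\<times> H)\<lparr>carrier := Y\<rparr>)"
    "(\<one>\<^bsub>K\<^esub>, inv\<^bsub>H\<^esub> \<one>\<^bsub>H\<lparr>carrier := S\<rparr>\<^esub>) = \<one>\<^bsub>(K \<times>\<times> H)\<lparr>carrier := Y\<rparr>\<^esub>"
    "\<And>x y. \<lbrakk>x \<in> carrier (H\<lparr>carrier := S\<rparr>); y \<in> carrier (H\<lparr>carrier := S\<rparr>)\<rbrakk> \<Longrightarrow>
      (\<one>\<^bsub>K\<^esub>, inv\<^bsub>H\<^esub> (x \<otimes>\<^bsub>H\<lparr>carrier := S\<rparr>\<^esub> y)) =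
      (\<one>\<^bsub>K\<^esub>, inv\<^bsub>H\<^esub> y) \<otimes>\<^bsub>(K \<times>\<times> H)\<lparr>carrier := Y\<rparr>\<^esub> (\<one>\<^bsub>K\<^esub>, inv\<^bsub>H\<^esub> x)"
    using Y_inv[of "\<one>\<^bsub>K\<^esub>"] by (auto simp: mem_S H.G.inv_mult_group)
  have RN: "carrier RN = carrier N" "\<zero>\<^bsub>RN\<^esub> = \<zero>\<^bsub>N\<^esub>" "add RN = add N"
    "\<And>f n. n \<odot>r\<^bsub>RN\<^esub> f = ga_extend R (carrier (H\<lparr>carrier := S\<rparr>)) (\<lambda>h. (\<one>\<^bsub>K\<^esub>, inv\<^bsub>H\<^esub> h)) f \<odot>\<^bsub>N\<^esub> n"
    by (simp_all add: right_restriction_def)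
  note * = right_module_pullback[OF S_algebra anti N.module_M[unfolded subgroup_algebra_def] RN N.X_algebra]
  show "right_module RS RN"
    unfolding subgroup_algebra_def by (rule *(1))
  show "n \<odot>r\<^bsub>RN\<^esub> ga_single R h r = ga_single R (\<one>\<^bsub>K\<^esub>, inv\<^bsub>H\<^esub> h) r \<odot>\<^bsub>N\<^esub> n"
    if "h \<in> S" "r \<in> carrier R"
    using *(2)[of h r n] that by simp
qed

lemma RN_simps:
  "carrier RN = carrier N" "add RN = add N" "\<zero>\<^bsub>RN\<^esub> = \<zero>\<^bsub>N\<^esub>"
  "r \<odot>\<^bsub>RN\<^esub> n = N.scal r n"
  by (simp_all add: right_restriction_def)

lemma LM_simps:
  "carrier LM = carrier M" "add LM = add M" "\<zero>\<^bsub>LM\<^esub> = \<zero>\<^bsub>M\<^esub>"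
  by (simp_all add: left_restriction_def conj_module_def)

lemma RN_left_module: "left_module R RN"
proof (rule left_moduleI)
  show "ring R" by (rule K.R.ring_axioms)
  show "abelian_group RN"
    by (rule abelian_group_cong[OF N.M.abelian_group_axioms]) (simp_all add: RN_simps)
  show "biadditive R RN RN (\<odot>\<^bsub>RN\<^esub>)"
    using biadditive_comp[OF left_module_biadditive[OF N.module_M] N.RX_single_hom[OF N.one_X] add_hom_ident]
    by (simp add: add_hom_cong[OF RN_simps(1,2)] RN_simps(4)[abs_def])
qed (simp_all add: RN_simps N.scal_one[unfolded one_DirProd] N.single_act Y_one)

text \<open>Scalars act through \<open>r (1, 1)\<close>, which commutes with every
  \<open>(1, s^-1)\<close>. This is what equips the middle tensor product with its
  \<open>R\<close>-module structure.\<close>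

lemma RN_comm:
  assumes "c \<in> carrier R" "n \<in> carrier RN" "a \<in> carrier RS"
  shows "(c \<odot>\<^bsub>RN\<^esub> n) \<odot>r\<^bsub>RN\<^esub> a = c \<odot>\<^bsub>RN\<^esub> (n \<odot>r\<^bsub>RN\<^esub> a)"
proof (rule add_hom_eqI[OF S_generates _ _ _ assms(3)])
  note biR = right_module_biadditive[OF RN_module]
  note biL = left_module_biadditive[OF RN_left_module]
  show "(\<lambda>a. (c \<odot>\<^bsub>RN\<^esub> n) \<odot>r\<^bsub>RN\<^esub> a) \<in> add_hom RS RN"
    using assms by (intro biadditive_homs(1)[OF biR] biadditiveD(1)[OF biL])
  show "(\<lambda>a. c \<odot>\<^bsub>RN\<^esub> (n \<odot>r\<^bsub>RN\<^esub> a)) \<in> add_hom RS RN"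
    using add_hom_comp[OF biadditive_homs(1)[OF biR assms(2)] biadditive_homs(1)[OF biL assms(1)]] .
  fix s assume "s \<in> ga_singles R S"
  then obtain x r where s: "s = ga_single R x r" "x \<in> S" "r \<in> carrier R" by blast
  then show "(c \<odot>\<^bsub>RN\<^esub> n) \<odot>r\<^bsub>RN\<^esub> s = c \<odot>\<^bsub>RN\<^esub> (n \<odot>r\<^bsub>RN\<^esub> s)"
    using assms Y_inv[of "\<one>\<^bsub>K\<^esub>" x]
    by (simp add: RN_single RN_simps N.single_act Y_one mem_S K.R.m_comm)
qed


section \<open>The middle tensor product and its action\<close>

interpretation mid: tensor_pair "RS" RN LM
  by (intro tensor_pair.intro RN_module LM_module)

abbreviation "W \<equiv> mid_tensor R K H G Y t X N M"
abbreviation "pure \<equiv> mid_pure_tensor R K H G Y t X N M"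
abbreviation "MM \<equiv> mid_module R K H G Y t X N M"
abbreviation "mact \<equiv> mid_act R K H G Y t X N M"

lemma W_eq: "W = mid.T"
  by (simp add: mid_tensor_def Let_def)

lemma pure_eq: "pure = mid.pure"
  by (simp add: mid_pure_tensor_def Let_def fun_eq_iff)

lemma W_left_module: "left_module R W"
  and W_scal: "\<lbrakk>r \<in> carrier R; n \<in> carrier N; m \<in> carrier M\<rbrakk> \<Longrightarrow> r \<odot>\<^bsub>W\<^esub> pure n m = pure (N.scal r n) m"
proof -
  have *: "left_module R mid.T"
    "\<And>c p q. \<lbrakk>c \<in> carrier R; p \<in> carrier RN; q \<in> carrier LM\<rbrakk> \<Longrightarrow> c \<odot>\<^bsub>mid.T\<^esub> mid.pure p q = mid.pure (c \<odot>\<^bsub>RN\<^esub> p) q"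
    using RN_comm by (intro mid.tensor_left_module[OF RN_left_module]; blast)+
  show "left_module R W" using *(1) by (simp add: W_eq)
  show "r \<odot>\<^bsub>W\<^esub> pure n m = pure (N.scal r n) m" if "r \<in> carrier R" "n \<in> carrier N" "m \<in> carrier M"
    using *(2) that by (simp add: W_eq pure_eq RN_simps LM_simps)
qed

lemma pure_biadditive: "biadditive N M W pure"
  using mid.pure_biadditive
  by (simp add: W_eq pure_eq add_hom_cong(4)[OF RN_simps(1,2)] add_hom_cong(5)[OF LM_simps(1,2)])

lemma W_generates: "add_generates W {pure n m | n m. n \<in> carrier N \<and> m \<in> carrier M}"
  using mid.pure_generates_carrier by (simp add: W_eq pure_eq RN_simps LM_simps)

lemma pure_balanced:
  assumes "s \<in> S" "r \<in> carrier R" "n \<in> carrier N" "m \<in> carrier M"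
  shows "pure (ga_single R (\<one>\<^bsub>K\<^esub>, inv\<^bsub>H\<^esub> s) r \<odot>\<^bsub>N\<^esub> n) m = pure n (ga_single R (cj s, \<one>\<^bsub>G\<^esub>) r \<odot>\<^bsub>M\<^esub> m)"
proof -
  have "ga_single R s r \<in> carrier RS"
    using finite_group_algebra.ga_single_closed[OF S_algebra] assms by (simp add: subgroup_algebra_def)
  then show ?thesis
    using mid.pure_balanced[of n "ga_single R s r" m] assms
    by (simp add: pure_eq RN_single LM_single RN_simps LM_simps)
qed

text \<open>Balancing at the identity of the middle group: the \<open>R\<close>-structure may be
  read on either factor.\<close>

lemma pure_scal:
  assumes "r \<in> carrier R" "n \<in> carrier N" "m \<in> carrier M"
  shows "pure (N.scal r n) m = pure n (M.scal r m)"
  using pure_balanced[of "\<one>\<^bsub>H\<^esub>" r n m] assms subgroup.one_closed[OF S_subgroup] t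
  by (simp add: H.G.conj_by_one)

text \<open>The middle group acts trivially when it acts on both factors at once: moved across the
  tensor sign, \<open>(s^t, 1)\<close> becomes \<open>(1, s^-1)\<close>, which cancels
  \<open>(1, s)\<close>. Independence of the linking element rests on this.\<close>

lemma pure_act_S:
  assumes "s \<in> S" "n \<in> carrier N" "m \<in> carrier M"
  shows "pure (N.act (\<one>\<^bsub>K\<^esub>, s) n) (M.act (cj s, \<one>\<^bsub>G\<^esub>) m) = pure n m"
proof -
  have s: "s \<in> carrier H" "(\<one>\<^bsub>K\<^esub>, s) \<in> Y" "(cj s, \<one>\<^bsub>G\<^esub>) \<in> X" using assms by (auto simp: mem_S)
  have s': "(\<one>\<^bsub>K\<^esub>, inv\<^bsub>H\<^esub> s) \<in> Y" using Y_inv[OF s(2)] by simp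
  have "pure (N.act (\<one>\<^bsub>K\<^esub>, s) n) (M.act (cj s, \<one>\<^bsub>G\<^esub>) m) =
      pure (N.act (\<one>\<^bsub>K\<^esub>, inv\<^bsub>H\<^esub> s) (N.act (\<one>\<^bsub>K\<^esub>, s) n)) m"
    using pure_balanced[OF assms(1) K.R.one_closed N.act_closed[OF s(2) assms(2)] assms(3)]
    by (simp add: group_act_def)
  also have "N.act (\<one>\<^bsub>K\<^esub>, inv\<^bsub>H\<^esub> s) (N.act (\<one>\<^bsub>K\<^esub>, s) n) = n"
    using assms s s' N.act_one by (simp add: N.act_act)
  finally show ?thesis .
qed

text \<open>The operators of \<open>(k, h)\<close> and \<open>(h^t, g)\<close> normalise the middle
  group instead of commuting with it. Both conjugate \<open>s\<close> to the same element
  \<open>s'\<close>, so balancing at \<open>s\<close> before the operators becomes balancing at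
  \<open>s'\<close> after them.\<close>

lemma mact:
  assumes kh: "(k, h) \<in> Y" and hg: "(cj h, g) \<in> X"
  shows mact_hom: "mact k h g \<in> add_hom W W"
    and mact_pure: "\<lbrakk>n \<in> carrier N; m \<in> carrier M\<rbrakk> \<Longrightarrow>
      mact k h g (pure n m) = pure (N.act (k, h) n) (M.act (cj h, g) m)"
proof -
  note c = Y_closed[OF kh] X_closed[OF hg]
  have homs: "N.act (k, h) \<in> add_hom RN RN" "M.act (cj h, g) \<in> add_hom LM LM"
    using N.act_hom[OF kh] M.act_hom[OF hg]
    by (simp_all add: add_hom_cong[OF RN_simps(1,2)] add_hom_cong[OF LM_simps(1,2)])
  have bal: "mid.pure (N.act (k, h) (p \<odot>r\<^bsub>RN\<^esub> a)) (M.act (cj h, g) q) =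
      mid.pure (N.act (k, h) p) (M.act (cj h, g) (a \<odot>\<^bsub>LM\<^esub> q))"
    if "p \<in> carrier RN" "a \<in> carrier RS" "q \<in> carrier LM" for p a q
  proof (rule balancedI[OF RN_module LM_module biadditive_comp[OF mid.pure_biadditive homs]
        add_generates_carrier S_generates add_generates_carrier _ that])
    fix p a q assume p: "p \<in> carrier RN" and q: "q \<in> carrier LM"
      and "a \<in> ga_singles R S"
    then obtain s r where a: "a = ga_single R s r" "s \<in> S" "r \<in> carrier R" by blast
    then have s: "s \<in> carrier H" "(\<one>\<^bsub>K\<^esub>, s) \<in> Y" "(cj s, \<one>\<^bsub>G\<^esub>) \<in> X" by (auto simp: mem_S)
    have si: "(\<one>\<^bsub>K\<^esub>, inv\<^bsub>H\<^esub> s) \<in> Y" using Y_inv[OF s(2)] by simp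
    \<comment> \<open>\<open>(1, s')\<close> is the conjugate of \<open>(1, s)\<close> by
      \<open>(k, h)\<close>, and \<open>(s'^t, 1)\<close> is that of \<open>(s^t, 1)\<close> by
      \<open>(h^t, g)\<close>; the components in \<open>K\<close> and \<open>G\<close> cancel, so
      \<open>s'\<close> lies in \<open>S\<close>.\<close>
    define s' where "s' = h \<otimes>\<^bsub>H\<^esub> s \<otimes>\<^bsub>H\<^esub> inv\<^bsub>H\<^esub> h"
    have s'c: "s' \<in> carrier H" using s c by (simp add: s'_def)
    have s'Y: "(\<one>\<^bsub>K\<^esub>, s') \<in> Y"
      using Y_mult[OF Y_mult[OF kh s(2)] Y_inv[OF kh]] c by (simp add: s'_def)
    have cjs': "cj s' = cj h \<otimes>\<^bsub>H\<^esub> cj s \<otimes>\<^bsub>H\<^esub> inv\<^bsub>H\<^esub> (cj h)"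
      using s c t by (simp add: s'_def H.G.conj_by_mult H.G.conj_by_inv)
    have s'X: "(cj s', \<one>\<^bsub>G\<^esub>) \<in> X"
      using X_mult[OF X_mult[OF hg s(3)] X_inv[OF hg]] c by (simp add: cjs')
    have s'S: "s' \<in> S" using s'c s'Y s'X by (simp add: mem_S)
    have s'i: "(\<one>\<^bsub>K\<^esub>, inv\<^bsub>H\<^esub> s') \<in> Y" using Y_inv[OF s'Y] by simp
    have eq1: "h \<otimes>\<^bsub>H\<^esub> inv\<^bsub>H\<^esub> s = inv\<^bsub>H\<^esub> s' \<otimes>\<^bsub>H\<^esub> h"
      using s c by (simp add: s'_def H.G.inv_mult_group H.G.m_assoc)
    have eq2: "cj s' \<otimes>\<^bsub>H\<^esub> cj h = cj h \<otimes>\<^bsub>H\<^esub> cj s"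
      using c X_closed[OF s(3)] by (simp add: cjs' H.G.m_assoc)
    have "N.act (k, h) (p \<odot>r\<^bsub>RN\<^esub> a) = ga_single R (\<one>\<^bsub>K\<^esub>, inv\<^bsub>H\<^esub> s') r \<odot>\<^bsub>N\<^esub> N.act (k, h) p"
      using a p kh si s'i c by (simp add: RN_single RN_simps group_act_def N.single_act eq1)
    moreover have "M.act (cj h, g) (a \<odot>\<^bsub>LM\<^esub> q) = ga_single R (cj s', \<one>\<^bsub>G\<^esub>) r \<odot>\<^bsub>M\<^esub> M.act (cj h, g) q"
      using a q hg s s'X c by (simp add: LM_single LM_simps group_act_def M.single_act eq2)
    ultimately show "mid.pure (N.act (k, h) (p \<odot>r\<^bsub>RN\<^esub> a)) (M.act (cj h, g) q) =
        mid.pure (N.act (k, h) p) (M.act (cj h, g) (a \<odot>\<^bsub>LM\<^esub> q))"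
      using pure_balanced[OF s'S a(3) N.act_closed[OF kh] M.act_closed[OF hg], of p q] p q
      by (simp add: pure_eq RN_simps LM_simps)
  qed
  have map_eq: "mact k h g = tensor_map RS RN LM (N.act (k, h)) (M.act (cj h, g))"
    by (simp add: mid_act_def Let_def fun_eq_iff)
  have "tensor_map RS RN LM (N.act (k, h)) (M.act (cj h, g)) \<in> add_hom mid.T mid.T"
    by (rule mid.tensor_map(1)[OF homs]) (rule bal)
  then show "mact k h g \<in> add_hom W W" by (simp add: W_eq map_eq)
  show "mact k h g (pure n m) = pure (N.act (k, h) n) (M.act (cj h, g) m)"
    if "n \<in> carrier N" "m \<in> carrier M"
  proof -
    have "tensor_map RS RN LM (N.act (k, h)) (M.act (cj h, g)) (mid.pure n m) =
        mid.pure (N.act (k, h) n) (M.act (cj h, g) m)"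
      by (rule mid.tensor_map(2)[OF homs]) (rule bal, use that in \<open>simp_all add: RN_simps LM_simps\<close>)
    then show ?thesis by (simp add: map_eq pure_eq)
  qed
qed

lemma mact_indep:
  assumes h: "(k, h) \<in> Y" "(cj h, g) \<in> X" and h': "(k, h') \<in> Y" "(cj h', g) \<in> X" and w: "w \<in> carrier W"
  shows "mact k h g w = mact k h' g w"
proof (rule add_hom_eqI[OF W_generates mact_hom[OF h] mact_hom[OF h'] _ w])
  note c = Y_closed[OF h(1)] X_closed[OF h(2)] Y_closed[OF h'(1)] X_closed[OF h'(2)]
  \<comment> \<open>The quotient of the two linking elements links the two identities, hence lies in
    \<open>S\<close> and is removed by \<open>pure_act_S\<close>.\<close>
  define s where "s = h' \<otimes>\<^bsub>H\<^esub> inv\<^bsub>H\<^esub> h"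
  have cjs: "cj s = cj h' \<otimes>\<^bsub>H\<^esub> inv\<^bsub>H\<^esub> (cj h)"
    using c t by (simp add: s_def H.G.conj_by_mult H.G.conj_by_inv)
  have s: "s \<in> carrier H" "(\<one>\<^bsub>K\<^esub>, s) \<in> Y" "(cj s, \<one>\<^bsub>G\<^esub>) \<in> X"
    using c Y_mult[OF h'(1) Y_inv[OF h(1)]] X_mult[OF h'(2) X_inv[OF h(2)]] by (simp_all add: s_def cjs[unfolded s_def])
  then have S: "s \<in> S" by (simp add: mem_S)
  have eq: "s \<otimes>\<^bsub>H\<^esub> h = h'" "cj s \<otimes>\<^bsub>H\<^esub> cj h = cj h'"
    using c by (simp_all add: cjs) (simp_all add: s_def H.G.m_assoc)
  fix w assume "w \<in> {pure n m | n m. n \<in> carrier N \<and> m \<in> carrier M}"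
  then obtain n m where nm: "w = pure n m" "n \<in> carrier N" "m \<in> carrier M" by blast
  have "pure (N.act (k, h') n) (M.act (cj h', g) m) =
      pure (N.act (\<one>\<^bsub>K\<^esub>, s) (N.act (k, h) n)) (M.act (cj s, \<one>\<^bsub>G\<^esub>) (M.act (cj h, g) m))"
    using nm c h s by (simp add: N.act_act M.act_act eq)
  also have "\<dots> = pure (N.act (k, h) n) (M.act (cj h, g) m)"
    using nm h by (intro pure_act_S S N.act_closed M.act_closed)
  finally show "mact k h g w = mact k h' g w"
    using nm by (simp add: mact_pure h h')
qed

lemma MM_simps:
  "carrier MM = carrier W" "add MM = add W" "\<zero>\<^bsub>MM\<^esub> = \<zero>\<^bsub>W\<^esub>"
  "f \<odot>\<^bsub>MM\<^esub> w = finsum W (\<lambda>(k, g). f (k, g) \<odot>\<^bsub>W\<^esub>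
       mact k (link k g) g w) St"
  by (simp_all add: mid_module_def Let_def)

lemma W_abelian_group: "abelian_group W"
  using W_left_module by (simp add: left_module_def)

lemma MM_some:
  assumes "(k, g) \<in> St"
  shows "(k, link k g) \<in> Y"
    "(cj (link k g), g) \<in> X"
proof -
  have "\<exists>h. h \<in> carrier H \<and> (k, h) \<in> Y \<and> (cj h, g) \<in> X" using assms by (auto simp: mem_St dest: Y_closed(2))
  from someI_ex[OF this]
  show "(k, link k g) \<in> Y"
    "(cj (link k g), g) \<in> X" by auto
qed

text \<open>Only the summand at \<open>(k, g)\<close> survives, and \<open>mact_indep\<close>
  replaces the element selected by \<open>SOME\<close> by any given linking element. Later
  computations with group elements use this form.\<close>

lemma MM_single:
  assumes h: "(k, h) \<in> Y" "(cj h, g) \<in> X" and r: "r \<in> carrier R" and w: "w \<in> carrier W"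
  shows "ga_single R (k, g) r \<odot>\<^bsub>MM\<^esub> w = r \<odot>\<^bsub>W\<^esub> mact k h g w"
proof -
  interpret W: left_module R W by (rule W_left_module)
  define F where "F x = (case x of (k, g) \<Rightarrow>
      mact k (link k g) g w)" for x
  have F: "F x \<in> carrier W" if "x \<in> St" for x
    using that w by (cases x) (simp add: F_def add_hom_closed[OF mact_hom[OF MM_some]])
  have smult: "f \<odot>\<^bsub>MM\<^esub> w = (\<Oplus>\<^bsub>W\<^esub>x\<in>St. f x \<odot>\<^bsub>W\<^esub> F x)" for f
    unfolding MM_simps F_def by (rule arg_cong[where f = "\<lambda>F. finsum W F St"]) (auto simp: fun_eq_iff)
  have zero: "\<zero>\<^bsub>R\<^esub> \<odot>\<^bsub>W\<^esub> v = \<zero>\<^bsub>W\<^esub>" if "v \<in> carrier W" for v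
    using add_hom_zero[OF biadditive_homs(2)[OF left_module_biadditive[OF W_left_module] that] K.R.is_abelian_group W_abelian_group] .
  have kg: "(k, g) \<in> St" using h by (auto simp: mem_St)
  have "ga_single R (k, g) r \<odot>\<^bsub>MM\<^esub> w = (\<Oplus>\<^bsub>W\<^esub>x\<in>St. if (k, g) = x then r \<odot>\<^bsub>W\<^esub> F x else \<zero>\<^bsub>W\<^esub>)"
    unfolding smult using r F
    by (intro abelian_monoid.finsum_cong'[OF abelian_group.axioms(1)[OF W_abelian_group]])
      (simp_all add: ga_single_def zero W.smult_closed Pi_iff)
  also have "\<dots> = r \<odot>\<^bsub>W\<^esub> F (k, g)"
    using r F kg finite_group_algebra.finite_carrier[OF St_algebra]
    by (intro abelian_monoid.finsum_singleton[OF abelian_group.axioms(1)[OF W_abelian_group]])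
      (simp_all add: W.smult_closed Pi_iff)
  also have "F (k, g) = mact k h g w"
    using mact_indep[OF MM_some[OF kg] h w] by (simp add: F_def)
  finally show ?thesis .
qed

lemma MM_module: "left_module (subgroup_algebra R (K \<times>\<times> G) St) MM"
  unfolding subgroup_algebra_def
proof (rule finite_group_algebra.left_module_group_algebraI[OF St_algebra])
  interpret W: left_module R W by (rule W_left_module)
  note biW = left_module_biadditive[OF W_left_module]
  let ?RSt = "group_algebra R ((K \<times>\<times> G)\<lparr>carrier := St\<rparr>)"
  let ?A = "\<lambda>x. case x of (k, g) \<Rightarrow> mact k (link k g) g"
  have A: "?A x \<in> add_hom W W" if "x \<in> St" for x
    using that by (cases x) (simp add: mact_hom[OF MM_some])
  have smult: "f \<odot>\<^bsub>MM\<^esub> w = (\<Oplus>\<^bsub>W\<^esub>x\<in>St. f x \<odot>\<^bsub>W\<^esub> ?A x w)" for f w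
    unfolding MM_simps by (rule arg_cong[where f = "\<lambda>F. finsum W F St"]) (auto simp: fun_eq_iff)
  show "abelian_group MM"
    by (rule abelian_group_cong[OF W_abelian_group]) (simp_all add: MM_simps)
  show "biadditive ?RSt MM MM (\<odot>\<^bsub>MM\<^esub>)"
    unfolding add_hom_cong[OF MM_simps(1,2)] biadditive_def smult
  proof (intro conjI ballI)
    fix f assume "f \<in> carrier ?RSt"
    then have "f x \<in> carrier R" if "x \<in> St" for x using that by (auto simp: group_algebra_simps)
    then have "(\<lambda>w. f x \<odot>\<^bsub>W\<^esub> ?A x w) \<in> add_hom W W" if "x \<in> St" for x
      using add_hom_comp[OF A[OF that] biadditive_homs(1)[OF biW]] that by auto
    from add_hom_finsum[OF W_abelian_group W_abelian_group this]
    show "(\<lambda>w. \<Oplus>\<^bsub>W\<^esub>x\<in>St. f x \<odot>\<^bsub>W\<^esub> ?A x w) \<in> add_hom W W" .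
  next
    fix w assume "w \<in> carrier W"
    then have "(\<lambda>f. f x \<odot>\<^bsub>W\<^esub> ?A x w) \<in> add_hom ?RSt W" if "x \<in> St" for x
      using add_hom_comp[OF finite_group_algebra.ga_eval_hom[OF St_algebra] biadditive_homs(2)[OF biW add_hom_closed[OF A[OF that]]]] that
      by simp
    from add_hom_finsum[OF finite_group_algebra.group_algebra_abelian_group[OF St_algebra] W_abelian_group this]
    show "(\<lambda>f. \<Oplus>\<^bsub>W\<^esub>x\<in>St. f x \<odot>\<^bsub>W\<^esub> ?A x w) \<in> add_hom ?RSt W" .
  qed
  {
    fix x y r s w
    assume *: "x \<in> carrier ((K \<times>\<times> G)\<lparr>carrier := St\<rparr>)" "y \<in> carrier ((K \<times>\<times> G)\<lparr>carrier := St\<rparr>)"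
      "r \<in> carrier R" "s \<in> carrier R" "w \<in> carrier MM"
    obtain k g k' g' where xy: "x = (k, g)" "y = (k', g')" by (cases x; cases y)
    obtain h h' where h: "(k, h) \<in> Y" "(cj h, g) \<in> X" and h': "(k', h') \<in> Y" "(cj h', g') \<in> X"
      using * xy by (auto simp: mem_St)
    \<comment> \<open>The product of linking elements links the product, and by
      \<open>MM_single\<close> the three group elements may act through \<open>h\<close>,
      \<open>h'\<close> and \<open>h h'\<close> simultaneously.\<close>
    have hh': "(k \<otimes>\<^bsub>K\<^esub> k', h \<otimes>\<^bsub>H\<^esub> h') \<in> Y" "(cj (h \<otimes>\<^bsub>H\<^esub> h'), g \<otimes>\<^bsub>G\<^esub> g') \<in> X"
      using Y_mult[OF h(1) h'(1)] X_mult[OF h(2) h'(2)] Y_closed[OF h(1)] Y_closed[OF h'(1)] t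
      by (simp_all add: H.G.conj_by_mult)
    have w: "w \<in> carrier W" using * by (simp add: MM_simps)
    have "r \<odot>\<^bsub>W\<^esub> mact k h g (s \<odot>\<^bsub>W\<^esub> mact k' h' g' w) =
        (r \<otimes>\<^bsub>R\<^esub> s) \<odot>\<^bsub>W\<^esub> mact (k \<otimes>\<^bsub>K\<^esub> k') (h \<otimes>\<^bsub>H\<^esub> h') (g \<otimes>\<^bsub>G\<^esub> g') w"
    proof (rule add_hom_eqI[OF W_generates _ _ _ w])
      show "(\<lambda>w. r \<odot>\<^bsub>W\<^esub> mact k h g (s \<odot>\<^bsub>W\<^esub> mact k' h' g' w)) \<in> add_hom W W"
        using add_hom_comp[OF add_hom_comp[OF add_hom_comp[OF mact_hom[OF h'] biadditive_homs(1)[OF biW *(4)]]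
              mact_hom[OF h]] biadditive_homs(1)[OF biW *(3)]] .
      show "(\<lambda>w. (r \<otimes>\<^bsub>R\<^esub> s) \<odot>\<^bsub>W\<^esub> mact (k \<otimes>\<^bsub>K\<^esub> k') (h \<otimes>\<^bsub>H\<^esub> h') (g \<otimes>\<^bsub>G\<^esub> g') w) \<in> add_hom W W"
        using add_hom_comp[OF mact_hom[OF hh'] biadditive_homs(1)[OF biW K.R.m_closed[OF *(3,4)]]] .
      fix w assume "w \<in> {pure n m | n m. n \<in> carrier N \<and> m \<in> carrier M}"
      then obtain n m where nm: "w = pure n m" "n \<in> carrier N" "m \<in> carrier M" by blast
      note cN = N.single_closed[OF N.one_X] and c = Y_closed[OF h(1)] Y_closed[OF h'(1)]
      have n1: "N.scal r (N.act (k, h) (N.scal s (N.act (k', h') n))) =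
          N.scal (r \<otimes>\<^bsub>R\<^esub> s) (N.act (k \<otimes>\<^bsub>K\<^esub> k', h \<otimes>\<^bsub>H\<^esub> h') n)"
        using nm h h' hh' * N.one_X c by (simp add: group_act_def N.single_act Y_mult)
      have m1: "M.act (cj h, g) (M.act (cj h', g') m) = M.act (cj (h \<otimes>\<^bsub>H\<^esub> h'), g \<otimes>\<^bsub>G\<^esub> g') m"
        using nm h h' c t by (simp add: M.act_act H.G.conj_by_mult)
      have "r \<odot>\<^bsub>W\<^esub> mact k h g (s \<odot>\<^bsub>W\<^esub> mact k' h' g' w) =
          pure (N.scal r (N.act (k, h) (N.scal s (N.act (k', h') n)))) (M.act (cj h, g) (M.act (cj h', g') m))"
        using nm h h' * cN by (simp add: mact_pure W_scal N.act_closed M.act_closed del: one_DirProd)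
      also have "\<dots> = (r \<otimes>\<^bsub>R\<^esub> s) \<odot>\<^bsub>W\<^esub> mact (k \<otimes>\<^bsub>K\<^esub> k') (h \<otimes>\<^bsub>H\<^esub> h') (g \<otimes>\<^bsub>G\<^esub> g') w"
        unfolding n1 m1 using nm hh' * by (simp add: mact_pure W_scal N.act_closed M.act_closed del: one_DirProd)
      finally show "r \<odot>\<^bsub>W\<^esub> mact k h g (s \<odot>\<^bsub>W\<^esub> mact k' h' g' w) =
        (r \<otimes>\<^bsub>R\<^esub> s) \<odot>\<^bsub>W\<^esub> mact (k \<otimes>\<^bsub>K\<^esub> k') (h \<otimes>\<^bsub>H\<^esub> h') (g \<otimes>\<^bsub>G\<^esub> g') w" .
    qed
    moreover have "s \<odot>\<^bsub>W\<^esub> mact k' h' g' w \<in> carrier W"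
      using * w by (simp add: W.smult_closed add_hom_closed[OF mact_hom[OF h']])
    ultimately show "ga_single R x r \<odot>\<^bsub>MM\<^esub> (ga_single R y s \<odot>\<^bsub>MM\<^esub> w) =
        ga_single R (x \<otimes>\<^bsub>(K \<times>\<times> G)\<lparr>carrier := St\<rparr>\<^esub> y) (r \<otimes>\<^bsub>R\<^esub> s) \<odot>\<^bsub>MM\<^esub> w"
      using xy * w by (simp add: MM_single[OF h] MM_single[OF h'] MM_single[OF hh'])
  }
  fix w assume "w \<in> carrier MM"
  then have w: "w \<in> carrier W" by (simp add: MM_simps)
  have one: "(cj \<one>\<^bsub>H\<^esub>, \<one>\<^bsub>G\<^esub>) \<in> X" using X_one t by (simp add: H.G.conj_by_one)
  have "mact \<one>\<^bsub>K\<^esub> \<one>\<^bsub>H\<^esub> \<one>\<^bsub>G\<^esub> w = w"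
    by (rule add_hom_eqI[OF W_generates mact_hom[OF Y_one one] add_hom_ident _ w])
      (use N.act_one M.act_one t in \<open>auto simp: mact_pure[OF Y_one one] H.G.conj_by_one\<close>)
  then show "ga_single R \<one>\<^bsub>(K \<times>\<times> G)\<lparr>carrier := St\<rparr>\<^esub> \<one>\<^bsub>R\<^esub> \<odot>\<^bsub>MM\<^esub> w = w"
    using w by (simp add: MM_single[OF Y_one one] W.smult_one)
qed

lemma MM_single_pure:
  assumes "(k, h) \<in> Y" "(cj h, g) \<in> X" "r \<in> carrier R" "n \<in> carrier N" "m \<in> carrier M"
  shows "ga_single R (k, g) r \<odot>\<^bsub>MM\<^esub> pure n m = pure (N.scal r (N.act (k, h) n)) (M.act (cj h, g) m)"
  using assms biadditiveD(1)[OF pure_biadditive]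
  by (simp add: MM_single[OF assms(1,2)] mact_pure W_scal N.act_closed M.act_closed del: one_DirProd)

lemma MM_act_pure:
  assumes "(k, h) \<in> Y" "(cj h, g) \<in> X" "n \<in> carrier N" "m \<in> carrier M"
  shows "group_act R MM (k, g) (pure n m) = pure (N.act (k, h) n) (M.act (cj h, g) m)"
  using assms N.scal_one[OF N.act_closed] by (simp add: group_act_def[of R MM] MM_single_pure del: one_DirProd)

section \<open>The summand at \<open>t\<close>\<close>

interpretation D: induced_module R "K \<times>\<times> G" St MM
  by (intro induced_module.intro induced_module_axioms.intro St_subgroup MM_module
      finite_group_algebra_DirProd K.finite_group_algebra_axioms G.finite_group_algebra_axioms)

abbreviation "BD \<equiv> as_bimodule R K G (Ind R (K \<times>\<times> G) St MM)"

abbreviation "mid_ind k g n m \<equiv> ind_tensor R (K \<times>\<times> G) St MM (k, g) (pure n m)"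

abbreviation "BD_gens \<equiv>
  {mid_ind k g n m | k g n m. k \<in> carrier K \<and> g \<in> carrier G \<and> n \<in> carrier N \<and> m \<in> carrier M}"

lemma BD_bimodule: "bimodule K.RG G.RG BD"
  by (rule as_bimodule(1)[OF K.finite_group_algebra_axioms G.finite_group_algebra_axioms D.Ind_left_module])

lemma mid_pure_closed: "\<lbrakk>n \<in> carrier N; m \<in> carrier M\<rbrakk> \<Longrightarrow> pure n m \<in> carrier MM"
  using biadditiveD(1)[OF pure_biadditive] by (simp add: MM_simps)

lemma mid_ind_closed:
  "\<lbrakk>k \<in> carrier K; g \<in> carrier G; n \<in> carrier N; m \<in> carrier M\<rbrakk> \<Longrightarrow> mid_ind k g n m \<in> carrier BD"
  by (simp add: as_bimodule_simps D.gen_closed mid_pure_closed)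

lemma mid_ind_biadditive:
  assumes "k \<in> carrier K" "g \<in> carrier G"
  shows "biadditive N M BD (mid_ind k g)"
proof -
  have "biadditive N M MM pure"
    using pure_biadditive by (simp add: add_hom_cong(6)[OF MM_simps(1,2)])
  from biadditive_comp_hom[OF this D.gen_hom[of "(k, g)"]] assms show ?thesis
    by (simp add: add_hom_cong(6)[OF as_bimodule_simps(1,3)])
qed

lemma mid_ind_mult:
  assumes "k \<in> carrier K" "g \<in> carrier G" "n \<in> carrier N" "m \<in> carrier M"
    and "(k0, h) \<in> Y" "(cj h, g0) \<in> X"
  shows "mid_ind (k \<otimes>\<^bsub>K\<^esub> k0) (g \<otimes>\<^bsub>G\<^esub> g0) n m = mid_ind k g (N.act (k0, h) n) (M.act (cj h, g0) m)"
proof -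
  have "(k0, g0) \<in> St" using assms by (auto simp: mem_St)
  with assms D.gen_mult[of "(k, g)" "(k0, g0)" "pure n m"] show ?thesis
    by (simp add: mid_pure_closed MM_act_pure)
qed

lemma mid_ind_scal:
  assumes "r \<in> carrier R" "n \<in> carrier N" "m \<in> carrier M"
  shows "mid_ind k g (N.scal r n) m = mid_ind k g n (M.scal r m)"
  by (simp only: pure_scal[OF assms])

lemma MM_scal_pure:
  assumes "r \<in> carrier R" "n \<in> carrier N" "m \<in> carrier M"
  shows "D.scal r (pure n m) = pure (N.scal r n) m"
  using MM_single_pure[OF Y_one _ assms, of "\<one>\<^bsub>G\<^esub>"] assms X_one t
    N.act_one[OF assms(2)] M.act_one[OF assms(3)]
  by (simp add: H.G.conj_by_one)

lemma BD_left:
  assumes "k' \<in> carrier K" "r \<in> carrier R" "k \<in> carrier K" "g \<in> carrier G" "n \<in> carrier N" "m \<in> carrier M"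
  shows "ga_single R k' r \<odot>\<^bsub>BD\<^esub> mid_ind k g n m = mid_ind (k' \<otimes>\<^bsub>K\<^esub> k) g (N.scal r n) m"
  using assms D.Ind_single[of "(k', \<one>\<^bsub>G\<^esub>)" "(k, g)" r "pure n m"] MM_scal_pure[OF assms(2,5,6)]
  by (simp add: mid_pure_closed
      as_bimodule(2)[OF K.finite_group_algebra_axioms G.finite_group_algebra_axioms D.Ind_left_module])

lemma BD_right:
  assumes "g' \<in> carrier G" "r \<in> carrier R" "k \<in> carrier K" "g \<in> carrier G" "n \<in> carrier N" "m \<in> carrier M"
  shows "mid_ind k g n m \<odot>r\<^bsub>BD\<^esub> ga_single R g' r = mid_ind k (inv\<^bsub>G\<^esub> g' \<otimes>\<^bsub>G\<^esub> g) n (M.scal r m)"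
  using assms D.Ind_single[of "(\<one>\<^bsub>K\<^esub>, inv\<^bsub>G\<^esub> g')" "(k, g)" r "pure n m"] MM_scal_pure[OF assms(2,5,6)]
    mid_ind_scal[OF assms(2,5,6)]
  by (simp add: mid_pure_closed
      as_bimodule(3)[OF K.finite_group_algebra_axioms G.finite_group_algebra_axioms D.Ind_left_module])

lemma BD_generates:
  "add_generates BD BD_gens"
proof -
  have "add_generates MM {pure n m | n m. n \<in> carrier N \<and> m \<in> carrier M}"
    using W_generates by (simp add: add_hom_cong(3)[OF MM_simps(1,2)])
  note D.Ind_generates_from[OF this]
  also have "{D.gen x w | x w. x \<in> carrier (K \<times>\<times> G) \<and> w \<in> {pure n m | n m. n \<in> carrier N \<and> m \<in> carrier M}} =
      BD_gens"
    by auto blast+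
  finally show ?thesis by (simp add: add_hom_cong(3)[OF as_bimodule_simps(1,3)])
qed

text \<open>Two universal properties in succession: the tensor product over the middle group for
  fixed \<open>(k, g)\<close>, then induction from \<open>St\<close>, whose compatibility condition
  is additive in the tensor and is tested on pure tensors.\<close>

lemma BD_universal:
  assumes Z: "abelian_group Z"
    and bi: "\<And>k g. \<lbrakk>k \<in> carrier K; g \<in> carrier G\<rbrakk> \<Longrightarrow> biadditive N M Z (f k g)"
    and fR: "\<And>k g n m r. \<lbrakk>k \<in> carrier K; g \<in> carrier G; n \<in> carrier N; m \<in> carrier M; r \<in> carrier R\<rbrakk> \<Longrightarrow>
      f k g (N.scal r n) m = f k g n (M.scal r m)"
    and fX: "\<And>k g n m k0 h g0. \<lbrakk>k \<in> carrier K; g \<in> carrier G; n \<in> carrier N; m \<in> carrier M;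
      (k0, h) \<in> Y; (cj h, g0) \<in> X\<rbrakk> \<Longrightarrow>
      f (k \<otimes>\<^bsub>K\<^esub> k0) (g \<otimes>\<^bsub>G\<^esub> g0) n m = f k g (N.act (k0, h) n) (M.act (cj h, g0) m)"
  shows "\<exists>\<Psi>\<in>add_hom BD Z. \<forall>k\<in>carrier K. \<forall>g\<in>carrier G. \<forall>n\<in>carrier N. \<forall>m\<in>carrier M.
    \<Psi> (mid_ind k g n m) = f k g n m"
proof -
  have "\<exists>\<Phi>. \<Phi> \<in> add_hom W Z \<and> (\<forall>n\<in>carrier N. \<forall>m\<in>carrier M. \<Phi> (pure n m) = f k g n m)"
    if kg: "k \<in> carrier K" "g \<in> carrier G" for k g
  proof -
    have B: "biadditive RN LM Z (f k g)"
      using bi[OF kg] by (simp add: add_hom_cong(4)[OF RN_simps(1,2)] add_hom_cong(5)[OF LM_simps(1,2)])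
    have bal: "f k g (p \<odot>r\<^bsub>RN\<^esub> a) q = f k g p (a \<odot>\<^bsub>LM\<^esub> q)"
      if "p \<in> carrier RN" "a \<in> carrier RS" "q \<in> carrier LM" for p a q
    proof (rule balancedI[OF mid.right mid.left B add_generates_carrier S_generates add_generates_carrier _ that])
      fix p a q assume "p \<in> carrier RN" "q \<in> carrier LM"
        and "a \<in> ga_singles R S"
      then obtain s r where a: "a = ga_single R s r" "s \<in> S" "r \<in> carrier R"
        and p: "p \<in> carrier N" and q: "q \<in> carrier M" by (auto simp: RN_simps LM_simps)
      then have s: "s \<in> carrier H" "(\<one>\<^bsub>K\<^esub>, s) \<in> Y" "(cj s, \<one>\<^bsub>G\<^esub>) \<in> X" by (auto simp: mem_S)
      have si: "(\<one>\<^bsub>K\<^esub>, inv\<^bsub>H\<^esub> s) \<in> Y" using Y_inv[OF s(2)] by simp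
      let ?p = "ga_single R (\<one>\<^bsub>K\<^esub>, inv\<^bsub>H\<^esub> s) r \<odot>\<^bsub>N\<^esub> p"
      \<comment> \<open>The relation \<open>fX\<close> with trivial outer components, read at the
        vector \<open>?p\<close> that carries \<open>s^-1\<close>: the action of \<open>s\<close>
        cancels the inverse on \<open>N\<close> and puts \<open>s^t\<close> on \<open>M\<close>;
        afterwards \<open>fR\<close> moves the scalar.\<close>
      have "f k g ?p q = f k g (N.act (\<one>\<^bsub>K\<^esub>, s) ?p) (M.act (cj s, \<one>\<^bsub>G\<^esub>) q)"
        using fX[OF kg N.single_closed[OF si a(3) p] q s(2,3)] kg by simp
      also have "N.act (\<one>\<^bsub>K\<^esub>, s) ?p = N.scal r p"
        using s si a p by (simp add: group_act_def N.single_act)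
      also have "f k g (N.scal r p) (M.act (cj s, \<one>\<^bsub>G\<^esub>) q) = f k g p (M.scal r (M.act (cj s, \<one>\<^bsub>G\<^esub>) q))"
        by (rule fR[OF kg p M.act_closed[OF s(3) q] a(3)])
      also have "M.scal r (M.act (cj s, \<one>\<^bsub>G\<^esub>) q) = ga_single R (cj s, \<one>\<^bsub>G\<^esub>) r \<odot>\<^bsub>M\<^esub> q"
        using s X_one X_closed[OF s(3)] a q by (simp add: group_act_def M.single_act)
      finally show "f k g (p \<odot>r\<^bsub>RN\<^esub> a) q = f k g p (a \<odot>\<^bsub>LM\<^esub> q)"
        using a by (simp add: RN_single LM_single)
    qed
    from mid.tensor_universal[OF Z B] bal obtain \<Phi> where "\<Phi> \<in> add_hom mid.T Z"
      "\<And>p q. \<lbrakk>p \<in> carrier RN; q \<in> carrier LM\<rbrakk> \<Longrightarrow> \<Phi> (mid.pure p q) = f k g p q" by blast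
    then show ?thesis
      by (auto simp: W_eq pure_eq RN_simps LM_simps)
  qed
  then have "\<forall>x\<in>carrier K \<times> carrier G. \<exists>\<Phi>. \<Phi> \<in> add_hom W Z \<and>
      (\<forall>n\<in>carrier N. \<forall>m\<in>carrier M. \<Phi> (pure n m) = f (fst x) (snd x) n m)" by auto
  from bchoice[OF this] obtain \<psi> where \<psi>: "\<forall>x\<in>carrier K \<times> carrier G. \<psi> x \<in> add_hom W Z \<and>
      (\<forall>n\<in>carrier N. \<forall>m\<in>carrier M. \<psi> x (pure n m) = f (fst x) (snd x) n m)" ..
  have \<psi>_hom: "\<psi> (k, g) \<in> add_hom MM Z" if "k \<in> carrier K" "g \<in> carrier G" for k g
    using \<psi> that by (auto simp: add_hom_cong(1)[OF MM_simps(1,2)])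
  have \<psi>_pure: "\<psi> (k, g) (pure n m) = f k g n m"
    if "k \<in> carrier K" "g \<in> carrier G" "n \<in> carrier N" "m \<in> carrier M" for k g n m
    using \<psi> that by auto
  have "\<exists>\<Psi>\<in>add_hom (Ind R (K \<times>\<times> G) St MM) Z. \<forall>x\<in>carrier (K \<times>\<times> G). \<forall>w\<in>carrier MM.
      \<Psi> (D.gen x w) = \<psi> x w"
  proof (rule D.Ind_universal[OF Z])
    show "\<psi> x \<in> add_hom MM Z" if "x \<in> carrier (K \<times>\<times> G)" for x
      using that by (auto intro: \<psi>_hom)
    fix x y w assume "x \<in> carrier (K \<times>\<times> G)" "y \<in> St" and w: "w \<in> carrier MM"
    then obtain k g k0 g0 where xy1: "x = (k, g)" "k \<in> carrier K" "g \<in> carrier G" "y = (k0, g0)"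
      "(k0, g0) \<in> St" by (cases x; cases y) auto
    then obtain h where xy2: "(k0, h) \<in> Y" "(cj h, g0) \<in> X" by (auto simp: mem_St)
    note xy = xy1 xy2
    note c = Y_closed(1)[OF xy(6)] X_closed(2)[OF xy(7)]
    have gen: "add_generates MM {pure n m | n m. n \<in> carrier N \<and> m \<in> carrier M}"
      using W_generates by (simp add: add_hom_cong(3)[OF MM_simps(1,2)])
    have "\<psi> (k \<otimes>\<^bsub>K\<^esub> k0, g \<otimes>\<^bsub>G\<^esub> g0) w = \<psi> (k, g) (D.act (k0, g0) w)"
    proof (rule add_hom_eqI[OF gen \<psi>_hom add_hom_comp[OF D.act_hom \<psi>_hom] _ w])
      fix w assume "w \<in> {pure n m | n m. n \<in> carrier N \<and> m \<in> carrier M}"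
      then obtain n m where nm: "w = pure n m" "n \<in> carrier N" "m \<in> carrier M" by blast
      then show "\<psi> (k \<otimes>\<^bsub>K\<^esub> k0, g \<otimes>\<^bsub>G\<^esub> g0) w = \<psi> (k, g) (D.act (k0, g0) w)"
        using xy c by (simp add: \<psi>_pure MM_act_pure[OF xy(6,7)] fX N.act_closed M.act_closed)
    qed (use xy c in auto)
    with xy show "\<psi> (x \<otimes>\<^bsub>K \<times>\<times> G\<^esub> y) w = \<psi> x (D.act y w)" by simp
  qed
  then obtain \<Psi> where \<Psi>: "\<Psi> \<in> add_hom (Ind R (K \<times>\<times> G) St MM) Z"
    "\<forall>x\<in>carrier (K \<times>\<times> G). \<forall>w\<in>carrier MM. \<Psi> (D.gen x w) = \<psi> x w" by blast
  then show ?thesis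
    by (intro bexI[of _ \<Psi>]) (auto simp: mid_pure_closed \<psi>_pure add_hom_cong(1)[OF as_bimodule_simps(1,3)])
qed

end

end

section \<open>The isomorphism\<close>

context induced_pair
begin

section \<open>Decomposition along the double cosets\<close>

lemma mem_proj2: "u \<in> proj2 K H Y \<longleftrightarrow> (\<exists>k. (k, u) \<in> Y)"
  using Y_closed by (auto simp: proj2_def)

lemma mem_proj1: "v \<in> proj1 H G X \<longleftrightarrow> (\<exists>g. (v, g) \<in> X)"
  using X_closed by (auto simp: proj1_def)

context
  fixes T assumes reps: "double_coset_reps H (proj2 K H Y) (proj1 H G X) T"
begin

lemma T_closed: "t \<in> T \<Longrightarrow> t \<in> carrier H"
  using reps by (auto simp: double_coset_reps_def)

text \<open>The double coset is unfolded together with the outer components \<open>k\<close> and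
  \<open>g\<close>, because the isomorphism uses the elements of \<open>Y\<close> and
  \<open>X\<close> and not merely their projections \<open>u\<close> and \<open>v\<close>.\<close>

lemma rep_ex1:
  assumes "h \<in> carrier H"
  shows "\<exists>!t. t \<in> T \<and> (\<exists>k u v g. (k, u) \<in> Y \<and> (v, g) \<in> X \<and> t = u \<otimes>\<^bsub>H\<^esub> h \<otimes>\<^bsub>H\<^esub> v)"
proof -
  let ?D = "proj2 K H Y <#>\<^bsub>H\<^esub> {h} <#>\<^bsub>H\<^esub> proj1 H G X"
  have "?D \<in> double_cosets H (proj2 K H Y) (proj1 H G X)"
    using assms by (auto simp: double_cosets_def)
  with reps have "\<exists>!t. t \<in> T \<and> t \<in> ?D" unfolding double_coset_reps_def by blast
  moreover have "t \<in> ?D \<longleftrightarrow> (\<exists>k u v g. (k, u) \<in> Y \<and> (v, g) \<in> X \<and> t = u \<otimes>\<^bsub>H\<^esub> h \<otimes>\<^bsub>H\<^esub> v)" for t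
  proof -
    have "t \<in> ?D \<longleftrightarrow> (\<exists>u v. u \<in> proj2 K H Y \<and> v \<in> proj1 H G X \<and> t = u \<otimes>\<^bsub>H\<^esub> h \<otimes>\<^bsub>H\<^esub> v)"
      by (auto simp: set_mult_def)
    then show ?thesis unfolding mem_proj1 mem_proj2 by blast
  qed
  ultimately show ?thesis by simp
qed

lemma rep_decomposition:
  assumes "h \<in> carrier H"
  obtains t k0 u v g0 where "t \<in> T" "(k0, u) \<in> Y" "(v, g0) \<in> X" "h = u \<otimes>\<^bsub>H\<^esub> t \<otimes>\<^bsub>H\<^esub> v"
proof -
  obtain t k u v g where *: "t \<in> T" "(k, u) \<in> Y" "(v, g) \<in> X" "t = u \<otimes>\<^bsub>H\<^esub> h \<otimes>\<^bsub>H\<^esub> v"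
    using rep_ex1[OF assms] by blast
  note c = Y_closed[OF *(2)] X_closed[OF *(3)]
  have "h = inv\<^bsub>H\<^esub> u \<otimes>\<^bsub>H\<^esub> t \<otimes>\<^bsub>H\<^esub> inv\<^bsub>H\<^esub> v"
    using c assms by (simp add: *(4) H.G.m_assoc) (simp add: H.G.m_assoc[symmetric])
  from that[OF *(1) Y_inv[OF *(2)] X_inv[OF *(3)] this] show thesis .
qed

lemma rep_unique:
  assumes "t \<in> T" "t' \<in> T" "(k0, u) \<in> Y" "(v, g0) \<in> X" "t' = u \<otimes>\<^bsub>H\<^esub> t \<otimes>\<^bsub>H\<^esub> v"
  shows "t = t'"
proof -
  have t: "t \<in> carrier H" by (rule T_closed[OF assms(1)])
  \<comment> \<open>\<open>t\<close> lies in its own double coset by the trivial decomposition, so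
    uniqueness compares it there with \<open>t'\<close>.\<close>
  then have "t = \<one>\<^bsub>H\<^esub> \<otimes>\<^bsub>H\<^esub> t \<otimes>\<^bsub>H\<^esub> \<one>\<^bsub>H\<^esub>" by simp
  with rep_ex1[OF t] assms Y_one X_one show ?thesis by blast
qed

lemma sum_BD: "finite_bimodule_sum T K.RG G.RG BD"
proof (rule finite_bimodule_sum.intro)
  show "finite T" using T_closed H.finite_carrier by (meson finite_subset subsetI)
  show "T \<noteq> {}" using rep_decomposition[OF H.G.one_closed] by blast
qed (rule BD_bimodule[OF T_closed])

interpretation S: finite_bimodule_sum T K.RG G.RG BD
  by (rule sum_BD)

text \<open>The candidate for the image of \<open>ind_pure k h g n m\<close> under a decomposition
  \<open>h = u t v\<close>. The decomposition appears among the arguments because its irrelevance is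
  still to be shown.\<close>

definition sum_val where
  "sum_val t k0 u v g0 k g n m = sum_inj T BD t
     (mid_ind t (k \<otimes>\<^bsub>K\<^esub> k0) (g \<otimes>\<^bsub>G\<^esub> inv\<^bsub>G\<^esub> g0) (N.act (inv\<^bsub>K\<^esub> k0, inv\<^bsub>H\<^esub> u) n) (M.act (v, g0) m))"

lemma sum_val_indep:
  assumes 1: "t \<in> T" "(k0, u) \<in> Y" "(v, g0) \<in> X" and 2: "t' \<in> T" "(k0', u') \<in> Y" "(v', g0') \<in> X"
    and eq: "u \<otimes>\<^bsub>H\<^esub> t \<otimes>\<^bsub>H\<^esub> v = u' \<otimes>\<^bsub>H\<^esub> t' \<otimes>\<^bsub>H\<^esub> v'"
    and c: "k \<in> carrier K" "g \<in> carrier G" "n \<in> carrier N" "m \<in> carrier M"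
  shows "sum_val t k0 u v g0 k g n m = sum_val t' k0' u' v' g0' k g n m"
proof -
  note t = T_closed[OF 1(1)] T_closed[OF 2(1)]
  note cl = Y_closed[OF 1(2)] X_closed[OF 1(3)] Y_closed[OF 2(2)] X_closed[OF 2(3)]
  define w where "w = inv\<^bsub>H\<^esub> u' \<otimes>\<^bsub>H\<^esub> u"
  define x where "x = v' \<otimes>\<^bsub>H\<^esub> inv\<^bsub>H\<^esub> v"
  have wY: "(inv\<^bsub>K\<^esub> k0' \<otimes>\<^bsub>K\<^esub> k0, w) \<in> Y" unfolding w_def by (intro Y_mult Y_inv 1 2)
  have xX: "(x, g0' \<otimes>\<^bsub>G\<^esub> inv\<^bsub>G\<^esub> g0) \<in> X" unfolding x_def by (intro X_mult X_inv 1 2)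
  have "w \<otimes>\<^bsub>H\<^esub> t = inv\<^bsub>H\<^esub> u' \<otimes>\<^bsub>H\<^esub> (u \<otimes>\<^bsub>H\<^esub> t \<otimes>\<^bsub>H\<^esub> v) \<otimes>\<^bsub>H\<^esub> inv\<^bsub>H\<^esub> v"
    using t cl by (simp add: w_def H.G.m_assoc)
  also have "\<dots> = t' \<otimes>\<^bsub>H\<^esub> x"
    using t cl unfolding eq by (simp add: x_def H.G.m_assoc) (simp add: H.G.m_assoc[symmetric])
  finally have wt: "w \<otimes>\<^bsub>H\<^esub> t = t' \<otimes>\<^bsub>H\<^esub> x" .
  have wc: "w \<in> carrier H" "x \<in> carrier H" using cl by (simp_all add: w_def x_def)
  \<comment> \<open>This places \<open>t'\<close> in the double coset of \<open>t\<close>, so the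
    representatives coincide. Only then does the equation \<open>w t = t' x\<close> identify
    \<open>x\<close> with \<open>w^t\<close>.\<close>
  have "t' = w \<otimes>\<^bsub>H\<^esub> t \<otimes>\<^bsub>H\<^esub> inv\<^bsub>H\<^esub> x" using t wc unfolding wt by (simp add: H.G.m_assoc)
  from rep_unique[OF 1(1) 2(1) wY X_inv[OF xX] this] have tt': "t' = t" by simp
  have "cj t w = inv\<^bsub>H\<^esub> t \<otimes>\<^bsub>H\<^esub> (w \<otimes>\<^bsub>H\<^esub> t)" using t wc by (simp add: conj_by_def H.G.m_assoc)
  also have "\<dots> = x" using t wc unfolding wt tt' by (simp add: H.G.m_assoc[symmetric])
  finally have cjw: "cj t w = x" .
  \<comment> \<open>Splitting off \<open>k0'^-1 k0\<close> and \<open>g0' g0^-1\<close> displays the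
    pair linked by \<open>w\<close>, to which \<open>mid_ind_mult\<close> applies.\<close>
  have "mid_ind t (k \<otimes>\<^bsub>K\<^esub> k0) (g \<otimes>\<^bsub>G\<^esub> inv\<^bsub>G\<^esub> g0) (N.act (inv\<^bsub>K\<^esub> k0, inv\<^bsub>H\<^esub> u) n) (M.act (v, g0) m) =
      mid_ind t (k \<otimes>\<^bsub>K\<^esub> k0' \<otimes>\<^bsub>K\<^esub> (inv\<^bsub>K\<^esub> k0' \<otimes>\<^bsub>K\<^esub> k0)) (g \<otimes>\<^bsub>G\<^esub> inv\<^bsub>G\<^esub> g0' \<otimes>\<^bsub>G\<^esub> (g0' \<otimes>\<^bsub>G\<^esub> inv\<^bsub>G\<^esub> g0))
        (N.act (inv\<^bsub>K\<^esub> k0, inv\<^bsub>H\<^esub> u) n) (M.act (v, g0) m)"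
  proof -
    have "k \<otimes>\<^bsub>K\<^esub> k0' \<otimes>\<^bsub>K\<^esub> (inv\<^bsub>K\<^esub> k0' \<otimes>\<^bsub>K\<^esub> k0) = k \<otimes>\<^bsub>K\<^esub> k0"
      using c cl by (simp add: K.G.m_assoc) (simp add: K.G.m_assoc[symmetric])
    moreover have "g \<otimes>\<^bsub>G\<^esub> inv\<^bsub>G\<^esub> g0' \<otimes>\<^bsub>G\<^esub> (g0' \<otimes>\<^bsub>G\<^esub> inv\<^bsub>G\<^esub> g0) = g \<otimes>\<^bsub>G\<^esub> inv\<^bsub>G\<^esub> g0"
      using c cl by (simp add: G.G.m_assoc) (simp add: G.G.m_assoc[symmetric])
    ultimately show ?thesis by simp
  qed
  also have "\<dots> = mid_ind t (k \<otimes>\<^bsub>K\<^esub> k0') (g \<otimes>\<^bsub>G\<^esub> inv\<^bsub>G\<^esub> g0')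
      (N.act (inv\<^bsub>K\<^esub> k0' \<otimes>\<^bsub>K\<^esub> k0, w) (N.act (inv\<^bsub>K\<^esub> k0, inv\<^bsub>H\<^esub> u) n))
      (M.act (x, g0' \<otimes>\<^bsub>G\<^esub> inv\<^bsub>G\<^esub> g0) (M.act (v, g0) m))"
    using mid_ind_mult[OF t(1) _ _ N.act_closed[OF Y_inv[OF 1(2)] c(3)] M.act_closed[OF 1(3) c(4)] wY, unfolded cjw, OF _ _ xX] c cl
    by simp
  also have "N.act (inv\<^bsub>K\<^esub> k0' \<otimes>\<^bsub>K\<^esub> k0, w) (N.act (inv\<^bsub>K\<^esub> k0, inv\<^bsub>H\<^esub> u) n) = N.act (inv\<^bsub>K\<^esub> k0', inv\<^bsub>H\<^esub> u') n"
    using c cl wY Y_inv[OF 1(2)] by (simp add: N.act_act w_def K.G.m_assoc H.G.m_assoc)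
  also have "M.act (x, g0' \<otimes>\<^bsub>G\<^esub> inv\<^bsub>G\<^esub> g0) (M.act (v, g0) m) = M.act (v', g0') m"
    using c cl xX 1(3) by (simp add: M.act_act x_def H.G.m_assoc G.G.m_assoc)
  finally show ?thesis by (simp add: sum_val_def tt')
qed

lemma bimodule_isomorphic_sum:
  "bimodule_isomorphic K.RG G.RG IT (bimodule_direct_sum T BD)"
proof -
  interpret IT: bimodule K.RG G.RG IT by (rule IT_bimodule)
  interpret D: bimodule K.RG G.RG S.D by (rule S.D_bimodule)
  have IT_ab: "abelian_group IT" using IT.left_module_axioms by (simp add: left_module_def)
  note Nc = N.single_closed[OF N.one_X] and Mc = M.single_closed[OF M.one_X]

  \<comment> \<open>The value is selected and not the decomposition: by \<open>sum_val_indep\<close>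
    all decompositions give the same candidate, and \<open>f_eq\<close> may be used with whichever
    one is convenient.\<close>
  define f where "f k h g n m = (SOME z. \<exists>t k0 u v g0. t \<in> T \<and> (k0, u) \<in> Y \<and> (v, g0) \<in> X \<and>
      h = u \<otimes>\<^bsub>H\<^esub> t \<otimes>\<^bsub>H\<^esub> v \<and> z = sum_val t k0 u v g0 k g n m)" for k h g n m
  have f_eq: "f k h g n m = sum_val t k0 u v g0 k g n m"
    if "t \<in> T" "(k0, u) \<in> Y" "(v, g0) \<in> X" "h = u \<otimes>\<^bsub>H\<^esub> t \<otimes>\<^bsub>H\<^esub> v"
      "k \<in> carrier K" "g \<in> carrier G" "n \<in> carrier N" "m \<in> carrier M" for t k0 u v g0 k h g n m
  proof -
    let ?P = "\<lambda>z. \<exists>t k0 u v g0. t \<in> T \<and> (k0, u) \<in> Y \<and> (v, g0) \<in> X \<and>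
      h = u \<otimes>\<^bsub>H\<^esub> t \<otimes>\<^bsub>H\<^esub> v \<and> z = sum_val t k0 u v g0 k g n m"
    have "?P (sum_val t k0 u v g0 k g n m)" using that by blast
    then have "?P (f k h g n m)" unfolding f_def by (rule someI[where P = ?P])
    then obtain t' k0' u' v' g0' where *: "t' \<in> T" "(k0', u') \<in> Y" "(v', g0') \<in> X"
      "h = u' \<otimes>\<^bsub>H\<^esub> t' \<otimes>\<^bsub>H\<^esub> v'" "f k h g n m = sum_val t' k0' u' v' g0' k g n m" by blast
    show ?thesis
      unfolding *(5) using *(4) that(4) by (intro sum_val_indep *(1-3) that(1-3,5-)) simp
  qed

  obtain \<Phi> where \<Phi>: "\<Phi> \<in> add_hom IT S.D"
    "\<And>k h g n m. \<lbrakk>k \<in> carrier K; h \<in> carrier H; g \<in> carrier G; n \<in> carrier N; m \<in> carrier M\<rbrakk> \<Longrightarrow>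
      \<Phi> (ind_pure k h g n m) = f k h g n m"
  proof (rule IT_universal[OF S.D_abelian_group])
    fix k h g assume c: "k \<in> carrier K" "h \<in> carrier H" "g \<in> carrier G"
    obtain t k0 u v g0 where *: "t \<in> T" "(k0, u) \<in> Y" "(v, g0) \<in> X" "h = u \<otimes>\<^bsub>H\<^esub> t \<otimes>\<^bsub>H\<^esub> v"
      by (rule rep_decomposition[OF c(2)])
    note cl = Y_closed[OF *(2)] X_closed[OF *(3)] T_closed[OF *(1)]
    have fe: "f k h g n m = sum_val t k0 u v g0 k g n m" if "n \<in> carrier N" "m \<in> carrier M" for n m
      by (rule f_eq[OF * c(1,3) that])
    have "biadditive N M S.D (sum_val t k0 u v g0 k g)"
      unfolding sum_val_def
      using cl c *
      by (intro biadditive_comp_hom[OF _ S.sum_inj_hom]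
          biadditive_comp[OF mid_ind_biadditive N.act_hom[OF Y_inv] M.act_hom]) auto
    from biadditiveD[OF this] show "biadditive N M S.D (f k h g)"
      by (intro biadditiveI)
        (simp_all add: fe N.M.a_closed M.M.a_closed)
    fix n m assume nm: "n \<in> carrier N" "m \<in> carrier M"
    \<comment> \<open>If \<open>(k0, u)\<close> serves for \<open>h\<close>, then
      \<open>(k1 k0, u1 u)\<close> serves for \<open>u1 h\<close>. Both sides then have the
      \<open>K\<close>-component \<open>k k1 k0\<close>, and \<open>(k1, u1)\<close> cancels in
      front of \<open>n\<close>.\<close>
    show "f (k \<otimes>\<^bsub>K\<^esub> k1) h g n m = f k (u1 \<otimes>\<^bsub>H\<^esub> h) g (N.act (k1, u1) n) m" if Y1: "(k1, u1) \<in> Y" for k1 u1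
    proof -
      note c1 = Y_closed[OF Y1]
      have e: "u1 \<otimes>\<^bsub>H\<^esub> h = (u1 \<otimes>\<^bsub>H\<^esub> u) \<otimes>\<^bsub>H\<^esub> t \<otimes>\<^bsub>H\<^esub> v" using cl c1 by (simp add: *(4) H.G.m_assoc)
      have a: "N.act (inv\<^bsub>K\<^esub> (k1 \<otimes>\<^bsub>K\<^esub> k0), inv\<^bsub>H\<^esub> (u1 \<otimes>\<^bsub>H\<^esub> u)) (N.act (k1, u1) n) = N.act (inv\<^bsub>K\<^esub> k0, inv\<^bsub>H\<^esub> u) n"
        using N.act_act[OF Y_inv[OF Y_mult[OF Y1 *(2)]] Y1 nm(1)] cl c1
        by (simp add: K.G.inv_mult_group H.G.inv_mult_group K.G.m_assoc H.G.m_assoc)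
      show ?thesis
        using f_eq[OF *(1) Y_mult[OF Y1 *(2)] *(3) e c(1,3) N.act_closed[OF Y1 nm(1)] nm(2)]
          f_eq[OF * _ c(3) nm, of "k \<otimes>\<^bsub>K\<^esub> k1"] c c1 cl
        by (simp add: sum_val_def a K.G.m_assoc)
    qed
    \<comment> \<open>Likewise \<open>(v v1, g0 g1)\<close> serves for \<open>h v1\<close>, and
      \<open>g1\<close> cancels in the \<open>G\<close>-component.\<close>
    show "f k (h \<otimes>\<^bsub>H\<^esub> v1) (g \<otimes>\<^bsub>G\<^esub> g1) n m = f k h g n (M.act (v1, g1) m)" if X1: "(v1, g1) \<in> X" for v1 g1
    proof -
      note c1 = X_closed[OF X1]
      have e: "h \<otimes>\<^bsub>H\<^esub> v1 = u \<otimes>\<^bsub>H\<^esub> t \<otimes>\<^bsub>H\<^esub> (v \<otimes>\<^bsub>H\<^esub> v1)" using cl c1 by (simp add: *(4) H.G.m_assoc)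
      have g: "g \<otimes>\<^bsub>G\<^esub> g1 \<otimes>\<^bsub>G\<^esub> inv\<^bsub>G\<^esub> (g0 \<otimes>\<^bsub>G\<^esub> g1) = g \<otimes>\<^bsub>G\<^esub> inv\<^bsub>G\<^esub> g0"
        using c cl c1 by (simp add: G.G.inv_mult_group G.G.m_assoc) (simp add: G.G.m_assoc[symmetric])
      have a: "M.act (v, g0) (M.act (v1, g1) m) = M.act (v \<otimes>\<^bsub>H\<^esub> v1, g0 \<otimes>\<^bsub>G\<^esub> g1) m"
        using M.act_act[OF *(3) X1 nm(2)] by simp
      show ?thesis
        using f_eq[OF *(1,2) X_mult[OF *(3) X1] e c(1) _ nm, of "g \<otimes>\<^bsub>G\<^esub> g1"] c c1
          fe[OF nm(1) M.act_closed[OF X1 nm(2)]]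
        by (simp add: sum_val_def a g)
    qed
    show "f k h g (N.scal r n) m = f k h g n (M.scal r m)" if r: "r \<in> carrier R" for r
      using fe[OF Nc[OF r nm(1)] nm(2)] fe[OF nm(1) Mc[OF r nm(2)]] r nm
        mid_ind_scal[OF cl(5) r N.act_closed[OF Y_inv[OF *(2)] nm(1)] M.act_closed[OF *(3) nm(2)]]
      by (simp only: sum_val_def N.act_scal[OF Y_inv[OF *(2)] r nm(1)] M.act_scal[OF *(3) r nm(2)])
  qed (rule that)

  have ex: "\<exists>\<Psi>\<in>add_hom (BD t) IT. \<forall>k\<in>carrier K. \<forall>g\<in>carrier G. \<forall>n\<in>carrier N. \<forall>m\<in>carrier M.
      \<Psi> (mid_ind t k g n m) = ind_pure k t g n m" if t: "t \<in> carrier H" for t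
  proof (rule BD_universal[OF t IT_ab])
    fix k g assume c: "k \<in> carrier K" "g \<in> carrier G"
    show "biadditive N M IT (ind_pure k t g)" using ind_pure_biadditive c t by blast
    fix n m assume nm: "n \<in> carrier N" "m \<in> carrier M"
    show "ind_pure k t g (N.scal r n) m = ind_pure k t g n (M.scal r m)" if "r \<in> carrier R" for r
      using ind_pure_scal[OF c(1) t c(2) nm that] .
    fix k0 h g0 assume Y0: "(k0, h) \<in> Y" and X0: "(cj t h, g0) \<in> X"
    note cl = Y_closed[OF Y0] X_closed[OF X0]
    \<comment> \<open>A single linking element serves twice: \<open>ind_pure_Y\<close> puts
      \<open>h\<close> in front of \<open>t\<close>, and \<open>ind_pure_X\<close> takes it off
      behind \<open>t\<close> as \<open>h^t\<close>.\<close>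
    have "h \<otimes>\<^bsub>H\<^esub> t = t \<otimes>\<^bsub>H\<^esub> cj t h"
      using t cl by (simp add: conj_by_def H.G.m_assoc[symmetric])
    then show "ind_pure (k \<otimes>\<^bsub>K\<^esub> k0) t (g \<otimes>\<^bsub>G\<^esub> g0) n m = ind_pure k t g (N.act (k0, h) n) (M.act (cj t h, g0) m)"
      using c t cl nm by (simp add: ind_pure_Y[OF _ _ _ _ _ Y0] ind_pure_X[OF _ _ _ _ _ X0] N.act_closed[OF Y0])
  qed
  have "\<forall>t\<in>T. \<exists>\<Psi>. \<Psi> \<in> add_hom (BD t) IT \<and> (\<forall>k\<in>carrier K. \<forall>g\<in>carrier G. \<forall>n\<in>carrier N. \<forall>m\<in>carrier M.
      \<Psi> (mid_ind t k g n m) = ind_pure k t g n m)"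
    using ex[OF T_closed] by (simp only: Bex_def Ball_def) simp
  from bchoice[OF this] obtain \<psi> where \<psi>0: "\<forall>t\<in>T. \<psi> t \<in> add_hom (BD t) IT \<and>
      (\<forall>k\<in>carrier K. \<forall>g\<in>carrier G. \<forall>n\<in>carrier N. \<forall>m\<in>carrier M.
      \<psi> t (mid_ind t k g n m) = ind_pure k t g n m)" ..
  have \<psi>: "\<And>t. t \<in> T \<Longrightarrow> \<psi> t \<in> add_hom (BD t) IT"
    "\<And>t k g n m. \<lbrakk>t \<in> T; k \<in> carrier K; g \<in> carrier G; n \<in> carrier N; m \<in> carrier M\<rbrakk> \<Longrightarrow>
      \<psi> t (mid_ind t k g n m) = ind_pure k t g n m"
    using \<psi>0 by simp_all
  from S.D_universal[OF IT_ab \<psi>(1)] obtain \<Psi> where \<Psi>: "\<Psi> \<in> add_hom S.D IT"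
    "\<And>t w. \<lbrakk>t \<in> T; w \<in> carrier (BD t)\<rbrakk> \<Longrightarrow> \<Psi> (sum_inj T BD t w) = \<psi> t w" by blast
  have \<Psi>_gen: "\<Psi> (sum_inj T BD t (mid_ind t k g n m)) = ind_pure k t g n m"
    if "t \<in> T" "k \<in> carrier K" "g \<in> carrier G" "n \<in> carrier N" "m \<in> carrier M" for t k g n m
    using that by (simp add: \<Psi>(2) \<psi>(2) mid_ind_closed[OF T_closed])

  have gen_D: "add_generates S.D {sum_inj T BD t w | t w. t \<in> T \<and> w \<in> BD_gens t}"
    by (rule S.D_generates[OF BD_generates[OF T_closed]])
  \<comment> \<open>The relations for \<open>X\<close> and for \<open>Y\<close> rebuild
    \<open>h = u t v\<close> from \<open>t\<close> one outer factor at a time and undo the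
    corrections made in \<open>sum_val\<close>.\<close>
  have \<Psi>\<Phi>: "\<Psi> (\<Phi> x) = x" if x: "x \<in> carrier IT" for x
  proof (rule add_hom_eqI[OF IT_generates add_hom_comp[OF \<Phi>(1) \<Psi>(1)] add_hom_ident _ x])
    fix s assume "s \<in> IT_gens"
    then obtain k h g n m where s: "s = ind_pure k h g n m"
      and c: "k \<in> carrier K" "h \<in> carrier H" "g \<in> carrier G" "n \<in> carrier N" "m \<in> carrier M" by blast
    obtain t k0 u v g0 where *: "t \<in> T" "(k0, u) \<in> Y" "(v, g0) \<in> X" "h = u \<otimes>\<^bsub>H\<^esub> t \<otimes>\<^bsub>H\<^esub> v"
      by (rule rep_decomposition[OF c(2)])
    note cl = Y_closed[OF *(2)] X_closed[OF *(3)] T_closed[OF *(1)]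
    let ?n = "N.act (inv\<^bsub>K\<^esub> k0, inv\<^bsub>H\<^esub> u) n"
    have nc: "?n \<in> carrier N" by (rule N.act_closed[OF Y_inv[OF *(2)] c(4)])
    have "\<Psi> (\<Phi> s) = ind_pure (k \<otimes>\<^bsub>K\<^esub> k0) t (g \<otimes>\<^bsub>G\<^esub> inv\<^bsub>G\<^esub> g0) ?n (M.act (v, g0) m)"
      using c cl nc by (simp add: s \<Phi>(2) f_eq[OF *] sum_val_def \<Psi>_gen[OF *(1)] M.act_closed[OF *(3)])
    also have "\<dots> = ind_pure (k \<otimes>\<^bsub>K\<^esub> k0) (t \<otimes>\<^bsub>H\<^esub> v) g ?n m"
      using ind_pure_X[OF _ cl(5) _ nc c(5) *(3), of "k \<otimes>\<^bsub>K\<^esub> k0" "g \<otimes>\<^bsub>G\<^esub> inv\<^bsub>G\<^esub> g0"] c cl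
      by (simp add: G.G.m_assoc)
    also have "\<dots> = ind_pure k h g (N.act (k0, u) ?n) m"
      using ind_pure_Y[OF c(1) _ c(3) nc c(5) *(2), of "t \<otimes>\<^bsub>H\<^esub> v"] cl by (simp add: *(4) H.G.m_assoc)
    also have "N.act (k0, u) ?n = n"
      using N.act_act[OF *(2) Y_inv[OF *(2)] c(4)] N.act_one[OF c(4)] cl by simp
    finally show "\<Psi> (\<Phi> s) = s" by (simp add: s)
  qed
  have \<Phi>\<Psi>: "\<Phi> (\<Psi> y) = y" if y: "y \<in> carrier S.D" for y
  proof (rule add_hom_eqI[OF gen_D add_hom_comp[OF \<Psi>(1) \<Phi>(1)] add_hom_ident _ y])
    fix s assume "s \<in> {sum_inj T BD t w | t w. t \<in> T \<and> w \<in> BD_gens t}"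
    then obtain t k g n m where s: "s = sum_inj T BD t (mid_ind t k g n m)" "t \<in> T"
      and c: "k \<in> carrier K" "g \<in> carrier G" "n \<in> carrier N" "m \<in> carrier M" by blast
    have t: "t \<in> carrier H" by (rule T_closed[OF s(2)])
    have "\<Phi> (\<Psi> s) = f k t g n m"
      using c t by (simp add: s \<Psi>_gen \<Phi>(2))
    \<comment> \<open>The representative itself has the decomposition \<open>t = 1 t 1\<close>, for
      which every correction is trivial.\<close>
    also have "\<dots> = sum_val t \<one>\<^bsub>K\<^esub> \<one>\<^bsub>H\<^esub> \<one>\<^bsub>H\<^esub> \<one>\<^bsub>G\<^esub> k g n m"
      using t by (intro f_eq s(2) Y_one X_one c) simp
    also have "\<dots> = s"
      using c N.act_one[OF c(3)] M.act_one[OF c(4)] by (simp add: sum_val_def s)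
    finally show "\<Phi> (\<Psi> s) = s" .
  qed
  have bij: "bij_betw \<Phi> (carrier IT) (carrier S.D)"
    by (rule bij_betwI[where g = \<Psi>])
      (auto simp: \<Psi>\<Phi> \<Phi>\<Psi> add_hom_closed[OF \<Phi>(1)] add_hom_closed[OF \<Psi>(1)])

  note biIT = left_module_biadditive[OF IT.left_module_axioms] right_module_biadditive[OF IT.right_module_axioms]
  note biD = left_module_biadditive[OF D.left_module_axioms] right_module_biadditive[OF D.right_module_axioms]
  have left: "\<Phi> (a \<odot>\<^bsub>IT\<^esub> x) = a \<odot>\<^bsub>S.D\<^esub> \<Phi> x" if a: "a \<in> carrier K.RG" and x: "x \<in> carrier IT" for a x
  proof (rule biadditive_eqI[OF K.ga_generates IT_generates biadditive_comp_hom[OF biIT(1) \<Phi>(1)]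
        biadditive_comp[OF biD(1) add_hom_ident \<Phi>(1)] _ a x])
    fix a s assume "a \<in> ga_singles R (carrier K)" and "s \<in> IT_gens"
    then obtain k' r k h g n m where a: "a = ga_single R k' r" "k' \<in> carrier K" "r \<in> carrier R"
      and s: "s = ind_pure k h g n m"
      and c: "k \<in> carrier K" "h \<in> carrier H" "g \<in> carrier G" "n \<in> carrier N" "m \<in> carrier M" by blast
    obtain t k0 u v g0 where *: "t \<in> T" "(k0, u) \<in> Y" "(v, g0) \<in> X" "h = u \<otimes>\<^bsub>H\<^esub> t \<otimes>\<^bsub>H\<^esub> v"
      by (rule rep_decomposition[OF c(2)])
    note cl = Y_closed[OF *(2)] X_closed[OF *(3)] T_closed[OF *(1)]
    have nc: "N.act (inv\<^bsub>K\<^esub> k0, inv\<^bsub>H\<^esub> u) n \<in> carrier N" by (rule N.act_closed[OF Y_inv[OF *(2)] c(4)])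
    \<comment> \<open>Left multiplication by \<open>k'\<close> leaves \<open>h\<close> alone, so one
      decomposition serves for both sides; the scalar is absorbed by \<open>n\<close>.\<close>
    have "\<Phi> (a \<odot>\<^bsub>IT\<^esub> s) = sum_val t k0 u v g0 (k' \<otimes>\<^bsub>K\<^esub> k) g (N.scal r n) m"
      using a c Nc[OF a(3) c(4)] by (simp add: s IT_left \<Phi>(2) f_eq[OF *] del: one_DirProd)
    also have "\<dots> = a \<odot>\<^bsub>S.D\<^esub> sum_val t k0 u v g0 k g n m"
      using a c cl nc M.act_closed[OF *(3) c(5)]
      by (simp add: sum_val_def S.sum_inj_smult[OF *(1)] K.ga_single_closed mid_ind_closed[OF cl(5)] BD_left[OF cl(5)]
          N.act_scal[OF Y_inv[OF *(2)]] K.G.m_assoc del: one_DirProd)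
    also have "\<dots> = a \<odot>\<^bsub>S.D\<^esub> \<Phi> s" using c by (simp add: s \<Phi>(2) f_eq[OF *])
    finally show "\<Phi> (a \<odot>\<^bsub>IT\<^esub> s) = a \<odot>\<^bsub>S.D\<^esub> \<Phi> s" .
  qed
  have right: "\<Phi> (x \<odot>r\<^bsub>IT\<^esub> b) = \<Phi> x \<odot>r\<^bsub>S.D\<^esub> b" if x: "x \<in> carrier IT" and b: "b \<in> carrier G.RG" for x b
  proof (rule biadditive_eqI[OF IT_generates G.ga_generates biadditive_comp_hom[OF biIT(2) \<Phi>(1)]
        biadditive_comp[OF biD(2) \<Phi>(1) add_hom_ident] _ x b])
    fix s b assume "b \<in> ga_singles R (carrier G)" and "s \<in> IT_gens"
    then obtain g' r k h g n m where b: "b = ga_single R g' r" "g' \<in> carrier G" "r \<in> carrier R"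
      and s: "s = ind_pure k h g n m"
      and c: "k \<in> carrier K" "h \<in> carrier H" "g \<in> carrier G" "n \<in> carrier N" "m \<in> carrier M" by blast
    obtain t k0 u v g0 where *: "t \<in> T" "(k0, u) \<in> Y" "(v, g0) \<in> X" "h = u \<otimes>\<^bsub>H\<^esub> t \<otimes>\<^bsub>H\<^esub> v"
      by (rule rep_decomposition[OF c(2)])
    note cl = Y_closed[OF *(2)] X_closed[OF *(3)] T_closed[OF *(1)]
    have nc: "N.act (inv\<^bsub>K\<^esub> k0, inv\<^bsub>H\<^esub> u) n \<in> carrier N" by (rule N.act_closed[OF Y_inv[OF *(2)] c(4)])
    \<comment> \<open>Here \<open>g'\<close> enters as its inverse on the left of the
      \<open>G\<close>-component, while \<open>g0^-1\<close> stands on its right, so again one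
      decomposition serves for both sides; the scalar is absorbed by \<open>m\<close>.\<close>
    have "\<Phi> (s \<odot>r\<^bsub>IT\<^esub> b) = sum_val t k0 u v g0 k (inv\<^bsub>G\<^esub> g' \<otimes>\<^bsub>G\<^esub> g) n (M.scal r m)"
      using b c Mc[OF b(3) c(5)] by (simp add: s IT_right \<Phi>(2) f_eq[OF *] del: one_DirProd)
    also have "\<dots> = sum_val t k0 u v g0 k g n m \<odot>r\<^bsub>S.D\<^esub> b"
      using b c cl nc M.act_closed[OF *(3) c(5)]
      by (simp add: sum_val_def S.sum_inj_rsmult[OF *(1)] G.ga_single_closed mid_ind_closed[OF cl(5)] BD_right[OF cl(5)]
          M.act_scal[OF *(3)] G.G.m_assoc del: one_DirProd)
    also have "\<dots> = \<Phi> s \<odot>r\<^bsub>S.D\<^esub> b" using c by (simp add: s \<Phi>(2) f_eq[OF *])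
    finally show "\<Phi> (s \<odot>r\<^bsub>IT\<^esub> b) = \<Phi> s \<odot>r\<^bsub>S.D\<^esub> b" .
  qed
  have "\<Phi> \<in> bimodule_isos K.RG G.RG IT S.D"
    using bij left right add_hom_add[OF \<Phi>(1)] by (simp add: bimodule_isos_def)
  then show ?thesis
    using IT.bimodule_axioms D.bimodule_axioms by (auto simp: bimodule_isomorphic_def)
qed

end

end

theorem theorem1p1:
  fixes R :: "'r ring"
    and G :: "'g monoid" and H :: "'h monoid" and K :: "'k monoid"
    and X :: "('h \<times> 'g) set" and Y :: "('k \<times> 'h) set"
    and M :: "('h \<times> 'g \<Rightarrow> 'r, 'm) module" and N :: "('k \<times> 'h \<Rightarrow> 'r, 'n) module"
    and T :: "'h set"
  assumes "cring R"
    and "group G" and "finite (carrier G)"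
    and "group H" and "finite (carrier H)"
    and "group K" and "finite (carrier K)"
    and "subgroup X (H \<times>\<times> G)"
    and "subgroup Y (K \<times>\<times> H)"
    and "left_module (subgroup_algebra R (H \<times>\<times> G) X) M"
    and "left_module (subgroup_algebra R (K \<times>\<times> H) Y) N"
    and "double_coset_reps H (proj2 K H Y) (proj1 H G X) T"
  shows "(\<forall>t\<in>T.
      left_module (subgroup_algebra R (K \<times>\<times> G) (star_conj K H G Y t X))
        (mid_module R K H G Y t X N M) \<and>
      (\<forall>(k, g)\<in>star_conj K H G Y t X. \<forall>h\<in>carrier H.
        (k, h) \<in> Y \<and> (conj_by H t h, g) \<in> X \<longrightarrow>
        (\<forall>n\<in>carrier N. \<forall>m\<in>carrier M.
          group_act R (mid_module R K H G Y t X N M) (k, g)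
              (mid_pure_tensor R K H G Y t X N M n m) =
            mid_pure_tensor R K H G Y t X N M
              (group_act R N (k, h) n) (group_act R M (conj_by H t h, g) m)))) \<and>
    bimodule_isomorphic (group_algebra R K) (group_algebra R G)
      (tensor_bimodule (group_algebra R H)
        (as_bimodule R K H (Ind R (K \<times>\<times> H) Y N))
        (as_bimodule R H G (Ind R (H \<times>\<times> G) X M)))
      (bimodule_direct_sum T (\<lambda>t. as_bimodule R K G
        (Ind R (K \<times>\<times> G) (star_conj K H G Y t X) (mid_module R K H G Y t X N M))))"
proof -
  have algebras: "finite_group_algebra R K" "finite_group_algebra R H" "finite_group_algebra R G"
    using assms(1-7) by (simp_all add: finite_group_algebra_def finite_group_algebra_axioms_def)
  interpret induced_pair R K H G Y X N M
    by (intro induced_pair.intro induced_module.intro induced_module_axioms.intro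
        finite_group_algebra_DirProd algebras assms(8-11))
  have "left_module (subgroup_algebra R (K \<times>\<times> G) (star_conj K H G Y t X)) (mid_module R K H G Y t X N M)"
    if "t \<in> T" for t
    by (rule MM_module[OF T_closed[OF assms(12) that]])
  moreover have "group_act R (mid_module R K H G Y t X N M) (k, g) (mid_pure_tensor R K H G Y t X N M n m) =
      mid_pure_tensor R K H G Y t X N M (group_act R N (k, h) n) (group_act R M (conj_by H t h, g) m)"
    if "t \<in> T" "(k, h) \<in> Y" "(conj_by H t h, g) \<in> X" "n \<in> carrier N" "m \<in> carrier M" for t k h g n m
    by (rule MM_act_pure[OF T_closed[OF assms(12) that(1)] that(2-)])
  ultimately show ?thesis
    using bimodule_isomorphic_sum[OF assms(12)] by auto
qed

end
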